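(* For $\alpha\in\mathbf Z/5\mathbf Z$ let $\mathcal L^{(\alpha)}=\mathcal L^{(\alpha)}(z_1^{(\alpha)},z_2^{(\alpha)})$ be the fundamental solution, normalized at the vertex $P_\alpha$, of the KZ equation of two variables $(\mathrm{KZE2}_\alpha)$, and put $\varPhi^{(\alpha)}_{\rm KZ}=\varPhi_{\rm KZ}(X_1^{(\alpha)},X_{11}^{(\alpha)})$, where $\varPhi_{\rm KZ}$ is the Drinfel'd associator (all defined in the context). Then: (1) On the open pentagon $\{0<z_1<1,\ 0<z_2<1\}$, $$\mathcal L^{(\alpha)}=\mathcal L^{(\alpha+1)}\,\varPhi^{(\alpha)}_{\rm KZ}\qquad(\alpha=0,1,2,3,4 \pmod 5).$$ (2) Consequently (as the compatibility condition of the relations in (1)) the pentagon relation of the Drinfel'd associator holds: $$\varPhi^{(4)}_{\rm KZ}\,\varPhi^{(3)}_{\rm KZ}\,\varPhi^{(2)}_{\rm KZ}\,\varPhi^{(1)}_{\rm KZ}\,\varPhi^{(0)}_{\rm KZ}=\mathbf I .$$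
   Context: **Lie algebra.** $\mathfrak X$ is the complex Lie algebra generated by $\varOmega_{ij}$ ($1\le i,j\le 5$) with defining relations $\varOmega_{ij}=\varOmega_{ji}$, $\varOmega_{ii}=0$; $\sum_{j=1}^5\varOmega_{ij}=0$ for every $i$; $[\varOmega_{ij},\varOmega_{kl}]=0$ if $\{i,j\}\cap\{k,l\}=\emptyset$. Its universal enveloping algebra $\mathcal U=\mathcal U(\mathfrak X)$ is graded with $\deg\varOmega_{ij}=1$; $\widetilde{\mathcal U}$ denotes the completion of $\mathcal U$ with respect to this grading and $\mathbf I$ its unit. Functions take values in $\widetilde{\mathcal U}$, and holomorphy is understood degree by degree. For a function $f$ with a chosen logarithm and $X\in\mathfrak X$ homogeneous of degree 1, $f^{X}=\exp(X\log f)$. **Coordinates.** $(z_1,z_2)$ are the cubic coordinates on $\mathcal M_{0,5}=\mathrm{PGL}(2,\mathbf C)\backslash\{(x_1,\dots,x_5)\in(\mathbf P^1)^5: x_i\ne x_j\ (i\neq j)\}$: $$z_1=\frac{(x_1-x_3)(x_4-x_5)}{(x_1-x_5)(x_4-x_3)},\qquad z_2=\frac{(x_2-x_3)(x_1-x_5)}{(x_2-x_5)(x_1-x_3)}.$$ Set $(z_1^{(0)},z_2^{(0)})=(z_1,z_2)$ and $$z_1^{(\alpha+1)}=z_2^{(\alpha)},\qquad z_2^{(\alpha+1)}=\frac{1-z_1^{(\alpha)}}{1-z_1^{(\alpha)}z_2^{(\alpha)}}.$$ This sequence has period 5 in $\alpha$. The open square $\{0<z_1<1,0<z_2<1\}$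 is the interior of a pentagon (a component of $\mathcal M_{0,5}(\mathbf R)$) with vertices $P_0,\dots,P_4$, and $(z_1^{(\alpha)},z_2^{(\alpha)})$ is a local coordinate system around the vertex $P_\alpha=\{z_1^{(\alpha)}=z_2^{(\alpha)}=0\}$ taking values in $(0,1)^2$ on the open pentagon. **Coefficients.** Let $$X_1^{(0)}=\varOmega_{12}+\varOmega_{13}+\varOmega_{23}\ (=\varOmega_{45}),\quad X_2^{(0)}=\varOmega_{23},\quad X_{11}^{(0)}=-\varOmega_{14},\quad X_{22}^{(0)}=-\varOmega_{12},\quad X_{12}^{(0)}=-\varOmega_{24}.$$ Let $\sigma$ be the permutation $1\mapsto5,\ 2\mapsto4,\ 3\mapsto1,\ 4\mapsto3,\ 5\mapsto2$ (a 5-cycle), and let $\sigma_*^{-1}:\mathfrak X\to\mathfrak X$ be the automorphism $\varOmega_{ij}\mapsto\varOmega_{\sigma(i)\sigma(j)}$. Put $X_i^{(\alpha+1)}=\sigma_*^{-1}(X_i^{(\alpha)})$ and $X_{ij}^{(\alpha+1)}=\sigma_*^{-1}(X_{ij}^{(\alpha)})$; the index $\alpha$ is taken mod 5. **Equation and normalized solutions.** For each $\alpha$, $(\mathrm{KZE2}_\alpha)$ is $$dG=\bigl(\xi^{(\alpha)}_1X^{(\alpha)}_1+\xi^{(\alpha)}_{11}X^{(\alpha)}_{11}+\xi^{(\alpha)}_2X^{(\alpha)}_2+\xi^{(\alpha)}_{22}X^{(\alpha)}_{22}+\xi^{(\alpha)}_{12}X^{(\alpha)}_{12}\bigr)G,$$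 $$\xi_i^{(\alpha)}=\frac{dz_i^{(\alpha)}}{z_i^{(\alpha)}},\quad \xi_{ii}^{(\alpha)}=\frac{dz_i^{(\alpha)}}{1-z_i^{(\alpha)}}\ (i=1,2),\quad \xi_{12}^{(\alpha)}=\frac{d(z_1^{(\alpha)}z_2^{(\alpha)})}{1-z_1^{(\alpha)}z_2^{(\alpha)}}.$$ (All five are the same Pfaffian system written in different coordinates.) $\mathcal L^{(\alpha)}$ is the unique solution of the form $$\mathcal L^{(\alpha)}=\widehat{\mathcal L}^{(\alpha)}(z_1^{(\alpha)},z_2^{(\alpha)})\,(z_1^{(\alpha)})^{X_1^{(\alpha)}}(z_2^{(\alpha)})^{X_2^{(\alpha)}},$$ with $\widehat{\mathcal L}^{(\alpha)}$ holomorphic at $(z_1^{(\alpha)},z_2^{(\alpha)})=(0,0)$ and $\widehat{\mathcal L}^{(\alpha)}(0,0)=\mathbf I$. On the open pentagon, the real logarithms of $z_i^{(\alpha)}\in(0,1)$ are used, and $\mathcal L^{(\alpha)}$ is extended to the whole open pentagon (indeed to a domain containing it) by analytic continuation. **Drinfel'd associator.** Let $S=\mathbf C\langle\xi_0,\xi_1\rangle$ be the vector space spanned by words in two letters $\xi_0,\xi_1$, with the shuffle product $ш$ and unit the empty word $\mathbf 1$. Let $S^{10}=\mathbf C\mathbf 1\oplus\xi_0S\xi_1$, a shuffle subalgebra. Every $u\in S$ is uniquely a finite sum $u=\sum_{i,j}\xi_1^{i}\,ш\,w_{ij}\,ш\,\xi_0^{j}$ with $w_{ij}\in S^{10}$;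 put $\mathrm{reg}^{10}(u)=w_{00}$. Let $\zeta:S^{10}\to\mathbf C$ be the linear map with $\zeta(\mathbf 1)=1$ and $$\zeta(\xi_0^{k_1-1}\xi_1\cdots\xi_0^{k_r-1}\xi_1)=\sum_{n_1>\cdots>n_r>0}\frac1{n_1^{k_1}\cdots n_r^{k_r}}\qquad(k_1\ge2).$$ For $A,B\in\mathfrak X$ homogeneous of degree 1, $$\varPhi_{\rm KZ}(A,B)=\sum_{w}\zeta(\mathrm{reg}^{10}(w))\,W\in\widetilde{\mathcal U},$$ where $w$ runs over all words in $\xi_0,\xi_1$ and $W$ is obtained from $w$ by replacing $\xi_0$ by $A$ and $\xi_1$ by $B$ (keeping the order of letters). *)

theory Defs
  imports
    "HOL-Analysis.Analysis"
    "HOL-Computational_Algebra.Formal_Power_Series"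
    "HOL-Library.Poly_Mapping"
    "HOL-Library.Groups_Big_Fun"
begin

section \<open>Complex vector spaces, algebras and Lie algebras as type classes\<close>

class scaleC =
  fixes scaleC :: "complex \<Rightarrow> 'a \<Rightarrow> 'a"  (infixr "*\<^sub>C" 75)

class complex_vector = scaleC + ab_group_add +
  assumes scaleC_add_right: "c *\<^sub>C (x + y) = c *\<^sub>C x + c *\<^sub>C y"
    and scaleC_add_left: "(c + d) *\<^sub>C x = c *\<^sub>C x + d *\<^sub>C x"
    and scaleC_scaleC [simp]: "c *\<^sub>C d *\<^sub>C x = (c * d) *\<^sub>C x"
    and scaleC_one [simp]: "1 *\<^sub>C x = x"

class complex_algebra_1 = complex_vector + ring_1 +
  assumes mult_scaleC_left [simp]: "(c *\<^sub>C x) * y = c *\<^sub>C (x * y)"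
    and mult_scaleC_right [simp]: "x * (c *\<^sub>C y) = c *\<^sub>C (x * y)"

class complex_lie_algebra = complex_vector +
  fixes bracket :: "'a \<Rightarrow> 'a \<Rightarrow> 'a"
  assumes bracket_add_left: "bracket (x + y) z = bracket x z + bracket y z"
    and bracket_add_right: "bracket x (y + z) = bracket x y + bracket x z"
    and bracket_scaleC_left: "bracket (c *\<^sub>C x) y = c *\<^sub>C bracket x y"
    and bracket_scaleC_right: "bracket x (c *\<^sub>C y) = c *\<^sub>C bracket x y"
    and bracket_self: "bracket x x = 0"
    and jacobi: "bracket x (bracket y z) + bracket y (bracket z x) + bracket z (bracket x y) = 0"

global_interpretation complex_vector:
  vector_space "scaleC :: complex \<Rightarrow> 'a \<Rightarrow> 'a::complex_vector"
  by unfold_locales (simp_all add: scaleC_add_right scaleC_add_left)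


section \<open>The Lie algebra\<close>

text \<open>
  Formal Lie expressions, and the least congruence that contains the axioms of complex Lie
  algebras and the defining relations. The index set \<open>{1,\<dots>,5}\<close> is the type \<^typ>\<open>5\<close>,
  in which the numeral 5 is another name of 0.
\<close>

datatype 'g lie_term =
    LGen 'g
  | LZero
  | LAdd "'g lie_term" "'g lie_term"
  | LScale complex "'g lie_term"
  | LBr "'g lie_term" "'g lie_term"

inductive lie_eq :: "(5 \<times> 5) lie_term \<Rightarrow> (5 \<times> 5) lie_term \<Rightarrow> bool" where
  lrefl: "lie_eq x x"
| lsym: "lie_eq x y \<Longrightarrow> lie_eq y x"
| ltrans: "lie_eq x y \<Longrightarrow> lie_eq y z \<Longrightarrow> lie_eq x z"
| ladd_cong: "lie_eq x x' \<Longrightarrow> lie_eq y y' \<Longrightarrow> lie_eq (LAdd x y) (LAdd x' y')"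
| lscale_cong: "lie_eq x x' \<Longrightarrow> lie_eq (LScale c x) (LScale c x')"
| lbr_cong: "lie_eq x x' \<Longrightarrow> lie_eq y y' \<Longrightarrow> lie_eq (LBr x y) (LBr x' y')"
| ladd_assoc: "lie_eq (LAdd (LAdd x y) z) (LAdd x (LAdd y z))"
| ladd_comm: "lie_eq (LAdd x y) (LAdd y x)"
| ladd_zero: "lie_eq (LAdd LZero x) x"
| ladd_neg: "lie_eq (LAdd (LScale (-1) x) x) LZero"
| lscale_add_right: "lie_eq (LScale c (LAdd x y)) (LAdd (LScale c x) (LScale c y))"
| lscale_add_left: "lie_eq (LScale (c + d) x) (LAdd (LScale c x) (LScale d x))"
| lscale_scale: "lie_eq (LScale c (LScale d x)) (LScale (c * d) x)"
| lscale_one: "lie_eq (LScale 1 x) x"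
| lbr_add_left: "lie_eq (LBr (LAdd x y) z) (LAdd (LBr x z) (LBr y z))"
| lbr_add_right: "lie_eq (LBr x (LAdd y z)) (LAdd (LBr x y) (LBr x z))"
| lbr_scale_left: "lie_eq (LBr (LScale c x) y) (LScale c (LBr x y))"
| lbr_scale_right: "lie_eq (LBr x (LScale c y)) (LScale c (LBr x y))"
| lbr_self: "lie_eq (LBr x x) LZero"
| lbr_jacobi: "lie_eq (LAdd (LAdd (LBr x (LBr y z)) (LBr y (LBr z x))) (LBr z (LBr x y))) LZero"
| omega_symmetric: "lie_eq (LGen (i, j)) (LGen (j, i))"
| omega_diagonal: "lie_eq (LGen (i, i)) LZero"
| omega_row_sum: "lie_eq (LAdd (LGen (i, 1)) (LAdd (LGen (i, 2)) (LAdd (LGen (i, 3))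
      (LAdd (LGen (i, 4)) (LGen (i, 5)))))) LZero"
| omega_commute: "{i, j} \<inter> {k, l} = {} \<Longrightarrow> lie_eq (LBr (LGen (i, j)) (LGen (k, l))) LZero"

lemmas lie_axioms = ladd_assoc ladd_comm ladd_zero ladd_neg lscale_add_right lscale_add_left
  lscale_scale lscale_one lbr_add_left lbr_add_right lbr_scale_left lbr_scale_right lbr_self
  lbr_jacobi

quotient_type kz_lie = "(5 \<times> 5) lie_term" / lie_eq
  by (intro equivpI reflpI sympI transpI) (fact lrefl, fact lsym, fact ltrans)

instantiation kz_lie :: complex_lie_algebra
begin

lift_definition zero_kz_lie :: kz_lie is LZero .
lift_definition plus_kz_lie :: "kz_lie \<Rightarrow> kz_lie \<Rightarrow> kz_lie" is LAdd by (rule ladd_cong)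
lift_definition uminus_kz_lie :: "kz_lie \<Rightarrow> kz_lie" is "LScale (-1)" by (rule lscale_cong)
lift_definition minus_kz_lie :: "kz_lie \<Rightarrow> kz_lie \<Rightarrow> kz_lie" is "\<lambda>x y. LAdd x (LScale (-1) y)"
  by (intro ladd_cong lscale_cong)
lift_definition scaleC_kz_lie :: "complex \<Rightarrow> kz_lie \<Rightarrow> kz_lie" is LScale by (rule lscale_cong)
lift_definition bracket_kz_lie :: "kz_lie \<Rightarrow> kz_lie \<Rightarrow> kz_lie" is LBr by (rule lbr_cong)

instance
  by standard (transfer, rule lie_axioms lrefl)+

end

lift_definition Omega :: "5 \<Rightarrow> 5 \<Rightarrow> kz_lie" is "\<lambda>i j. LGen (i, j)" .

lemma Omega_row_sum: "Omega i 1 + (Omega i 2 + (Omega i 3 + (Omega i 4 + Omega i 5))) = 0"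
  by transfer (rule omega_row_sum)

lemma Omega_row_sum_permuted:
  "Omega i 5 + (Omega i 4 + (Omega i 1 + (Omega i 3 + Omega i 2))) = 0"
  using Omega_row_sum[of i] by (simp only: ac_simps)

definition index_perm :: "5 \<Rightarrow> 5" where
  "index_perm i = (if i = 1 then 5 else if i = 2 then 4 else if i = 3 then 1
     else if i = 4 then 3 else 2)"

lemma index5_cases:
  obtains "(i::5) = 1" | "i = 2" | "i = 3" | "i = 4" | "i = 5"
proof (cases i)
  case (of_int z)
  then have "z = 0 \<or> z = 1 \<or> z = 2 \<or> z = 3 \<or> z = 4" by auto
  then show ?thesis using of_int that by auto
qed

lemma inj_index_perm: "inj index_perm"
proof (rule injI)
  fix i j :: 5
  assume "index_perm i = index_perm j"
  then show "i = j"
    by (cases i rule: index5_cases; cases j rule: index5_cases) (simp_all add: index_perm_def)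
qed

text \<open>
  The automorphism \<open>\<sigma>\<^sub>*\<^sup>-\<^sup>1\<close>, induced by the permutation \<open>\<sigma>\<close> of the indices (\<^const>\<open>index_perm\<close>).
\<close>

lift_definition sigma_aut :: "kz_lie \<Rightarrow> kz_lie" is "map_lie_term (map_prod index_perm index_perm)"
proof -
  fix x y assume "lie_eq x y"
  then show "lie_eq (map_lie_term (map_prod index_perm index_perm) x) (map_lie_term (map_prod index_perm index_perm) y)"
  proof induction
    case (ltrans x y z)
    show ?case by (rule lie_eq.ltrans[OF ltrans.IH])
  next
    case (omega_row_sum i)
    show ?case
      using Omega_row_sum_permuted[of "index_perm i"] by (transfer, simp add: index_perm_def)
  next
    case (omega_commute i j k l)
    then show ?case
      using inj_index_perm by (auto simp: inj_eq intro!: lie_eq.omega_commute)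
  qed (simp_all add: lrefl lsym ladd_cong lscale_cong lbr_cong lie_axioms omega_symmetric
      omega_diagonal)
qed

lemma sigma_aut_Omega [simp]: "sigma_aut (Omega i j) = Omega (index_perm i) (index_perm j)"
  by transfer (simp add: lrefl)

lemma sigma_aut_hom:
  "sigma_aut (x + y) = sigma_aut x + sigma_aut y"
  "sigma_aut (c *\<^sub>C x) = c *\<^sub>C sigma_aut x"
  "sigma_aut (bracket x y) = bracket (sigma_aut x) (sigma_aut y)"
  by (transfer, simp add: lrefl)+


section \<open>Universal enveloping algebras\<close>

text \<open>
  The unital associative complex algebra generated by the elements of a Lie algebra, subject to
  linearity of the inclusion and \<open>[x, y] = x y - y x\<close>.
\<close>

datatype 'l uea_term =
    UIn 'l
  | UZero
  | UOne
  | UAdd "'l uea_term" "'l uea_term"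
  | UScale complex "'l uea_term"
  | UMul "'l uea_term" "'l uea_term"

inductive uea_eq :: "'l::complex_lie_algebra uea_term \<Rightarrow> 'l uea_term \<Rightarrow> bool" where
  urefl: "uea_eq x x"
| usym: "uea_eq x y \<Longrightarrow> uea_eq y x"
| utrans: "uea_eq x y \<Longrightarrow> uea_eq y z \<Longrightarrow> uea_eq x z"
| uadd_cong: "uea_eq x x' \<Longrightarrow> uea_eq y y' \<Longrightarrow> uea_eq (UAdd x y) (UAdd x' y')"
| uscale_cong: "uea_eq x x' \<Longrightarrow> uea_eq (UScale c x) (UScale c x')"
| umul_cong: "uea_eq x x' \<Longrightarrow> uea_eq y y' \<Longrightarrow> uea_eq (UMul x y) (UMul x' y')"
| uadd_assoc: "uea_eq (UAdd (UAdd x y) z) (UAdd x (UAdd y z))"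
| uadd_comm: "uea_eq (UAdd x y) (UAdd y x)"
| uadd_zero: "uea_eq (UAdd UZero x) x"
| uadd_neg: "uea_eq (UAdd (UScale (-1) x) x) UZero"
| uscale_add_right: "uea_eq (UScale c (UAdd x y)) (UAdd (UScale c x) (UScale c y))"
| uscale_add_left: "uea_eq (UScale (c + d) x) (UAdd (UScale c x) (UScale d x))"
| uscale_scale: "uea_eq (UScale c (UScale d x)) (UScale (c * d) x)"
| uscale_one: "uea_eq (UScale 1 x) x"
| umul_assoc: "uea_eq (UMul (UMul x y) z) (UMul x (UMul y z))"
| umul_one_left: "uea_eq (UMul UOne x) x"
| umul_one_right: "uea_eq (UMul x UOne) x"
| umul_add_left: "uea_eq (UMul (UAdd x y) z) (UAdd (UMul x z) (UMul y z))"
| umul_add_right: "uea_eq (UMul x (UAdd y z)) (UAdd (UMul x y) (UMul x z))"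
| umul_scale_left: "uea_eq (UMul (UScale c x) y) (UScale c (UMul x y))"
| umul_scale_right: "uea_eq (UMul x (UScale c y)) (UScale c (UMul x y))"
| uin_add: "uea_eq (UIn (a + b)) (UAdd (UIn a) (UIn b))"
| uin_scale: "uea_eq (UIn (c *\<^sub>C a)) (UScale c (UIn a))"
| uin_bracket: "uea_eq (UIn (bracket a b))
    (UAdd (UMul (UIn a) (UIn b)) (UScale (-1) (UMul (UIn b) (UIn a))))"

lemmas uea_axioms = uadd_assoc uadd_comm uadd_zero uadd_neg uscale_add_right uscale_add_left
  uscale_scale uscale_one umul_assoc umul_one_left umul_one_right umul_add_left umul_add_right
  umul_scale_left umul_scale_right

quotient_type (overloaded) 'l uea = "'l::complex_lie_algebra uea_term" / uea_eq
  by (intro equivpI reflpI sympI transpI) (fact urefl, fact usym, fact utrans)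

primrec uea_augment :: "'l uea_term \<Rightarrow> complex" where
  "uea_augment (UIn a) = 0"
| "uea_augment UZero = 0"
| "uea_augment UOne = 1"
| "uea_augment (UAdd x y) = uea_augment x + uea_augment y"
| "uea_augment (UScale c x) = c * uea_augment x"
| "uea_augment (UMul x y) = uea_augment x * uea_augment y"

lemma uea_augment_cong: "uea_eq x y \<Longrightarrow> uea_augment x = uea_augment y"
  by (induction rule: uea_eq.induct) (simp_all add: algebra_simps)

instantiation uea :: (complex_lie_algebra) complex_algebra_1
begin

lift_definition zero_uea :: "'a uea" is UZero .
lift_definition one_uea :: "'a uea" is UOne .
lift_definition plus_uea :: "'a uea \<Rightarrow> 'a uea \<Rightarrow> 'a uea" is UAdd by (rule uadd_cong)
lift_definition uminus_uea :: "'a uea \<Rightarrow> 'a uea" is "UScale (-1)" by (rule uscale_cong)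
lift_definition minus_uea :: "'a uea \<Rightarrow> 'a uea \<Rightarrow> 'a uea" is "\<lambda>x y. UAdd x (UScale (-1) y)"
  by (intro uadd_cong uscale_cong)
lift_definition scaleC_uea :: "complex \<Rightarrow> 'a uea \<Rightarrow> 'a uea" is UScale by (rule uscale_cong)
lift_definition times_uea :: "'a uea \<Rightarrow> 'a uea \<Rightarrow> 'a uea" is UMul by (rule umul_cong)

instance
proof
  show "(0::'a uea) \<noteq> 1"
    by transfer (auto dest: uea_augment_cong)
qed (transfer, rule uea_axioms urefl)+

end

lift_definition uea_in :: "'l::complex_lie_algebra \<Rightarrow> 'l uea" is UIn .


section \<open>The grading of the enveloping algebra and its completion\<close>

text \<open>
  The defining relations are homogeneous, so the enveloping algebra is the direct sum of the
  subspaces \<open>uea_deg n\<close>, and its completion is their product. The latter is realised as the ring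
  of all power series over the enveloping algebra whose \<open>n\<close>-th coefficient has degree \<open>n\<close>.
\<close>

definition uea_deg :: "nat \<Rightarrow> kz_lie uea set" where
  "uea_deg n = complex_vector.span
     {prod_list xs | xs. length xs = n \<and> set xs \<subseteq> {uea_in (Omega i j) | i j. True}}"

lemma subspace_uea_deg: "complex_vector.subspace (uea_deg n)"
  unfolding uea_deg_def by (rule complex_vector.subspace_span)

lemma uea_deg_one: "1 \<in> uea_deg 0"
  unfolding uea_deg_def by (rule complex_vector.span_base) force

lemma uea_deg_mult:
  assumes "x \<in> uea_deg m" "y \<in> uea_deg n"
  shows "x * y \<in> uea_deg (m + n)"
proof -
  have base: "prod_list xs * prod_list ys \<in> uea_deg (length xs + length ys)"
    if "set xs \<subseteq> {uea_in (Omega i j) | i j. True}" "set ys \<subseteq> {uea_in (Omega i j) | i j. True}"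
    for xs ys
    unfolding uea_deg_def using that
    by (intro complex_vector.span_base CollectI exI[of _ "xs @ ys"]) auto
  have left: "prod_list xs * y \<in> uea_deg (m + n)"
    if xs: "length xs = m" "set xs \<subseteq> {uea_in (Omega i j) | i j. True}" for xs
    using assms(2) unfolding uea_deg_def[of n]
  proof (induction rule: complex_vector.span_induct)
    case base
    show ?case
      unfolding complex_vector.subspace_def
      using complex_vector.subspace_0[OF subspace_uea_deg]
        complex_vector.subspace_add[OF subspace_uea_deg]
        complex_vector.subspace_scale[OF subspace_uea_deg]
      by (auto simp: distrib_left)
  next
    case (step y)
    then show ?case using base xs by auto
  qed
  show ?thesis
    using assms(1) unfolding uea_deg_def[of m]
  proof (induction rule: complex_vector.span_induct)
    case base
    show ?case
      unfolding complex_vector.subspace_def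
      using complex_vector.subspace_0[OF subspace_uea_deg]
        complex_vector.subspace_add[OF subspace_uea_deg]
        complex_vector.subspace_scale[OF subspace_uea_deg]
      by (auto simp: distrib_right)
  next
    case (step x)
    then show ?case using left by auto
  qed
qed

lemma uea_deg_sum: "(\<And>i. i \<in> A \<Longrightarrow> f i \<in> uea_deg n) \<Longrightarrow> sum f A \<in> uea_deg n"
  by (rule complex_vector.subspace_sum[OF subspace_uea_deg])

typedef kz_compl = "{f :: kz_lie uea fps. \<forall>n. fps_nth f n \<in> uea_deg n}"
  by (rule exI[of _ 0]) (simp add: complex_vector.subspace_0[OF subspace_uea_deg])

setup_lifting type_definition_kz_compl

instantiation kz_compl :: complex_algebra_1
begin

lift_definition zero_kz_compl :: kz_compl is 0
  by (simp add: complex_vector.subspace_0[OF subspace_uea_deg])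
lift_definition one_kz_compl :: kz_compl is 1
  by (simp add: uea_deg_one complex_vector.subspace_0[OF subspace_uea_deg])
lift_definition plus_kz_compl :: "kz_compl \<Rightarrow> kz_compl \<Rightarrow> kz_compl" is "(+)"
  by (simp add: complex_vector.subspace_add[OF subspace_uea_deg])
lift_definition uminus_kz_compl :: "kz_compl \<Rightarrow> kz_compl" is uminus
  by (simp add: complex_vector.subspace_neg[OF subspace_uea_deg])
lift_definition minus_kz_compl :: "kz_compl \<Rightarrow> kz_compl \<Rightarrow> kz_compl" is "(-)"
  by (simp add: complex_vector.subspace_diff[OF subspace_uea_deg])
lift_definition times_kz_compl :: "kz_compl \<Rightarrow> kz_compl \<Rightarrow> kz_compl" is "(*)"
proof -
  fix f g :: "kz_lie uea fps" and n
  assume "\<And>n. fps_nth f n \<in> uea_deg n" "\<And>n. fps_nth g n \<in> uea_deg n"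
  then have "fps_nth f i * fps_nth g (n - i) \<in> uea_deg n" if "i \<in> {0..n}" for i
    using uea_deg_mult[of "fps_nth f i" i "fps_nth g (n - i)" "n - i"] that by simp
  then show "fps_nth (f * g) n \<in> uea_deg n"
    unfolding fps_mult_nth by (rule uea_deg_sum)
qed
lift_definition scaleC_kz_compl :: "complex \<Rightarrow> kz_compl \<Rightarrow> kz_compl"
  is "\<lambda>c f. Abs_fps (\<lambda>n. c *\<^sub>C fps_nth f n)"
  by (simp add: complex_vector.subspace_scale[OF subspace_uea_deg])

instance
proof
  show "(0::kz_compl) \<noteq> 1" by transfer simp
qed (transfer, simp add: fps_eq_iff algebra_simps scaleC_add_right scaleC_add_left
      fps_mult_nth complex_vector.scale_sum_right)+

end

definition component :: "kz_compl \<Rightarrow> nat \<Rightarrow> kz_lie uea" where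
  "component x = fps_nth (Rep_kz_compl x)"

text \<open>
  The element of the completion given by a homogeneous element of degree 1 of the Lie algebra
  (0 on other elements of the Lie algebra).
\<close>

definition of_deg1 :: "kz_lie \<Rightarrow> kz_compl" where
  "of_deg1 x = Abs_kz_compl
     (Abs_fps (\<lambda>n. if n = 1 \<and> uea_in x \<in> uea_deg 1 then uea_in x else 0))"

text \<open>
  Infinite sums in the completion, for families with only finitely many nonzero components in
  each degree.
\<close>

lift_definition formal_sum :: "('i \<Rightarrow> kz_compl) \<Rightarrow> kz_compl"
  is "\<lambda>f. Abs_fps (\<lambda>n. Sum_any (\<lambda>i. fps_nth (f i) n))"
  by (simp add: Sum_any.expand_set uea_deg_sum)

text \<open>The exponential of an element with vanishing component in degree 0.\<close>

definition exp_compl :: "kz_compl \<Rightarrow> kz_compl" where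
  "exp_compl x = formal_sum (\<lambda>k. (1 / fact k) *\<^sub>C x ^ k)"

text \<open>\<open>f\<^sup>X\<close> with the principal logarithm, which is the real one if \<open>0 < f < 1\<close>.\<close>

definition pow_compl :: "complex \<Rightarrow> kz_compl \<Rightarrow> kz_compl" where
  "pow_compl f X = exp_compl (Ln f *\<^sub>C X)"


section \<open>Differentiation and holomorphy degree by degree\<close>

text \<open>
  The components \<open>uea_deg n\<close> are finite-dimensional, and their canonical topology is the one for
  which convergence means convergence under all linear functionals. \<open>has_differential G G' w\<close>
  says that every component of \<open>G\<close> has the total (Frechet) derivative \<open>G'\<close> at \<open>w\<close>.
\<close>

definition has_differential ::
    "(complex \<times> complex \<Rightarrow> kz_compl) \<Rightarrow> (complex \<times> complex \<Rightarrow> kz_compl)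
      \<Rightarrow> complex \<times> complex \<Rightarrow> bool" where
  "has_differential G G' w \<longleftrightarrow>
     (\<forall>n \<phi>. Vector_Spaces.linear (*\<^sub>C) (*) \<phi> \<longrightarrow>
        ((\<lambda>v. \<phi> (component (G v) n)) has_derivative (\<lambda>h. \<phi> (component (G' h) n))) (at w))"

definition holomorphic2_on ::
    "(complex \<times> complex \<Rightarrow> kz_compl) \<Rightarrow> (complex \<times> complex) set \<Rightarrow> bool" where
  "holomorphic2_on G D \<longleftrightarrow>
     (\<forall>w\<in>D. \<exists>A B. has_differential G (\<lambda>h. fst h *\<^sub>C A + snd h *\<^sub>C B) w)"


section \<open>The KZ equations and their normalized solutions\<close>

definition X1 :: "nat \<Rightarrow> kz_lie" where
  "X1 \<alpha> = (sigma_aut ^^ \<alpha>) (Omega 1 2 + Omega 1 3 + Omega 2 3)"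

definition X2 :: "nat \<Rightarrow> kz_lie" where
  "X2 \<alpha> = (sigma_aut ^^ \<alpha>) (Omega 2 3)"

definition X11 :: "nat \<Rightarrow> kz_lie" where
  "X11 \<alpha> = (sigma_aut ^^ \<alpha>) (- Omega 1 4)"

definition X22 :: "nat \<Rightarrow> kz_lie" where
  "X22 \<alpha> = (sigma_aut ^^ \<alpha>) (- Omega 1 2)"

definition X12 :: "nat \<Rightarrow> kz_lie" where
  "X12 \<alpha> = (sigma_aut ^^ \<alpha>) (- Omega 2 4)"

text \<open>The coordinates \<open>(z\<^sub>1\<^sup>(\<^sup>\<alpha>\<^sup>), z\<^sub>2\<^sup>(\<^sup>\<alpha>\<^sup>))\<close> as functions of \<open>(z\<^sub>1, z\<^sub>2)\<close>.\<close>

definition next_coords :: "complex \<times> complex \<Rightarrow> complex \<times> complex" where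
  "next_coords = (\<lambda>(z1, z2). (z2, (1 - z1) / (1 - z1 * z2)))"

definition coords :: "nat \<Rightarrow> complex \<times> complex \<Rightarrow> complex \<times> complex" where
  "coords \<alpha> = next_coords ^^ \<alpha>"

definition open_pentagon :: "(complex \<times> complex) set" where
  "open_pentagon = {(complex_of_real s, complex_of_real t) | s t. 0 < s \<and> s < 1 \<and> 0 < t \<and> t < 1}"

definition regular_points :: "(complex \<times> complex) set" where
  "regular_points = {(w1, w2). w1 \<noteq> 0 \<and> w2 \<noteq> 0 \<and> w1 \<noteq> 1 \<and> w2 \<noteq> 1 \<and> w1 * w2 \<noteq> 1}"

text \<open>
  The 1-form of the \<open>\<alpha>\<close>-th equation in its own coordinates \<open>w = z\<^sup>(\<^sup>\<alpha>\<^sup>)\<close>, at the point \<open>w\<close> and the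
  tangent vector \<open>h = (dw\<^sub>1, dw\<^sub>2)\<close>.
\<close>

definition KZE2_form ::
    "nat \<Rightarrow> complex \<times> complex \<Rightarrow> complex \<times> complex \<Rightarrow> kz_compl" where
  "KZE2_form \<alpha> = (\<lambda>(w1, w2) (h1, h2).
      (h1 / w1) *\<^sub>C of_deg1 (X1 \<alpha>) + (h1 / (1 - w1)) *\<^sub>C of_deg1 (X11 \<alpha>)
    + (h2 / w2) *\<^sub>C of_deg1 (X2 \<alpha>) + (h2 / (1 - w2)) *\<^sub>C of_deg1 (X22 \<alpha>)
    + ((w2 * h1 + w1 * h2) / (1 - w1 * w2)) *\<^sub>C of_deg1 (X12 \<alpha>))"

definition KZE2_solution_on ::
    "nat \<Rightarrow> (complex \<times> complex) set \<Rightarrow> (complex \<times> complex \<Rightarrow> kz_compl) \<Rightarrow> bool" where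
  "KZE2_solution_on \<alpha> D G \<longleftrightarrow>
     (\<forall>w\<in>D. has_differential G (\<lambda>h. KZE2_form \<alpha> w h * G w) w)"

text \<open>
  A single-valued analytic solution, as a function of \<open>w = z\<^sup>(\<^sup>\<alpha>\<^sup>)\<close>, on a domain \<open>D\<close> containing the
  open pentagon, which near the vertex \<open>w = (0, 0)\<close> has the normalized form (with real
  logarithms) on the open pentagon. Being analytic on the connected set \<open>D\<close>, it is the analytic
  continuation of its germ at the vertex. In each of the coordinates \<open>z\<^sup>(\<^sup>\<alpha>\<^sup>)\<close> the open pentagon is
  the open unit square.
\<close>

definition normalized_solution ::
    "nat \<Rightarrow> (complex \<times> complex \<Rightarrow> kz_compl) \<Rightarrow> bool" where
  "normalized_solution \<alpha> G \<longleftrightarrow>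
     (\<exists>D. open D \<and> connected D \<and> open_pentagon \<subseteq> D \<and> D \<subseteq> regular_points \<and>
        KZE2_solution_on \<alpha> D G) \<and>
     (\<exists>N H. open N \<and> (0, 0) \<in> N \<and> holomorphic2_on H N \<and> H (0, 0) = 1 \<and>
        (\<forall>w \<in> N \<inter> open_pentagon.
           G w = H w * pow_compl (fst w) (of_deg1 (X1 \<alpha>)) * pow_compl (snd w) (of_deg1 (X2 \<alpha>))))"

text \<open>
  The unique normalized solution, as a function on the open pentagon (two normalized solutions
  need not agree, or have the same domain, outside of it).
\<close>

definition KZ_solution :: "nat \<Rightarrow> complex \<times> complex \<Rightarrow> kz_compl" where
  "KZ_solution \<alpha> = (THE L. \<exists>G. normalized_solution \<alpha> G \<and> L = restrict G open_pentagon)"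


section \<open>The Drinfel'd associator\<close>

datatype letter = xi0 | xi1

type_synonym word_poly = "letter list \<Rightarrow>\<^sub>0 complex"

text \<open>The words of \<open>u \<amalg> v\<close>, with repetitions.\<close>

fun shuffle_words :: "'a list \<Rightarrow> 'a list \<Rightarrow> 'a list list" where
  "shuffle_words [] v = [v]"
| "shuffle_words u [] = [u]"
| "shuffle_words (a # u) (b # v) =
     map ((#) a) (shuffle_words u (b # v)) @ map ((#) b) (shuffle_words (a # u) v)"

definition shuffle_prod :: "word_poly \<Rightarrow> word_poly \<Rightarrow> word_poly"  (infixl "\<amalg>" 70) where
  "p \<amalg> q = (\<Sum>u \<in> Poly_Mapping.keys p. \<Sum>v \<in> Poly_Mapping.keys q. \<Sum>w \<leftarrow> shuffle_words u v.
      Poly_Mapping.single w (Poly_Mapping.lookup p u * Poly_Mapping.lookup q v))"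

definition word :: "letter list \<Rightarrow> word_poly" where
  "word w = Poly_Mapping.single w 1"

definition S10 :: "word_poly set" where
  "S10 = {p. \<forall>w \<in> Poly_Mapping.keys p. w = [] \<or> (\<exists>v. w = xi0 # v @ [xi1])}"

text \<open>
  \<open>W (0, 0)\<close> for the unique decomposition of \<open>u\<close> as the sum of \<open>\<xi>\<^sub>1\<^sup>i \<amalg> W (i, j) \<amalg> \<xi>\<^sub>0\<^sup>j\<close>; the powers are
  words, that is, concatenation powers.
\<close>

definition reg10 :: "word_poly \<Rightarrow> word_poly" where
  "reg10 u = (THE r. \<exists>W :: nat \<times> nat \<Rightarrow> word_poly.
      finite {ij. W ij \<noteq> 0} \<and> (\<forall>ij. W ij \<in> S10) \<and>
      u = (\<Sum>ij | W ij \<noteq> 0.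
             word (replicate (fst ij) xi1) \<amalg> W ij \<amalg> word (replicate (snd ij) xi0)) \<and>
      r = W (0, 0))"

definition index_word :: "nat list \<Rightarrow> letter list" where
  "index_word ks = concat (map (\<lambda>k. replicate (k - 1) xi0 @ [xi1]) ks)"

text \<open>The sum over \<open>n\<^sub>1 > \<dots> > n\<^sub>r > 0\<close>; it is 1 for the empty index.\<close>

definition mzv :: "nat list \<Rightarrow> real" where
  "mzv ks = (\<Sum>\<^sub>\<infinity> ns \<in> {ns. length ns = length ks \<and> sorted_wrt (>) ns \<and> (\<forall>n \<in> set ns. 0 < n)}.
      \<Prod>i < length ks. 1 / real (ns ! i) ^ (ks ! i))"

text \<open>The linear map \<open>\<zeta>\<close>, to be applied to elements of \<^const>\<open>S10\<close> only.\<close>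

definition zeta_word :: "letter list \<Rightarrow> real" where
  "zeta_word w = mzv (THE ks. (\<forall>k \<in> set ks. 1 \<le> k) \<and> index_word ks = w)"

definition zeta_map :: "word_poly \<Rightarrow> complex" where
  "zeta_map p = (\<Sum>w \<in> Poly_Mapping.keys p. Poly_Mapping.lookup p w * complex_of_real (zeta_word w))"

primrec letter_val :: "kz_compl \<Rightarrow> kz_compl \<Rightarrow> letter \<Rightarrow> kz_compl" where
  "letter_val A B xi0 = A"
| "letter_val A B xi1 = B"

definition Phi_KZ :: "kz_lie \<Rightarrow> kz_lie \<Rightarrow> kz_compl" where
  "Phi_KZ A B = formal_sum (\<lambda>w. zeta_map (reg10 (word w)) *\<^sub>C
      prod_list (map (letter_val (of_deg1 A) (of_deg1 B)) w))"

definition Phi :: "nat \<Rightarrow> kz_compl" where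
  "Phi \<alpha> = Phi_KZ (X1 \<alpha>) (X11 \<alpha>)"

end

theory Submission
  imports Defs "HOL-Analysis.FPS_Convergence"
begin

text \<open>
  Besides the axes, the polar divisors of the equation are \<open>w\<^sub>1 = 1\<close>, \<open>w\<^sub>2 = 1\<close> and
  \<open>w\<^sub>1 w\<^sub>2 = 1\<close>, and none of them meets the open unit bidisc. The regular part of the solution
  normalized at a vertex is therefore a power series that converges on the whole bidisc, and the
  formula \<open>regular part \<cdot> w\<^sub>1\<^sup>X \<cdot> w\<^sub>2\<^sup>Y\<close> describes the solution on the whole open pentagon. The
  coefficients of the series are forced by the Euler operator. That they satisfy the equation in
  each variable separately is the integrability of the form: it rests on the Lie relations
  \<open>X_relations\<close> and on the identity \<open>ab = c + ca + cb\<close> for \<open>a = w\<^sub>1 / (1 - w\<^sub>1)\<close>,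
  \<open>b = w\<^sub>2 / (1 - w\<^sub>2)\<close>, \<open>c = w\<^sub>1 w\<^sub>2 / (1 - w\<^sub>1 w\<^sub>2)\<close> (lemma \<open>connection_closed\<close>).

  Solutions are compared degree by degree. If two solutions agree in all degrees below \<open>n\<close>, their
  difference in degree \<open>n\<close> is constant on the pentagon, and it vanishes as soon as it tends to
  zero along some path (lemma \<open>solution_zeroI\<close>). A path to the vertex gives the uniqueness of the
  normalized solution. For the connection formula, the difference of \<open>\<L>\<^sup>(\<^sup>\<alpha>\<^sup>)\<close> and
  \<open>\<L>\<^sup>(\<^sup>\<alpha>\<^sup>+\<^sup>1\<^sup>) \<Phi>\<close> is followed to the edge \<open>z\<^sub>2 = 0\<close> that joins the two vertices, and then along
  the edge. The factor \<open>z\<^sub>2\<^sup>X\<close> with \<open>X = X\<^sub>2\<^sup>(\<^sup>\<alpha>\<^sup>)\<close> commutes with the other powers and with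
  \<open>\<Phi>\<close> and can be cancelled; there remain solutions of the equation in the one
  variable \<open>z\<^sub>1\<close> with the residues \<open>A = X\<^sub>1\<^sup>(\<^sup>\<alpha>\<^sup>)\<close> and \<open>B = X\<^sub>1\<^sub>1\<^sup>(\<^sup>\<alpha>\<^sup>)\<close>, and the claim becomes that
  \<open>(1 - z)\<^sup>B L(z)\<close> tends to \<open>\<Phi>(A, B)\<close> for \<open>z \<longrightarrow> 1\<close>, where \<open>L\<close> is normalized at 0.

  This limit is a statement on words. The series \<open>(1 - z)\<^sup>B L(z)\<close> is \<open>\<Sum>w. R(w) W\<close>, where \<open>R\<close> is a
  convolution of three functions on words, each of which is multiplicative for the shuffle
  product. So \<open>R\<close> is multiplicative, and \<open>R(\<xi>\<^sub>1) = log (1 - z) + (z + z\<^sup>2 / 2 + \<dots>) = 0\<close>,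
  \<open>R(\<xi>\<^sub>0) = log z\<close>. In the decomposition of a word \<open>w\<close> into terms \<open>\<xi>\<^sub>1\<^sup>i \<amalg> w\<^sub>i\<^sub>j \<amalg> \<xi>\<^sub>0\<^sup>j\<close> the terms with
  \<open>i > 0\<close> thus contribute nothing, those with \<open>j > 0\<close> vanish in the limit, and on \<open>w\<^sub>0\<^sub>0\<close> the
  function \<open>R\<close> is a convergent polylogarithm; hence \<open>R(w) \<longrightarrow> \<zeta>(reg\<^sup>1\<^sup>0 w)\<close> (lemma
  \<open>regularized_polylog_tendsto\<close>).

  Going around the five vertices returns to the first solution. Its constant term is 1, so it can
  be cancelled, which leaves the pentagon relation.
\<close>

section \<open>Functions on words and the shuffle product\<close>

text \<open>
  The shuffle product enters through its pairing with functions on words: this is the value at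
  \<open>u \<amalg> v\<close> of the linear extension of \<open>f\<close>. Identities in the shuffle algebra are proved as identities
  between such values.
\<close>

definition shuffle_sum :: "('a list \<Rightarrow> 'k::comm_monoid_add) \<Rightarrow> 'a list \<Rightarrow> 'a list \<Rightarrow> 'k" where
  "shuffle_sum f u v = (\<Sum>w\<leftarrow>shuffle_words u v. f w)"

lemma shuffle_sum_Nil [simp]: "shuffle_sum f [] v = f v" "shuffle_sum f u [] = f u"
  by (simp add: shuffle_sum_def, cases u) (simp_all add: shuffle_sum_def)

lemma shuffle_sum_Cons [simp]:
  "shuffle_sum f (a # u) (b # v) =
     shuffle_sum (\<lambda>w. f (a # w)) u (b # v) + shuffle_sum (\<lambda>w. f (b # w)) (a # u) v"
  by (simp add: shuffle_sum_def o_def)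

lemma shuffle_sum_add:
  "shuffle_sum (\<lambda>w. f w + g w) u v = shuffle_sum f u v + shuffle_sum g u v"
  by (simp add: shuffle_sum_def sum_list_addf)

lemma shuffle_sum_diff:
  fixes f g :: "'a list \<Rightarrow> 'k::ab_group_add"
  shows "shuffle_sum (\<lambda>w. f w - g w) u v = shuffle_sum f u v - shuffle_sum g u v"
  by (simp add: shuffle_sum_def sum_list_subtractf)

lemma shuffle_sum_0 [simp]: "shuffle_sum (\<lambda>w. 0) u v = 0"
  by (simp add: shuffle_sum_def)

lemma shuffle_sum_scale:
  fixes c :: "'k::semiring_0"
  shows "shuffle_sum (\<lambda>w. c * f w) u v = c * shuffle_sum f u v"
  by (simp add: shuffle_sum_def sum_list_const_mult)

lemma shuffle_sum_uminus:
  fixes f :: "'a list \<Rightarrow> 'k::ab_group_add"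
  shows "shuffle_sum (\<lambda>w. - f w) u v = - shuffle_sum f u v"
  using shuffle_sum_diff[of "\<lambda>w. 0" f u v] by simp

lemma length_shuffle_words: "w \<in> set (shuffle_words u v) \<Longrightarrow> length w = length u + length v"
  by (induction u v arbitrary: w rule: shuffle_words.induct) auto

lemma set_shuffle_words: "w \<in> set (shuffle_words u v) \<Longrightarrow> set w = set u \<union> set v"
  by (induction u v arbitrary: w rule: shuffle_words.induct) auto

lemma last_shuffle_words:
  "w \<in> set (shuffle_words u v) \<Longrightarrow> u = [] \<or> last u = a \<Longrightarrow> v = [] \<or> last v = a \<Longrightarrow> w = [] \<or> last w = a"
proof (induction u v arbitrary: w rule: shuffle_words.induct)
  case (3 x u y v)
  from 3(3) consider w' where "w = x # w'" "w' \<in> set (shuffle_words u (y # v))"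
    | w' where "w = y # w'" "w' \<in> set (shuffle_words (x # u) v)"
    by auto
  then show ?case
  proof cases
    case 1
    then have "w' \<noteq> []" using length_shuffle_words[OF 1(2)] by auto
    with 3(1)[OF 1(2)] 3(4,5) 1 show ?thesis by (cases u) auto
  next
    case 2
    then have "w' \<noteq> []" using length_shuffle_words[OF 2(2)] by auto
    with 3(2)[OF 2(2)] 3(4,5) 2 show ?thesis by (cases v) auto
  qed
qed auto

lemma length_list_shuffle_words:
  "length (shuffle_words u v) = (length u + length v) choose length u"
  by (induction u v rule: shuffle_words.induct) simp_all

lemma shuffle_sum_cong:
  "(\<And>w. length w = length u + length v \<Longrightarrow> set w = set u \<union> set v \<Longrightarrow> f w = g w)
    \<Longrightarrow> shuffle_sum f u v = shuffle_sum g u v"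
  unfolding shuffle_sum_def
  by (intro arg_cong[of _ _ sum_list] map_cong refl) (auto dest: length_shuffle_words set_shuffle_words)

lemma shuffle_sum_snoc_single:
  "shuffle_sum f (u @ [a]) [b] = shuffle_sum (\<lambda>w. f (w @ [a])) u [b] + f (u @ [a, b])"
  by (induction u arbitrary: f) (simp_all add: ac_simps)

text \<open>
  The shuffle product is defined by recursion on the first letters. The letter \<open>\<xi>\<^sub>0\<close> is split off
  at the end of a word, for which the mirrored recursion is needed.
\<close>

lemma shuffle_sum_snoc:
  fixes f :: "'a list \<Rightarrow> 'k::comm_monoid_add"
  shows "shuffle_sum f (u @ [a]) (v @ [b]) =
     shuffle_sum (\<lambda>w. f (w @ [a])) u (v @ [b]) + shuffle_sum (\<lambda>w. f (w @ [b])) (u @ [a]) v"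
proof (induction u v arbitrary: f rule: shuffle_words.induct)
  case (1 v)
  show ?case by (induction v arbitrary: f) (simp_all add: ac_simps)
next
  case (2 x u)
  show ?case using shuffle_sum_snoc_single[of f "x # u"] by simp
next
  case (3 x u y v)
  have IH: "shuffle_sum f (u @ [a]) (y # v @ [b]) =
     shuffle_sum (\<lambda>w. f (w @ [a])) u (y # v @ [b]) + shuffle_sum (\<lambda>w. f (w @ [b])) (u @ [a]) (y # v)"
     "shuffle_sum f (x # u @ [a]) (v @ [b]) =
     shuffle_sum (\<lambda>w. f (w @ [a])) (x # u) (v @ [b]) + shuffle_sum (\<lambda>w. f (w @ [b])) (x # u @ [a]) v"
    for f :: "'a list \<Rightarrow> 'k"
    using 3[of f] by simp_all
  show ?case by (simp add: IH) (simp add: ac_simps)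
qed

text \<open>
  The transpose of the operator on words that removes a first letter \<open>a\<close> and annihilates the words
  that do not begin with \<open>a\<close>.
\<close>

definition delete_first :: "'a \<Rightarrow> ('a list \<Rightarrow> 'k::comm_monoid_add) \<Rightarrow> 'a list \<Rightarrow> 'k" where
  "delete_first a f w = (case w of [] \<Rightarrow> 0 | b # v \<Rightarrow> if b = a then f v else 0)"

definition delete_last :: "'a \<Rightarrow> ('a list \<Rightarrow> 'k::comm_monoid_add) \<Rightarrow> 'a list \<Rightarrow> 'k" where
  "delete_last a f w = (if w \<noteq> [] \<and> last w = a then f (butlast w) else 0)"

lemma delete_first_simps [simp]:
  "delete_first a f [] = 0" "delete_first a f (b # v) = (if b = a then f v else 0)"
  by (simp_all add: delete_first_def)

lemma delete_last_simps [simp]: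
  "delete_last a f [] = 0" "delete_last a f (v @ [b]) = (if b = a then f v else 0)"
  by (simp_all add: delete_last_def)

text \<open>
  The deletion of a first letter is a derivation of the shuffle product, and so is the deletion of
  a last letter. This makes the polylogarithms multiplicative and the decomposition over powers of
  the two letters unique.
\<close>

lemma shuffle_sum_delete_first:
  "shuffle_sum (delete_first a f) u v =
     delete_first a (\<lambda>x. shuffle_sum f x v) u + delete_first a (\<lambda>x. shuffle_sum f u x) v"
  by (cases u; cases v) simp_all

lemma shuffle_sum_delete_last:
  "shuffle_sum (delete_last a f) u v =
     delete_last a (\<lambda>x. shuffle_sum f x v) u + delete_last a (\<lambda>x. shuffle_sum f u x) v"
  by (cases u rule: rev_cases; cases v rule: rev_cases) (simp_all add: shuffle_sum_snoc)

text \<open>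
  The convolution dual to cutting words in two; it is the product of the generating series
  \<open>\<Sum>w. f w W\<close> and \<open>\<Sum>w. g w W\<close>.
\<close>

definition conv :: "('a list \<Rightarrow> 'k::semiring_0) \<Rightarrow> ('a list \<Rightarrow> 'k) \<Rightarrow> 'a list \<Rightarrow> 'k" where
  "conv f g w = (\<Sum>i\<le>length w. f (take i w) * g (drop i w))"

lemma conv_Nil [simp]: "conv f g [] = f [] * g []"
  by (simp add: conv_def)

lemma conv_Cons: "conv f g (a # w) = f [] * g (a # w) + conv (\<lambda>x. f (a # x)) g w"
  unfolding conv_def by (simp add: sum.atMost_Suc_shift del: sum.atMost_Suc)

text \<open>
  The bialgebra property: to cut a shuffle of \<open>u\<close> and \<open>v\<close> in two is to cut \<open>u\<close> and \<open>v\<close> and to shuffle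
  the front and the rear parts separately.
\<close>

lemma shuffle_sum_conv:
  "shuffle_sum (conv f g) u v =
     (\<Sum>i\<le>length u. \<Sum>j\<le>length v.
        shuffle_sum f (take i u) (take j v) * shuffle_sum g (drop i u) (drop j v))"
proof (induction u v arbitrary: f rule: shuffle_words.induct)
  case (1 v)
  show ?case by (simp add: conv_def)
next
  case (2 a u)
  show ?case by (simp add: conv_def)
next
  case (3 a u b v)
  have "shuffle_sum (conv f g) (a # u) (b # v) =
      f [] * shuffle_sum g (a # u) (b # v)
      + shuffle_sum (conv (\<lambda>x. f (a # x)) g) u (b # v)
      + shuffle_sum (conv (\<lambda>x. f (b # x)) g) (a # u) v"
    by (simp add: conv_Cons shuffle_sum_add shuffle_sum_scale algebra_simps)
  also have "\<dots> = (\<Sum>i\<le>length (a # u). \<Sum>j\<le>length (b # v).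
        shuffle_sum f (take i (a # u)) (take j (b # v)) * shuffle_sum g (drop i (a # u)) (drop j (b # v)))"
    unfolding 3
    by (simp add: sum.atMost_Suc_shift sum.distrib algebra_simps del: sum.atMost_Suc)
  finally show ?case .
qed

text \<open>
  The generating series of such a function is group-like.
\<close>

definition shuffle_character :: "('a list \<Rightarrow> 'k::comm_semiring_1) \<Rightarrow> bool" where
  "shuffle_character f \<longleftrightarrow> f [] = 1 \<and> (\<forall>u v. shuffle_sum f u v = f u * f v)"

lemma shuffle_characterD:
  assumes "shuffle_character f"
  shows "f [] = 1" "shuffle_sum f u v = f u * f v"
  using assms by (auto simp: shuffle_character_def)

lemma shuffle_character_conv:
  assumes "shuffle_character f" "shuffle_character g"
  shows "shuffle_character (conv f g)"
proof -
  have "shuffle_sum (conv f g) u v = conv f g u * conv f g v" for u v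
    unfolding shuffle_sum_conv shuffle_characterD(2)[OF assms(1)] shuffle_characterD(2)[OF assms(2)]
      conv_def sum_product by (simp add: mult_ac)
  then show ?thesis
    using assms by (simp add: shuffle_character_def)
qed

text \<open>
  The coefficients of the noncommutative series \<open>exp (t a)\<close>.
\<close>

definition power_word :: "'a \<Rightarrow> complex \<Rightarrow> 'a list \<Rightarrow> complex" where
  "power_word a t w = (if set w \<subseteq> {a} then t ^ length w / fact (length w) else 0)"

lemma shuffle_character_power_word: "shuffle_character (power_word a t)"
proof -
  have "shuffle_sum (power_word a t) u v = power_word a t u * power_word a t v" for u v
  proof (cases "set u \<union> set v \<subseteq> {a}")
    case True
    let ?c = "t ^ (length u + length v) / fact (length u + length v)"
    have "shuffle_sum (power_word a t) u v = shuffle_sum (\<lambda>w. ?c * 1) u v"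
      by (rule shuffle_sum_cong) (use True in \<open>simp add: power_word_def\<close>)
    also have "\<dots> = ?c * of_nat ((length u + length v) choose length u)"
      unfolding shuffle_sum_scale
      by (simp add: shuffle_sum_def sum_list_triv length_list_shuffle_words)
    also have "\<dots> = power_word a t u * power_word a t v"
      using True by (simp add: power_word_def binomial_fact power_add)
    finally show ?thesis .
  next
    case False
    then have "shuffle_sum (power_word a t) u v = shuffle_sum (\<lambda>w. 0) u v"
      by (intro shuffle_sum_cong) (auto simp: power_word_def)
    with False show ?thesis by (auto simp: power_word_def)
  qed
  then show ?thesis by (simp add: shuffle_character_def power_word_def)
qed

text \<open>
  Shuffling one more letter \<open>a\<close> into \<open>a\<^sup>n\<close> yields the word \<open>a\<^sup>n\<^sup>+\<^sup>1\<close> with multiplicity \<open>n + 1\<close>.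
\<close>

lemma shuffle_character_replicate:
  fixes f :: "'a list \<Rightarrow> complex"
  assumes "shuffle_character f"
  shows "f (replicate n a) = f [a] ^ n / fact n"
proof (induction n)
  case (Suc n)
  have "shuffle_sum g [a] (replicate n a) = of_nat (Suc n) * g (replicate (Suc n) a)"
    for g :: "'a list \<Rightarrow> complex"
    by (induction n arbitrary: g) (simp_all add: algebra_simps)
  from this[of f] have "of_nat (Suc n) * f (replicate (Suc n) a) = f [a] * f (replicate n a)"
    using shuffle_characterD(2)[OF assms] by simp
  with Suc show ?case by (simp add: field_simps del: of_nat_Suc)
qed (simp add: shuffle_characterD[OF assms])

section \<open>Decomposition over powers of the two letters\<close>

definition word_lin :: "(letter list \<Rightarrow> complex) \<Rightarrow> word_poly \<Rightarrow> complex" where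
  "word_lin f p = (\<Sum>w\<in>Poly_Mapping.keys p. Poly_Mapping.lookup p w * f w)"

lemma word_lin_superset:
  assumes "finite A" "Poly_Mapping.keys p \<subseteq> A"
  shows "word_lin f p = (\<Sum>w\<in>A. Poly_Mapping.lookup p w * f w)"
  unfolding word_lin_def using assms by (intro sum.mono_neutral_left) (auto simp: in_keys_iff)

lemma word_lin_add: "word_lin f (p + q) = word_lin f p + word_lin f q"
proof -
  let ?A = "Poly_Mapping.keys p \<union> Poly_Mapping.keys q"
  have "word_lin f p = (\<Sum>w\<in>?A. Poly_Mapping.lookup p w * f w)"
    "word_lin f q = (\<Sum>w\<in>?A. Poly_Mapping.lookup q w * f w)"
    "word_lin f (p + q) = (\<Sum>w\<in>?A. Poly_Mapping.lookup (p + q) w * f w)"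
    by (intro word_lin_superset; use Poly_Mapping.keys_add[of p q] in auto)+
  then show ?thesis by (simp add: lookup_add sum.distrib algebra_simps)
qed

lemma word_lin_0 [simp]: "word_lin f 0 = 0"
  by (simp add: word_lin_def)

lemma word_lin_single [simp]: "word_lin f (Poly_Mapping.single w c) = c * f w"
  by (simp add: word_lin_def)

lemma word_lin_word [simp]: "word_lin f (word w) = f w"
  by (simp add: word_def)

lemma word_lin_sum: "word_lin f (sum p A) = (\<Sum>a\<in>A. word_lin f (p a))"
  by (induction A rule: infinite_finite_induct) (simp_all add: word_lin_add)

lemma word_lin_sum_list: "word_lin f (\<Sum>a\<leftarrow>as. p a) = (\<Sum>a\<leftarrow>as. word_lin f (p a))"
  by (induction as) (simp_all add: word_lin_add)

lemma word_lin_shuffle_sum: "word_lin f (shuffle_sum p u v) = shuffle_sum (\<lambda>w. word_lin f (p w)) u v"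
  by (simp add: shuffle_sum_def word_lin_sum_list)

lemma word_lin_scale: "word_lin (\<lambda>w. c * f w) p = c * word_lin f p"
  by (simp add: word_lin_def sum_distrib_left mult_ac)

lemma word_poly_eqI:
  assumes "\<And>f. word_lin f p = word_lin f q"
  shows "p = q"
proof (rule poly_mapping_eqI)
  have *: "word_lin (\<lambda>x. if x = w then 1 else 0) r = Poly_Mapping.lookup r w" for w r
  proof -
    have "word_lin (\<lambda>x. if x = w then 1 else 0) r
        = (\<Sum>x\<in>Poly_Mapping.keys r. if x = w then Poly_Mapping.lookup r w else 0)"
      unfolding word_lin_def by (intro sum.cong) auto
    then show ?thesis by (simp add: in_keys_iff)
  qed
  show "Poly_Mapping.lookup p w = Poly_Mapping.lookup q w" for w
    using assms[of "\<lambda>x. if x = w then 1 else 0"] by (simp add: *)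
qed

lemma word_lin_shuffle:
  "word_lin f (p \<amalg> q) = word_lin (\<lambda>u. word_lin (\<lambda>v. shuffle_sum f u v) q) p"
  by (simp add: shuffle_prod_def word_lin_sum word_lin_sum_list word_lin_def[of _ p]
      word_lin_def[of _ q] shuffle_sum_def sum_list_const_mult sum_list_mult_const sum_distrib_left mult_ac)

lemma zeta_map_word_lin: "zeta_map p = word_lin (\<lambda>w. complex_of_real (zeta_word w)) p"
  by (simp add: zeta_map_def word_lin_def)

text \<open>
  The terms of the decomposition that defines \<^const>\<open>reg10\<close>, and the functions on words by which
  they are paired with \<open>f\<close>.
\<close>

abbreviation sandwich :: "nat \<Rightarrow> word_poly \<Rightarrow> nat \<Rightarrow> word_poly" where
  "sandwich i p j \<equiv> word (replicate i xi1) \<amalg> p \<amalg> word (replicate j xi0)"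

abbreviation sandwich_sum :: "(letter list \<Rightarrow> complex) \<Rightarrow> nat \<Rightarrow> nat \<Rightarrow> letter list \<Rightarrow> complex" where
  "sandwich_sum f i j \<equiv>
     shuffle_sum (\<lambda>x. shuffle_sum f x (replicate j xi0)) (replicate i xi1)"

lemma word_lin_sandwich: "word_lin f (sandwich i p j) = word_lin (sandwich_sum f i j) p"
  by (simp add: word_lin_shuffle)

lemma sandwich_additive: "sandwich i (p + q) j = sandwich i p j + sandwich i q j"
  by (rule word_poly_eqI) (simp add: word_lin_sandwich word_lin_add)

lemma sandwich_zero [simp]: "sandwich i 0 j = 0"
  by (rule word_poly_eqI) (simp add: word_lin_sandwich)

definition admissible :: "letter list \<Rightarrow> bool" where
  "admissible w \<longleftrightarrow> w = [] \<or> (\<exists>v. w = xi0 # v @ [xi1])"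

lemma S10_eq: "S10 = {p. \<forall>w\<in>Poly_Mapping.keys p. admissible w}"
  by (simp add: S10_def admissible_def)

lemma S10_add: "p \<in> S10 \<Longrightarrow> q \<in> S10 \<Longrightarrow> p + q \<in> S10"
  using Poly_Mapping.keys_add[of p q] by (auto simp: S10_eq)

lemma S10_diff: "p \<in> S10 \<Longrightarrow> q \<in> S10 \<Longrightarrow> p - q \<in> S10"
  using Poly_Mapping.keys_diff[of p q] by (auto simp: S10_eq)

lemma S10_single: "admissible w \<Longrightarrow> Poly_Mapping.single w c \<in> S10"
  by (simp add: S10_eq)

lemma zero_S10 [simp]: "0 \<in> S10"
  by (simp add: S10_eq)

text \<open>
  The derivation acts on the power of \<open>\<xi>\<^sub>1\<close> only: neither an admissible word nor a power of \<open>\<xi>\<^sub>0\<close>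
  begins with \<open>\<xi>\<^sub>1\<close>. The lemma for \<open>\<xi>\<^sub>0\<close> is the mirror image.
\<close>

lemma sandwich_sum_delete_first:
  assumes "admissible w"
  shows "sandwich_sum (delete_first xi1 f) i j w = (if i = 0 then 0 else sandwich_sum f (i - 1) j w)"
proof -
  have "delete_first xi1 h (replicate j xi0) = 0" "delete_first xi1 h w = 0"
    for h :: "letter list \<Rightarrow> complex"
    using assms by (cases j; auto simp: admissible_def)+
  then show ?thesis by (cases i) (simp_all add: shuffle_sum_delete_first)
qed

lemma sandwich_sum_delete_last:
  assumes "admissible w"
  shows "sandwich_sum (delete_last xi0 f) i j w = (if j = 0 then 0 else sandwich_sum f i (j - 1) w)"
proof -
  have w: "delete_last xi0 h w = 0" and i: "delete_last xi0 h (replicate i xi1) = 0"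
    for h :: "letter list \<Rightarrow> complex"
    using assms by (auto simp: admissible_def delete_last_def)
  have j: "delete_last xi0 h (replicate j xi0) = (if j = 0 then 0 else h (replicate (j - 1) xi0))"
    for h :: "letter list \<Rightarrow> complex"
    by (cases j) (simp_all add: replicate_append_same[symmetric])
  show ?thesis
    by (simp add: shuffle_sum_delete_last w i j shuffle_sum_add)
qed

lemma sandwich_sum_delete:
  assumes "admissible w"
  shows "sandwich_sum ((delete_first xi1 ^^ k) ((delete_last xi0 ^^ l) f)) i j w =
     (if k \<le> i \<and> l \<le> j then sandwich_sum f (i - k) (j - l) w else 0)"
proof -
  have 1: "sandwich_sum ((delete_last xi0 ^^ l) f) i j w =
     (if l \<le> j then sandwich_sum f i (j - l) w else 0)" for i
    by (induction l arbitrary: j) (auto simp: sandwich_sum_delete_last[OF assms])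
  show ?thesis
    by (induction k arbitrary: i) (auto simp: sandwich_sum_delete_first[OF assms] 1)
qed

text \<open>
  Among the pairs with a nonzero coefficient take \<open>(k, l)\<close> with \<open>k + l\<close> maximal, and delete \<open>k\<close> letters
  \<open>\<xi>\<^sub>1\<close> on the left and \<open>l\<close> letters \<open>\<xi>\<^sub>0\<close> on the right. A term with fewer letters on one of the sides is
  annihilated, so that only \<open>V (k, l)\<close> is left.
\<close>

lemma sandwich_independent:
  assumes "finite A" and S10: "\<And>ij. V ij \<in> S10" and supp: "\<And>ij. ij \<notin> A \<Longrightarrow> V ij = 0"
    and zero: "(\<Sum>ij\<in>A. sandwich (fst ij) (V ij) (snd ij)) = 0"
  shows "V ij = 0"
proof (rule ccontr)
  assume "V ij \<noteq> 0"
  let ?B = "{ij. V ij \<noteq> 0}"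
  have "finite ?B" using supp by (intro finite_subset[OF _ \<open>finite A\<close>]) auto
  moreover have "?B \<noteq> {}" using \<open>V ij \<noteq> 0\<close> by blast
  ultimately have "\<exists>kl\<in>?B. (\<lambda>kl. fst kl + snd kl) kl = Max ((\<lambda>kl. fst kl + snd kl) ` ?B)"
    by (metis (no_types, lifting) Max_in finite_imageI imageE image_is_empty)
  then obtain k l where kl: "V (k, l) \<noteq> 0" "k + l = Max ((\<lambda>kl. fst kl + snd kl) ` ?B)"
    by auto
  have max: "i + j \<le> k + l" if "V (i, j) \<noteq> 0" for i j
    unfolding kl(2) using that \<open>finite ?B\<close> by (intro Max_ge) force+
  have "word_lin f (V (k, l)) = word_lin f 0" for f
  proof -
    let ?f = "(delete_first xi1 ^^ k) ((delete_last xi0 ^^ l) f)"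
    have "0 = word_lin ?f (\<Sum>ij\<in>A. sandwich (fst ij) (V ij) (snd ij))"
      by (simp add: zero)
    also have "\<dots> = (\<Sum>ij\<in>A. word_lin (sandwich_sum ?f (fst ij) (snd ij)) (V ij))"
      by (simp add: word_lin_sum word_lin_sandwich)
    also have "\<dots> = (\<Sum>ij\<in>A. if ij = (k, l) then word_lin f (V (k, l)) else 0)"
    proof (rule sum.cong[OF refl])
      fix ij
      have adm: "admissible w" if "w \<in> Poly_Mapping.keys (V ij)" for w
        using S10[of ij] that by (auto simp: S10_eq)
      have "word_lin (sandwich_sum ?f (fst ij) (snd ij)) (V ij)
          = word_lin (\<lambda>w. if k \<le> fst ij \<and> l \<le> snd ij
              then sandwich_sum f (fst ij - k) (snd ij - l) w else 0) (V ij)"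
        unfolding word_lin_def
        by (intro sum.cong refl) (simp add: sandwich_sum_delete[OF adm])
      also have "\<dots> = (if ij = (k, l) then word_lin f (V (k, l)) else 0)"
      proof (cases "k \<le> fst ij \<and> l \<le> snd ij \<and> ij \<noteq> (k, l)")
        case True
        then have "\<not> fst ij + snd ij \<le> k + l" by (cases ij) auto
        with max[of "fst ij" "snd ij"] have "V ij = 0" by auto
        with True show ?thesis by simp
      next
        case False
        then show ?thesis by (cases ij) (auto simp: word_lin_def)
      qed
      finally show "word_lin (sandwich_sum ?f (fst ij) (snd ij)) (V ij)
          = (if ij = (k, l) then word_lin f (V (k, l)) else 0)" .
    qed
    also have "\<dots> = word_lin f (V (k, l))"
      using supp[of "(k, l)"] kl(1) \<open>finite A\<close> by auto
    finally show ?thesis by simp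
  qed
  then have "V (k, l) = 0" by (rule word_poly_eqI)
  with kl show False by simp
qed

definition shuffle_decomposition :: "word_poly \<Rightarrow> (nat \<times> nat \<Rightarrow> word_poly) \<Rightarrow> bool" where
  "shuffle_decomposition u W \<longleftrightarrow> finite {ij. W ij \<noteq> 0} \<and> (\<forall>ij. W ij \<in> S10) \<and>
     u = (\<Sum>ij | W ij \<noteq> 0. sandwich (fst ij) (W ij) (snd ij))"

lemma shuffle_decompositionD:
  assumes "shuffle_decomposition u W" "finite A" "{ij. W ij \<noteq> 0} \<subseteq> A"
  shows "u = (\<Sum>ij\<in>A. sandwich (fst ij) (W ij) (snd ij))"
proof -
  have "(\<Sum>ij | W ij \<noteq> 0. sandwich (fst ij) (W ij) (snd ij)) = (\<Sum>ij\<in>A. sandwich (fst ij) (W ij) (snd ij))"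
    using assms by (intro sum.mono_neutral_left) auto
  with assms(1) show ?thesis by (simp add: shuffle_decomposition_def)
qed

lemma shuffle_decompositionI:
  assumes "finite A" "\<And>ij. W ij \<in> S10" "\<And>ij. ij \<notin> A \<Longrightarrow> W ij = 0"
    "u = (\<Sum>ij\<in>A. sandwich (fst ij) (W ij) (snd ij))"
  shows "shuffle_decomposition u W"
proof -
  have *: "{ij. W ij \<noteq> 0} \<subseteq> A" using assms(3) by auto
  moreover have "(\<Sum>ij | W ij \<noteq> 0. sandwich (fst ij) (W ij) (snd ij)) = (\<Sum>ij\<in>A. sandwich (fst ij) (W ij) (snd ij))"
    using assms * by (intro sum.mono_neutral_left) auto
  ultimately show ?thesis
    using assms by (simp add: shuffle_decomposition_def finite_subset[OF *])
qed

lemma shuffle_decomposition_unique: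
  assumes "shuffle_decomposition u V" "shuffle_decomposition u W"
  shows "V = W"
proof
  fix ij
  let ?A = "{ij. V ij \<noteq> 0} \<union> {ij. W ij \<noteq> 0}"
  have fin: "finite ?A" using assms by (simp add: shuffle_decomposition_def)
  have "V ij - W ij = 0"
  proof (rule sandwich_independent[OF fin])
    have "(\<Sum>ij\<in>?A. sandwich (fst ij) (V ij) (snd ij)) = u"
      "(\<Sum>ij\<in>?A. sandwich (fst ij) (W ij) (snd ij)) = u"
      using shuffle_decompositionD[OF assms(1) fin] shuffle_decompositionD[OF assms(2) fin] by auto
    moreover have "sandwich i (p - q) j = sandwich i p j - sandwich i q j" for i p q j
      using sandwich_additive[of i "p - q" q j] by simp
    ultimately show "(\<Sum>ij\<in>?A. sandwich (fst ij) (V ij - W ij) (snd ij)) = 0"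
      by (simp add: sum_subtractf)
    show "V ij - W ij \<in> S10" for ij
      using assms by (intro S10_diff) (simp_all add: shuffle_decomposition_def del: split_paired_All)
  qed auto
  then show "V ij = W ij" by simp
qed

abbreviation decomposable :: "word_poly \<Rightarrow> bool" where
  "decomposable u \<equiv> \<exists>W. shuffle_decomposition u W"

lemma decomposable_add:
  assumes "decomposable u" "decomposable v"
  shows "decomposable (u + v)"
proof -
  obtain V W where VW: "shuffle_decomposition u V" "shuffle_decomposition v W"
    using assms by auto
  let ?A = "{ij. V ij \<noteq> 0} \<union> {ij. W ij \<noteq> 0}"
  have fin: "finite ?A" using VW by (simp add: shuffle_decomposition_def)
  have "shuffle_decomposition (u + v) (\<lambda>ij. V ij + W ij)"
  proof (rule shuffle_decompositionI[OF fin])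
    show "u + v = (\<Sum>ij\<in>?A. sandwich (fst ij) (V ij + W ij) (snd ij))"
      using shuffle_decompositionD[OF VW(1) fin] shuffle_decompositionD[OF VW(2) fin]
      by (simp add: sandwich_additive sum.distrib)
  qed (use VW in \<open>auto simp: shuffle_decomposition_def intro: S10_add\<close>)
  then show ?thesis by blast
qed

lemma decomposable_sandwich: "p \<in> S10 \<Longrightarrow> decomposable (sandwich i p j)"
  by (intro exI[of _ "\<lambda>ij. if ij = (i, j) then p else 0"] shuffle_decompositionI[of "{(i, j)}"])
    auto

lemma decomposable_zero: "decomposable 0"
  using decomposable_sandwich[of 0 0 0] by (simp only: sandwich_zero zero_S10)

lemma decomposable_sum: "(\<And>a. a \<in> A \<Longrightarrow> decomposable (p a)) \<Longrightarrow> decomposable (sum p A)"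
  by (induction A rule: infinite_finite_induct) (auto intro: decomposable_zero decomposable_add)

lemma decomposable_sum_list:
  "(\<And>a. a \<in> set as \<Longrightarrow> decomposable (p a)) \<Longrightarrow> decomposable (\<Sum>a\<leftarrow>as. p a)"
  by (induction as) (auto intro: decomposable_zero decomposable_add)

text \<open>
  The words of the shuffle are sorted by the number \<open>k\<close> of letters \<open>a\<close> that precede \<open>b\<close>. The only one
  with all \<open>n\<close> letters in front has multiplicity 1, so the shuffle is triangular and can be solved for
  that word.
\<close>

lemma shuffle_sum_replicate_left:
  assumes "a \<noteq> b"
  shows "shuffle_sum f (replicate n a) (b # y) = f (replicate n a @ b # y)
     + (\<Sum>k<n. shuffle_sum (\<lambda>x. f (replicate k a @ b # x)) (replicate (n - k) a) y)"
proof (induction n arbitrary: f)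
  case (Suc n)
  show ?case
    by (simp add: Suc[of "\<lambda>w. f (a # w)"] sum.lessThan_Suc_shift add.assoc del: sum.lessThan_Suc)
      (simp add: add.commute)
qed simp

lemma shuffle_sum_replicate_right:
  assumes "a \<noteq> b"
  shows "shuffle_sum f (y @ [b]) (replicate n a) = f (y @ b # replicate n a)
     + (\<Sum>k<n. shuffle_sum (\<lambda>x. f (x @ b # replicate k a)) y (replicate (n - k) a))"
proof (induction n arbitrary: f)
  case (Suc n)
  have *: "replicate (Suc n) a = replicate n a @ [a]" for n
    by (simp add: replicate_append_same)
  have "shuffle_sum f (y @ [b]) (replicate (Suc n) a) =
     shuffle_sum (\<lambda>w. f (w @ [b])) y (replicate (Suc n) a)
      + shuffle_sum (\<lambda>w. f (w @ [a])) (y @ [b]) (replicate n a)"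
    unfolding * by (rule shuffle_sum_snoc)
  then show ?case
    by (simp add: Suc[of "\<lambda>w. f (w @ [a])"] sum.lessThan_Suc_shift replicate_append_same
          del: sum.lessThan_Suc) (simp add: ac_simps)
qed simp

text \<open>
  Induction on the number of first letters \<open>\<xi>\<^sub>1\<close>, by triangularity. The factor \<open>\<xi>\<^sub>0\<^sup>j\<close> is carried along:
  the products in a decomposition associate to the left, so the left factor has to be split off
  inside a product with \<open>\<xi>\<^sub>0\<^sup>j\<close>.
\<close>

lemma decomposable_ends_xi1:
  assumes "V = [] \<or> last V = xi1"
  shows "decomposable (Poly_Mapping.single V c \<amalg> word (replicate j xi0))"
proof -
  have xi1s: "decomposable (Poly_Mapping.single (replicate n xi1) c \<amalg> word (replicate j xi0))" for n c
  proof -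
    have "Poly_Mapping.single (replicate n xi1) c \<amalg> word (replicate j xi0)
        = sandwich n (Poly_Mapping.single [] c) j"
      by (rule word_poly_eqI) (simp add: word_lin_shuffle)
    then show ?thesis using decomposable_sandwich[OF S10_single] by (simp add: admissible_def)
  qed
  have general: "decomposable (Poly_Mapping.single (replicate n xi1 @ xi0 # y) c \<amalg> word (replicate j xi0))"
    if "y \<noteq> []" "last y = xi1" for n y c
    using that
  proof (induction n arbitrary: y c rule: less_induct)
    case (less n)
    let ?rest = "\<Sum>k<n. \<Sum>x\<leftarrow>shuffle_words (replicate (n - k) xi1) y.
        Poly_Mapping.single (replicate k xi1 @ xi0 # x) (- c) \<amalg> word (replicate j xi0)"
    have "Poly_Mapping.single (replicate n xi1 @ xi0 # y) c \<amalg> word (replicate j xi0)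
        = sandwich n (Poly_Mapping.single (xi0 # y) c) j + ?rest"
      by (rule word_poly_eqI)
        (simp add: word_lin_shuffle word_lin_add word_lin_sum word_lin_shuffle_sum
          shuffle_sum_replicate_left shuffle_sum_scale shuffle_sum_uminus sum_negf
          distrib_left sum_distrib_left flip: shuffle_sum_def)
    moreover have "decomposable (sandwich n (Poly_Mapping.single (xi0 # y) c) j)"
      using less.prems by (intro decomposable_sandwich S10_single)
        (simp add: admissible_def, metis append_butlast_last_id)
    moreover have "decomposable ?rest"
    proof (intro decomposable_sum decomposable_sum_list)
      fix k x assume k: "k \<in> {..<n}" and x: "x \<in> set (shuffle_words (replicate (n - k) xi1) y)"
      have "x \<noteq> []" using length_shuffle_words[OF x] less.prems by auto
      moreover have "x = [] \<or> last x = xi1"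
        using less.prems by (intro last_shuffle_words[OF x]) (cases "n - k"; simp)+
      ultimately show "decomposable (Poly_Mapping.single (replicate k xi1 @ xi0 # x) (- c) \<amalg> word (replicate j xi0))"
        using less.IH k by auto
    qed
    ultimately show ?case by (simp only: decomposable_add)
  qed
  have "\<exists>n y. V = replicate n xi1 \<or> (V = replicate n xi1 @ xi0 # y)"
  proof (induction V)
    case (Cons a V)
    then obtain n y where "V = replicate n xi1 \<or> (V = replicate n xi1 @ xi0 # y)" by blast
    then show ?case
      by (cases a) (auto intro: exI[of _ 0] exI[of _ "Suc n"])
  qed auto
  then obtain n y where "V = replicate n xi1 \<or> (V = replicate n xi1 @ xi0 # y)" by blast
  then show ?thesis
    using xi1s general[of y n c] assms by (auto split: if_splits)
qed

text \<open>
  The same induction at the other end, on the number of last letters \<open>\<xi>\<^sub>0\<close>.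
\<close>

lemma decomposable_single: "decomposable (Poly_Mapping.single w c)"
proof -
  have general: "decomposable (Poly_Mapping.single (v @ xi1 # replicate n xi0) c)" for n v c
  proof (induction n arbitrary: v c rule: less_induct)
    case (less n)
    let ?rest = "\<Sum>k<n. \<Sum>x\<leftarrow>shuffle_words v (replicate (n - k) xi0).
        Poly_Mapping.single (x @ xi1 # replicate k xi0) (- c)"
    have "Poly_Mapping.single (v @ xi1 # replicate n xi0) c
        = Poly_Mapping.single (v @ [xi1]) c \<amalg> word (replicate n xi0) + ?rest"
      by (rule word_poly_eqI)
        (simp add: word_lin_shuffle word_lin_add word_lin_sum word_lin_shuffle_sum
          shuffle_sum_replicate_right shuffle_sum_scale shuffle_sum_uminus sum_negf
          distrib_left sum_distrib_left flip: shuffle_sum_def)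
    moreover have "decomposable ?rest"
      by (intro decomposable_sum decomposable_sum_list less.IH) simp
    moreover have "decomposable (Poly_Mapping.single (v @ [xi1]) c \<amalg> word (replicate n xi0))"
      by (rule decomposable_ends_xi1) simp
    ultimately show ?case by (simp only: decomposable_add)
  qed
  have "\<exists>n v. w = replicate n xi0 \<or> (w = v @ xi1 # replicate n xi0)"
  proof (induction w rule: rev_induct)
    case (snoc a w)
    then obtain n v where "w = replicate n xi0 \<or> (w = v @ xi1 # replicate n xi0)" by blast
    then show ?case
      by (cases a) (auto intro: exI[of _ 0] exI[of _ "Suc n"] simp: replicate_append_same)
  qed auto
  then obtain n v where "w = replicate n xi0 \<or> (w = v @ xi1 # replicate n xi0)" by blast
  moreover have "decomposable (Poly_Mapping.single (replicate n xi0) c)"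
  proof -
    have "Poly_Mapping.single (replicate n xi0) c = sandwich 0 (Poly_Mapping.single [] c) n"
      by (rule word_poly_eqI) (simp add: word_lin_shuffle)
    then show ?thesis
      using decomposable_sandwich[OF S10_single[of "[]" c], of 0 n] by (simp add: admissible_def)
  qed
  ultimately show ?thesis using general by auto
qed

lemma reg10_word:
  obtains W where "shuffle_decomposition (word w) W" "reg10 (word w) = W (0, 0)"
proof -
  obtain W where W: "shuffle_decomposition (word w) W"
    using decomposable_single[of w 1] by (auto simp: word_def)
  have "reg10 (word w) = (THE r. \<exists>W. shuffle_decomposition (word w) W \<and> r = W (0, 0))"
    unfolding reg10_def shuffle_decomposition_def conj_assoc ..
  also have "\<dots> = W (0, 0)"
  proof (rule the_equality)
    show "\<exists>V. shuffle_decomposition (word w) V \<and> W (0, 0) = V (0, 0)" using W by blast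
    show "r = W (0, 0)" if "\<exists>V. shuffle_decomposition (word w) V \<and> r = V (0, 0)" for r
      using that shuffle_decomposition_unique[OF W] by blast
  qed
  finally show ?thesis using that W by blast
qed

lemma sandwich_sum_character:
  assumes R: "shuffle_character R"
  shows "sandwich_sum R i j = (\<lambda>v. (R [xi0] ^ j / fact j * (R [xi1] ^ i / fact i)) * R v)"
proof
  fix v
  have "sandwich_sum R i j v = shuffle_sum (\<lambda>x. R (replicate j xi0) * R x) (replicate i xi1) v"
    by (simp add: shuffle_characterD(2)[OF R] mult.commute)
  then show "sandwich_sum R i j v = (R [xi0] ^ j / fact j * (R [xi1] ^ i / fact i)) * R v"
    by (simp only: shuffle_sum_scale shuffle_characterD(2)[OF R] shuffle_character_replicate[OF R])
      (simp add: mult_ac)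
qed

text \<open>
  A character maps a power of a letter to a divided power. As \<open>R\<close> vanishes at \<open>\<xi>\<^sub>1\<close>, only the terms
  without a factor \<open>\<xi>\<^sub>1\<close> are left.
\<close>

lemma word_lin_decomposition:
  assumes W: "shuffle_decomposition (word w) W" and R: "shuffle_character R" and R1: "R [xi1] = 0"
  shows "R w = (\<Sum>ij | W ij \<noteq> 0. if fst ij = 0 then word_lin R (W ij) * (R [xi0] ^ snd ij / fact (snd ij)) else 0)"
proof -
  have "R w = word_lin R (word w)" by simp
  also have "word w = (\<Sum>ij | W ij \<noteq> 0. sandwich (fst ij) (W ij) (snd ij))"
    using W by (simp add: shuffle_decomposition_def)
  also have "word_lin R \<dots> = (\<Sum>ij | W ij \<noteq> 0. word_lin (sandwich_sum R (fst ij) (snd ij)) (W ij))"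
    by (simp add: word_lin_sum word_lin_sandwich)
  finally show ?thesis
    by (simp only: sandwich_sum_character[OF R] word_lin_scale R1)
      (auto intro!: sum.cong simp: power_0_left)
qed

section \<open>Multiplicativity of polylogarithms\<close>

text \<open>
  The power series \<open>p w\<close> with these coefficients are the multiple polylogarithms of the words that do
  not end with \<open>\<xi>\<^sub>0\<close>; in general the polylogarithm of \<open>w\<close> is the sum of \<open>p v \<cdot> (log z)\<^sup>j / j!\<close> over
  \<open>w = v \<xi>\<^sub>0\<^sup>j\<close>. Thus \<open>\<Sum>w. p w W\<close> is the regular part of the solution of the one-variable equation,
  and the subtracted term, in which the last letter \<open>\<xi>\<^sub>0\<close> is removed, stems from the power of \<open>z\<close> that
  has been divided out. For \<open>m = 0\<close> the quotient is 0, the wanted constant term of a nonempty word.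
\<close>

fun polylog_coeff :: "letter list \<Rightarrow> nat \<Rightarrow> complex" where
  "polylog_coeff [] m = (if m = 0 then 1 else 0)"
| "polylog_coeff (x # v) m =
     ((if x = xi0 then polylog_coeff v m else 0)
      - (if last (x # v) = xi0 then polylog_coeff (butlast (x # v)) m else 0)
      + (if x = xi1 then (\<Sum>l<m. polylog_coeff v l) else 0)) / of_nat m"

declare polylog_coeff.simps(2) [simp del]

lemma polylog_coeff_rec:
  "of_nat m * polylog_coeff w m = delete_first xi0 (\<lambda>v. polylog_coeff v m) w
     - delete_last xi0 (\<lambda>v. polylog_coeff v m) w
     + delete_first xi1 (\<lambda>v. \<Sum>l<m. polylog_coeff v l) w"
proof (cases w)
  case (Cons x v)
  have 0: "polylog_coeff v 0 = (if v = [] then 1 else 0)" for v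
    by (cases v) (simp_all add: polylog_coeff.simps(2))
  show ?thesis
  proof (cases "m = 0")
    case True
    with Cons show ?thesis by (cases x) (auto simp: 0 delete_last_def)
  next
    case False
    with Cons show ?thesis by (simp add: polylog_coeff.simps(2) delete_last_def)
  qed
qed (simp_all)

lemma polylog_coeff_0: "polylog_coeff w 0 = (if w = [] then 1 else 0)"
  by (cases w) (simp_all add: polylog_coeff.simps(2))

lemma norm_polylog_coeff: "norm (polylog_coeff w m) \<le> 3 ^ length w"
proof (induction "length w" arbitrary: w m)
  case (Suc n)
  let ?B = "of_nat m * 3 ^ n :: real"
  show ?case
  proof (cases "m = 0")
    case True
    with Suc.hyps(2) show ?thesis by (auto simp: polylog_coeff_0)
  next
    case False
    have IH: "norm (polylog_coeff v l) \<le> 3 ^ n" if "length v = n" for v l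
      using Suc.hyps(1)[of v l] that by simp
    have first: "norm (delete_first a f w) \<le> ?B" and last: "norm (delete_last a f w) \<le> ?B"
      if "\<And>v. length v = n \<Longrightarrow> norm (f v) \<le> ?B" for a and f :: "letter list \<Rightarrow> complex"
      using that Suc.hyps(2) by (auto simp: delete_first_def delete_last_def split: list.split)
    have one: "norm (polylog_coeff v m) \<le> ?B" if "length v = n" for v
      using IH[OF that] mult_right_mono[of 1 "real m" "3 ^ n"] False by (fastforce intro: order_trans)
    have sum: "norm (\<Sum>l<m. polylog_coeff v l) \<le> ?B" if "length v = n" for v
      using sum_norm_le[of "{..<m}" "polylog_coeff v" "\<lambda>l. 3 ^ n"] IH[OF that] by simp
    have "norm (delete_first xi0 (\<lambda>v. polylog_coeff v m) w) \<le> ?B" by (rule first, erule one)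
    moreover have "norm (delete_last xi0 (\<lambda>v. polylog_coeff v m) w) \<le> ?B" by (rule last, erule one)
    moreover have "norm (delete_first xi1 (\<lambda>v. \<Sum>l<m. polylog_coeff v l) w) \<le> ?B"
      by (rule first, erule sum)
    ultimately have "norm (of_nat m * polylog_coeff w m) \<le> (?B + ?B) + ?B"
      unfolding polylog_coeff_rec by (meson add_mono norm_triangle_le norm_triangle_ineq4 order_trans)
    then show ?thesis using False by (simp add: norm_mult Suc.hyps(2)[symmetric])
  qed
qed simp

definition polylog_fps :: "letter list \<Rightarrow> complex fps" where
  "polylog_fps w = Abs_fps (polylog_coeff w)"

lemma polylog_fps_nth [simp]: "fps_nth (polylog_fps w) m = polylog_coeff w m"
  by (simp add: polylog_fps_def)

lemma polylog_fps_Nil [simp]: "polylog_fps [] = 1"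
  by (simp add: fps_eq_iff)

abbreviation fps_X_over_one_minus_X :: "complex fps" where
  "fps_X_over_one_minus_X \<equiv> Abs_fps (\<lambda>n. if n = 0 then 0 else 1)"

lemma fps_X_over_one_minus_X_mult_nth:
  "fps_nth (fps_X_over_one_minus_X * f) m = (\<Sum>l<m. fps_nth f l)"
proof -
  have "fps_nth (fps_X_over_one_minus_X * f) m = fps_nth (f * fps_X_over_one_minus_X) m"
    by (simp add: mult.commute)
  also have "\<dots> = (\<Sum>l=0..m. if l < m then fps_nth f l else 0)"
    unfolding fps_mult_nth by (intro sum.cong) auto
  also have "\<dots> = (\<Sum>l<m. fps_nth f l)"
    by (intro sum.mono_neutral_cong_right) auto
  finally show ?thesis .
qed

lemma delete_first_apply: "h (delete_first a f w) = delete_first a (\<lambda>v. h (f v)) w" if "h 0 = 0"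
  using that by (simp add: delete_first_def split: list.split)

lemma delete_last_apply: "h (delete_last a f w) = delete_last a (\<lambda>v. h (f v)) w" if "h 0 = 0"
  using that by (simp add: delete_last_def)

text \<open>
  The operator \<open>z d/dz\<close> is expressed by deletions of letters, that is, by derivations of the shuffle
  product.
\<close>

lemma theta_polylog_fps:
  "fps_X * fps_deriv (polylog_fps w) = delete_first xi0 polylog_fps w - delete_last xi0 polylog_fps w
     + fps_X_over_one_minus_X * delete_first xi1 polylog_fps w"
proof (rule fps_ext)
  fix m
  have "fps_nth (fps_X * fps_deriv (polylog_fps w)) m = of_nat m * polylog_coeff w m"
    by (cases m) simp_all
  moreover have "fps_nth (fps_X_over_one_minus_X * delete_first xi1 polylog_fps w) m
      = delete_first xi1 (\<lambda>v. \<Sum>l<m. polylog_coeff v l) w"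
    using delete_first_apply[of "\<lambda>f. fps_nth (fps_X_over_one_minus_X * f) m" xi1 polylog_fps w]
    by (simp add: fps_X_over_one_minus_X_mult_nth)
  ultimately show "fps_nth (fps_X * fps_deriv (polylog_fps w)) m =
    fps_nth (delete_first xi0 polylog_fps w - delete_last xi0 polylog_fps w
     + fps_X_over_one_minus_X * delete_first xi1 polylog_fps w) m"
    using delete_first_apply[of "\<lambda>f. fps_nth f m" xi0 polylog_fps w]
      delete_last_apply[of "\<lambda>f. fps_nth f m" xi0 polylog_fps w]
    by (simp add: polylog_coeff_rec)
qed

lemma fps_eq_theta:
  fixes f g :: "complex fps"
  assumes "fps_X * fps_deriv f = fps_X * fps_deriv g" "fps_nth f 0 = fps_nth g 0"
  shows "f = g"
proof (rule fps_ext)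
  fix n
  have "fps_deriv f = fps_deriv g" using assms(1) by simp
  then have "of_nat n * fps_nth f n = of_nat n * fps_nth g n"
    by (cases n) (auto simp: fps_eq_iff)
  then show "fps_nth f n = fps_nth g n"
    using assms(2) by (cases n) (auto simp del: of_nat_Suc)
qed

text \<open>
  Both sides of the multiplicativity satisfy the same first-order equation, because \<open>z d/dz\<close> and the
  deletions are derivations, and they have the same constant term.
\<close>

lemma shuffle_character_polylog_fps: "shuffle_character polylog_fps"
proof -
  have "shuffle_sum polylog_fps u v = polylog_fps u * polylog_fps v" for u v
  proof (induction "length u + length v" arbitrary: u v rule: less_induct)
    case less
    let ?L = polylog_fps and ?G = fps_X_over_one_minus_X
    have first: "shuffle_sum (delete_first a ?L) u v =
        delete_first a ?L u * ?L v + ?L u * delete_first a ?L v" for a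
      unfolding shuffle_sum_delete_first using less by (cases u; cases v) auto
    have last: "shuffle_sum (delete_last a ?L) u v =
        delete_last a ?L u * ?L v + ?L u * delete_last a ?L v" for a
      unfolding shuffle_sum_delete_last using less
      by (cases u rule: rev_cases; cases v rule: rev_cases) auto
    have linear: "fps_X * fps_deriv (shuffle_sum f u v) = shuffle_sum (\<lambda>w. fps_X * fps_deriv (f w)) u v"
      for f :: "letter list \<Rightarrow> complex fps"
    proof -
      have "fps_X * fps_deriv (\<Sum>w\<leftarrow>ws. f w) = (\<Sum>w\<leftarrow>ws. fps_X * fps_deriv (f w))" for ws
        by (induction ws) (simp_all add: distrib_left)
      then show ?thesis by (simp add: shuffle_sum_def)
    qed
    show ?case
    proof (rule fps_eq_theta)
      have "fps_X * fps_deriv (shuffle_sum ?L u v) = shuffle_sum (delete_first xi0 ?L) u v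
          - shuffle_sum (delete_last xi0 ?L) u v + ?G * shuffle_sum (delete_first xi1 ?L) u v"
        unfolding linear theta_polylog_fps shuffle_sum_add shuffle_sum_diff shuffle_sum_scale ..
      also have "\<dots> = (fps_X * fps_deriv (?L u)) * ?L v + ?L u * (fps_X * fps_deriv (?L v))"
        unfolding first last theta_polylog_fps by (simp add: algebra_simps)
      also have "\<dots> = fps_X * fps_deriv (?L u * ?L v)"
        by (simp add: algebra_simps)
      finally show "fps_X * fps_deriv (shuffle_sum ?L u v) = fps_X * fps_deriv (?L u * ?L v)" .
      have "fps_nth (shuffle_sum ?L u v) 0 = shuffle_sum (\<lambda>w. polylog_coeff w 0) u v"
      proof -
        have "fps_nth (\<Sum>w\<leftarrow>ws. ?L w) 0 = (\<Sum>w\<leftarrow>ws. polylog_coeff w 0)" for ws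
          by (induction ws) simp_all
        then show ?thesis by (simp add: shuffle_sum_def)
      qed
      also have "\<dots> = (if u = [] \<and> v = [] then 1 else 0)"
        by (cases u; cases v) (simp_all add: polylog_coeff_0)
      finally show "fps_nth (shuffle_sum ?L u v) 0 = fps_nth (?L u * ?L v) 0"
        by (auto simp: polylog_coeff_0)
    qed
  qed
  then show ?thesis by (simp add: shuffle_character_def)
qed

definition polylog :: "letter list \<Rightarrow> complex \<Rightarrow> complex" where
  "polylog w z = suminf (\<lambda>m. polylog_coeff w m * z ^ m)"

lemma summable_bounded_power:
  fixes z :: complex
  assumes "\<And>m. norm (c m) \<le> C" "norm z < 1"
  shows "summable (\<lambda>m. norm (c m * z ^ m))"
proof (rule summable_comparison_test)
  show "summable (\<lambda>m. C * norm z ^ m)" using assms(2) by (intro summable_mult summable_geometric) simp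
  show "\<exists>N. \<forall>m\<ge>N. norm (norm (c m * z ^ m)) \<le> C * norm z ^ m"
    using assms(1) by (auto simp: norm_mult norm_power intro!: mult_right_mono)
qed

lemma polylog_fps_conv_radius: "fps_conv_radius (polylog_fps w) \<ge> 1"
  unfolding fps_conv_radius_def
proof (rule conv_radius_geI_ex')
  fix r :: real assume "0 < r" "ereal r < 1"
  then show "summable (\<lambda>m. fps_nth (polylog_fps w) m * of_real r ^ m)"
    using summable_norm_cancel[OF summable_bounded_power[OF norm_polylog_coeff[of w], of "of_real r"]]
    by simp
qed

lemma shuffle_character_polylog:
  assumes "norm z < 1"
  shows "shuffle_character (\<lambda>w. polylog w z)"
proof -
  have eval: "polylog w z = eval_fps (polylog_fps w) z" for w
    by (simp add: polylog_def eval_fps_def)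
  have radius: "norm z < fps_conv_radius (polylog_fps w)" for w
    using polylog_fps_conv_radius[of w] assms by (metis ereal_less(3) less_le_trans one_ereal_def)
  have "norm z < fps_conv_radius (\<Sum>w\<leftarrow>ws. polylog_fps w) \<and>
      eval_fps (\<Sum>w\<leftarrow>ws. polylog_fps w) z = (\<Sum>w\<leftarrow>ws. polylog w z)" for ws
  proof (induction ws)
    case (Cons w ws)
    then show ?case using radius[of w]
      by (auto simp: eval eval_fps_add intro!: less_le_trans[OF _ fps_conv_radius_add])
  qed simp
  then have "shuffle_sum (\<lambda>w. polylog w z) u v = eval_fps (shuffle_sum polylog_fps u v) z" for u v
    by (simp add: shuffle_sum_def)
  then show ?thesis
    by (simp add: shuffle_character_def shuffle_characterD[OF shuffle_character_polylog_fps] eval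
        eval_fps_mult radius)
qed

lemma polylog_xi0: "polylog [xi0] z = 0"
  by (simp add: polylog_def polylog_coeff.simps(2))

lemma polylog_xi1:
  assumes "norm z < 1"
  shows "polylog [xi1] z = - Ln (1 - z)"
proof -
  have "(\<lambda>m. - (- (z ^ m) / of_nat m)) sums - Ln (1 - z)"
    using Ln_series'[of "- z"] assms by (intro sums_minus) simp
  moreover have "polylog_coeff [xi1] m = 1 / of_nat m" for m
  proof (cases m)
    case (Suc k)
    then show ?thesis by (simp add: polylog_coeff.simps(2) sum.lessThan_Suc_shift del: sum.lessThan_Suc)
  qed (simp add: polylog_coeff_0)
  ultimately show ?thesis by (simp add: polylog_def sums_iff)
qed

lemma conv_power_word_left: "a \<noteq> b \<Longrightarrow> conv (power_word a t) g (b # v) = g (b # v)"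
proof -
  assume "a \<noteq> b"
  then have "conv (power_word a t) g (b # v)
      = (\<Sum>i\<le>length (b # v). if i = 0 then g (b # v) else 0)"
    unfolding conv_def by (intro sum.cong refl) (auto simp: power_word_def take_Cons' )
  then show ?thesis by simp
qed

lemma conv_power_word_right: "a \<noteq> b \<Longrightarrow> conv g (power_word a t) (v @ [b]) = g (v @ [b])"
proof -
  assume "a \<noteq> b"
  then have "conv g (power_word a t) (v @ [b])
      = (\<Sum>i\<le>length (v @ [b]). if i = length (v @ [b]) then g (v @ [b]) else 0)"
    unfolding conv_def by (intro sum.cong refl) (auto simp: power_word_def)
  then show ?thesis by simp
qed

text \<open>
  The coefficients of \<open>(1 - z)\<^sup>B L(z)\<close>, where \<open>L(z) = (\<Sum>w. p w W) z\<^sup>A\<close> is the solution normalized at 0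
  and \<open>A\<close>, \<open>B\<close> are the values of the letters.
\<close>

definition regularized_polylog :: "complex \<Rightarrow> letter list \<Rightarrow> complex" where
  "regularized_polylog z =
     conv (conv (power_word xi1 (Ln (1 - z))) (\<lambda>w. polylog w z)) (power_word xi0 (Ln z))"

lemma polylog_Nil [simp]: "norm z < 1 \<Longrightarrow> polylog [] z = 1"
  using shuffle_characterD(1)[OF shuffle_character_polylog] .

lemma power_word_Nil [simp]: "power_word a t [] = 1"
  by (simp add: power_word_def)

lemma regularized_polylog_properties:
  assumes "norm z < 1"
  shows "shuffle_character (regularized_polylog z)"
    "regularized_polylog z [xi1] = 0" "regularized_polylog z [xi0] = Ln z"
    "admissible w \<Longrightarrow> regularized_polylog z w = polylog w z"
proof -
  show "shuffle_character (regularized_polylog z)"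
    unfolding regularized_polylog_def
    by (intro shuffle_character_conv shuffle_character_power_word shuffle_character_polylog assms)
  show "regularized_polylog z [xi1] = 0" "regularized_polylog z [xi0] = Ln z"
    using assms by (simp_all add: regularized_polylog_def conv_Cons polylog_xi0 polylog_xi1 power_word_def)
  show "admissible w \<Longrightarrow> regularized_polylog z w = polylog w z"
    using assms conv_power_word_right[of xi0 xi1 _ _ "xi0 # _"]
    by (auto simp: admissible_def regularized_polylog_def conv_power_word_left)
qed

section \<open>Multiple zeta values as limits of polylogarithms\<close>

text \<open>
  The part of the multiple zeta series that belongs to the index \<open>n\<^sub>1 = m\<close>. For the empty list the
  whole weight is put at \<open>m = 0\<close>, so that the sum over \<open>l < m\<close> in the recursion is 1.
\<close>

fun mzv_coeff :: "nat list \<Rightarrow> nat \<Rightarrow> real" where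
  "mzv_coeff [] m = (if m = 0 then 1 else 0)"
| "mzv_coeff (k # ks) m = (\<Sum>l<m. mzv_coeff ks l) / real m ^ k"

lemma mzv_coeff_nonneg: "mzv_coeff ks m \<ge> 0"
  by (induction ks m rule: mzv_coeff.induct) (auto intro!: divide_nonneg_nonneg sum_nonneg)

lemma index_word_simps [simp]:
  "index_word [] = []" "index_word (k # ks) = replicate (k - 1) xi0 @ xi1 # index_word ks"
  by (simp_all add: index_word_def)

lemma last_index_word: "index_word ks = [] \<or> last (index_word ks) = xi1"
  by (induction ks) auto

lemma polylog_coeff_index_word:
  "\<forall>k\<in>set ks. 1 \<le> k \<Longrightarrow> polylog_coeff (index_word ks) m = of_real (mzv_coeff ks m)"
proof (induction ks arbitrary: m)
  case (Cons k ks)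
  have last: "last (xi1 # index_word ks) = xi1" using last_index_word[of ks] by auto
  have "polylog_coeff (replicate n xi0 @ xi1 # index_word ks) m
      = of_real ((\<Sum>l<m. mzv_coeff ks l) / real m ^ Suc n)" for n
  proof (induction n)
    case 0
    show ?case using Cons last by (simp add: polylog_coeff.simps(2) del: last.simps)
  next
    case (Suc n)
    have "last (xi0 # replicate n xi0 @ xi1 # index_word ks) = xi1"
      using last_append[of "replicate (Suc n) xi0" "xi1 # index_word ks"] last by simp
    then have "polylog_coeff (replicate (Suc n) xi0 @ xi1 # index_word ks) m
        = polylog_coeff (replicate n xi0 @ xi1 # index_word ks) m / of_nat m"
      by (simp add: polylog_coeff.simps(2) del: last.simps)
    also have "\<dots> = of_real ((\<Sum>l<m. mzv_coeff ks l) / real m ^ Suc n) / of_nat m"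
      by (simp only: Suc)
    also have "\<dots> = of_real ((\<Sum>l<m. mzv_coeff ks l) / real m ^ Suc (Suc n))"
      by (simp add: mult_ac)
    finally show ?case .
  qed
  moreover obtain n where "k = Suc n" using Cons.prems by (cases k) auto
  ultimately show ?case by simp
qed simp

lemma sum_inverse_sqrt_le: "(\<Sum>l<m. 1 / sqrt (real l)) \<le> 2 * sqrt (real m)"
proof -
  have "(\<Sum>l<Suc m. 1 / sqrt (real l)) \<le> 2 * sqrt (real m)" for m
  proof (induction m)
    case (Suc m)
    define a where "a = sqrt (real m)"
    define b where "b = sqrt (real (Suc m))"
    have b: "b > 0" "b\<^sup>2 = a\<^sup>2 + 1" by (simp_all add: a_def b_def)
    have "0 \<le> (b - a)\<^sup>2" by simp
    then have "1 \<le> (2 * (b - a)) * b" using b(2) by (simp add: power2_eq_square algebra_simps)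
    then have "1 / b \<le> 2 * (b - a)" using b(1) by (simp add: divide_le_eq)
    with Suc show ?case by (simp add: a_def b_def)
  qed simp
  from this[of "m - 1"] show ?thesis
    by (cases m) (auto intro: order_trans)
qed

text \<open>
  The bound \<open>O(\<surd>m)\<close> reproduces itself in the recursion: it is divided by \<open>l\<close> and summed, and the sum of
  \<open>1 / \<surd>l\<close> is again \<open>O(\<surd>m)\<close>. For a first exponent of at least 2 it leaves \<open>O(m\<^sup>-\<^sup>3\<^sup>/\<^sup>2)\<close>.
\<close>

lemma mzv_coeff_partial_sum_le:
  assumes "\<forall>k\<in>set ks. 1 \<le> k"
  shows "\<exists>C\<ge>0. \<forall>m. (\<Sum>l<m. mzv_coeff ks l) \<le> C * sqrt (real m)"
  using assms
proof (induction ks)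
  case Nil
  have "(\<Sum>l<m. mzv_coeff [] l) \<le> 1 * sqrt (real m)" for m
    by (cases m) (simp_all add: sum.lessThan_Suc_shift del: sum.lessThan_Suc)
  then show ?case by (intro exI[of _ 1]) simp
next
  case (Cons k ks)
  then obtain C where C: "C \<ge> 0" "\<And>m. (\<Sum>l<m. mzv_coeff ks l) \<le> C * sqrt (real m)" by auto
  have "mzv_coeff (k # ks) l \<le> C * (1 / sqrt (real l))" for l
  proof (cases "l = 0")
    case False
    have "real l ^ 1 \<le> real l ^ k" using False Cons.prems by (intro power_increasing) auto
    then have "mzv_coeff (k # ks) l \<le> (C * sqrt (real l)) / real l"
      using False C by (simp del: sum.lessThan_Suc) (intro frac_le; simp)
    also have "\<dots> = C * (1 / sqrt (real l))" using False by (simp add: field_simps)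
    finally show ?thesis .
  qed simp
  then have "(\<Sum>l<m. mzv_coeff (k # ks) l) \<le> (\<Sum>l<m. C * (1 / sqrt (real l)))" for m
    by (rule sum_mono)
  also have "(\<Sum>l<m. C * (1 / sqrt (real l))) \<le> (C * 2) * sqrt (real m)" for m
    unfolding sum_distrib_left[symmetric] using sum_inverse_sqrt_le[of m] C(1)
    by (simp add: mult_left_mono mult.assoc)
  finally show ?case using C(1) by (intro exI[of _ "C * 2"]) auto
qed

lemma summable_mzv_coeff:
  assumes "\<forall>k\<in>set ks. 1 \<le> k" "ks = [] \<or> 2 \<le> hd ks"
  shows "summable (mzv_coeff ks)"
proof (cases ks)
  case Nil
  then have "mzv_coeff ks = (\<lambda>m. if m = 0 then 1 else 0)" by auto
  then show ?thesis using summable_single[of 0 "\<lambda>_. 1 :: real"] by simp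
next
  case (Cons k ks')
  then obtain C where C: "C \<ge> 0" "\<And>m. (\<Sum>l<m. mzv_coeff ks' l) \<le> C * sqrt (real m)"
    using mzv_coeff_partial_sum_le[of ks'] assms by auto
  have le: "mzv_coeff ks m \<le> C * real m powr (- 3/2)" for m
  proof (cases "m = 0")
    case False
    have "real m ^ 2 \<le> real m ^ k" using False assms Cons by (intro power_increasing) auto
    then have "mzv_coeff ks m \<le> (C * sqrt (real m)) / real m ^ 2"
      using False C Cons by simp (intro frac_le; simp)
    also have "\<dots> = C * (real m powr (1/2) / real m powr 2)"
      using False by (simp add: powr_half_sqrt powr_numeral)
    also have "real m powr (1/2) / real m powr 2 = real m powr (- 3/2)"
      by (simp only: powr_diff[symmetric]) simp
    finally show ?thesis .
  qed (simp add: Cons)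
  have sm: "summable (\<lambda>m. C * real m powr (- 3/2))"
    by (intro summable_mult) (simp add: summable_real_powr_iff)
  show ?thesis
    by (rule summable_comparison_test'[OF sm, of 0]) (use le in \<open>simp add: mzv_coeff_nonneg\<close>)
qed

abbreviation mzv_indices :: "nat \<Rightarrow> nat list set" where
  "mzv_indices r \<equiv> {ns. length ns = r \<and> sorted_wrt (>) ns \<and> (\<forall>n\<in>set ns. 0 < n)}"

abbreviation mzv_term :: "nat list \<Rightarrow> nat list \<Rightarrow> real" where
  "mzv_term ks ns \<equiv> \<Prod>i<length ks. 1 / real (ns ! i) ^ (ks ! i)"

lemma mzv_term_Cons: "mzv_term (k # ks) (n # ns) = 1 / real n ^ k * mzv_term ks ns"
  by (simp add: prod.lessThan_Suc_shift del: prod.lessThan_Suc)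

lemma mzv_indices_Suc:
  "mzv_indices (Suc r) \<inter> {ns. \<forall>n\<in>set ns. n < M} =
     (\<lambda>(n, ns). n # ns) ` (SIGMA n:{1..<M}. mzv_indices r \<inter> {ns. \<forall>l\<in>set ns. l < n})"
  by (auto simp: length_Suc_conv image_iff) force+

lemma finite_mzv_indices: "finite (mzv_indices r \<inter> {ns. \<forall>n\<in>set ns. n < M})"
proof (rule finite_subset)
  show "mzv_indices r \<inter> {ns. \<forall>n\<in>set ns. n < M} \<subseteq> {ns. set ns \<subseteq> {..<M} \<and> length ns = r}" by auto
  show "finite {ns. set ns \<subseteq> {..<M} \<and> length ns = r}" by (rule finite_lists_length_eq) simp
qed

lemma mzv_partial_sum:
  "M \<noteq> 0 \<or> ks \<noteq> [] \<Longrightarrow>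
     (\<Sum>ns\<in>mzv_indices (length ks) \<inter> {ns. \<forall>n\<in>set ns. n < M}. mzv_term ks ns) = (\<Sum>l<M. mzv_coeff ks l)"
proof (induction ks arbitrary: M)
  case Nil
  have "mzv_indices 0 \<inter> {ns. \<forall>n\<in>set ns. n < M} = {[]}" by auto
  with Nil show ?case by (cases M) (simp_all add: sum.lessThan_Suc_shift del: sum.lessThan_Suc)
next
  case (Cons k ks)
  have "(\<Sum>ns\<in>mzv_indices (length (k # ks)) \<inter> {ns. \<forall>n\<in>set ns. n < M}. mzv_term (k # ks) ns)
      = (\<Sum>(n, ns)\<in>(SIGMA n:{1..<M}. mzv_indices (length ks) \<inter> {ns. \<forall>l\<in>set ns. l < n}).
           mzv_term (k # ks) (n # ns))"
    unfolding list.size(4) add_0_right add_Suc_right mzv_indices_Suc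
    by (subst sum.reindex) (auto simp: inj_on_def case_prod_unfold)
  also have "\<dots> = (\<Sum>n\<in>{1..<M}. \<Sum>ns\<in>mzv_indices (length ks) \<inter> {ns. \<forall>l\<in>set ns. l < n}.
           1 / real n ^ k * mzv_term ks ns)"
    unfolding mzv_term_Cons by (subst sum.Sigma) (auto simp only: finite_mzv_indices finite_atLeastLessThan)
  also have "\<dots> = (\<Sum>n\<in>{1..<M}. mzv_coeff (k # ks) n)"
    by (intro sum.cong refl, unfold sum_distrib_left[symmetric], subst Cons.IH) auto
  also have "\<dots> = (\<Sum>n<M. mzv_coeff (k # ks) n)"
    by (intro sum.mono_neutral_left) (auto simp: Suc_le_eq)
  finally show ?case .
qed

text \<open>
  The terms are nonnegative, and the finite sets of indices below \<open>M\<close> exhaust all indices.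
\<close>

lemma mzv_eq_suminf:
  assumes "summable (mzv_coeff ks)"
  shows "mzv ks = suminf (mzv_coeff ks)"
proof -
  let ?S = "\<lambda>M. \<Sum>l<M. mzv_coeff ks l" and ?L = "suminf (mzv_coeff ks)"
  let ?I = "mzv_indices (length ks)"
  have nonneg: "mzv_term ks ns \<ge> 0" for ns by (intro prod_nonneg) auto
  have "(mzv_term ks has_sum ?L) ?I"
    unfolding has_sum_def
  proof (rule tendstoI)
    fix e :: real assume "e > 0"
    have "?S \<longlonglongrightarrow> ?L" using assms by (rule summable_LIMSEQ)
    then have "\<forall>\<^sub>F M in sequentially. ?L - e < ?S M" using \<open>e > 0\<close> by (intro order_tendstoD) auto
    then have "\<forall>\<^sub>F M in sequentially. M > 0 \<and> ?L - e < ?S M"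
      using eventually_gt_at_top[of "0 :: nat"] by eventually_elim auto
    then obtain M where M: "M > 0" "?L - e < ?S M" by (auto dest: eventually_happens)
    show "\<forall>\<^sub>F F in finite_subsets_at_top ?I. dist (sum (mzv_term ks) F) ?L < e"
      unfolding eventually_finite_subsets_at_top
    proof (intro exI[of _ "?I \<inter> {ns. \<forall>n\<in>set ns. n < M}"] conjI allI impI finite_mzv_indices)
      fix F assume F: "finite F \<and> ?I \<inter> {ns. \<forall>n\<in>set ns. n < M} \<subseteq> F \<and> F \<subseteq> ?I"
      have "?S M \<le> sum (mzv_term ks) F"
        using M(1) F nonneg by (subst mzv_partial_sum[symmetric]) (auto intro!: sum_mono2)
      moreover have "sum (mzv_term ks) F \<le> ?L"
      proof -
        define N where "N = Suc (Max (insert 0 (\<Union> (set ` F))))"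
        have "F \<subseteq> ?I \<inter> {ns. \<forall>n\<in>set ns. n < N}"
          using F by (auto simp: N_def less_Suc_eq_le intro!: Max_ge)
        then have "sum (mzv_term ks) F \<le> ?S N"
          using nonneg by (subst mzv_partial_sum[symmetric])
            (auto simp: N_def intro!: sum_mono2 finite_mzv_indices)
        also have "\<dots> \<le> ?L" using assms by (intro sum_le_suminf) (auto simp: mzv_coeff_nonneg)
        finally show ?thesis .
      qed
      ultimately show "dist (sum (mzv_term ks) F) ?L < e" using M by (auto simp: dist_real_def)
    qed auto
  qed
  then show ?thesis unfolding mzv_def by (rule infsumI)
qed

lemma index_word_exists:
  assumes "w = [] \<or> last w = xi1"
  obtains ks where "\<forall>k\<in>set ks. 1 \<le> k" "index_word ks = w"
proof -
  have "\<exists>ks. (\<forall>k\<in>set ks. 1 \<le> k) \<and> index_word ks = w"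
    using assms
  proof (induction w)
    case (Cons x w)
    show ?case
    proof (cases x)
      case xi0
      with Cons obtain ks where ks: "\<forall>k\<in>set ks. 1 \<le> k" "index_word ks = w" "ks \<noteq> []"
        by (cases "w = []") force+
      then obtain k ks' where "ks = k # ks'" by (cases ks) auto
      with ks xi0 show ?thesis
        by (intro exI[of _ "Suc k # ks'"]) (auto simp: Cons_replicate_eq replicate_append_same Suc_diff_le
             simp flip: replicate_Suc append_Cons)
    next
      case xi1
      from Cons.prems xi1 have "w = [] \<or> last w = xi1" by (auto split: if_splits)
      with Cons.IH obtain ks where "\<forall>k\<in>set ks. 1 \<le> k" "index_word ks = w" by auto
      with xi1 show ?thesis by (intro exI[of _ "1 # ks"]) auto
    qed
  qed (auto intro: exI[of _ "[]"])
  then show ?thesis using that by blast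
qed

lemma index_word_inject:
  assumes "\<forall>k\<in>set ks. 1 \<le> k" "\<forall>k\<in>set ls. 1 \<le> k" "index_word ks = index_word ls"
  shows "ks = ls"
  using assms
proof (induction ks arbitrary: ls)
  case Nil
  then show ?case by (cases ls) auto
next
  case (Cons k ks)
  then obtain l ls' where ls: "ls = l # ls'" by (cases ls) auto
  have takeWhile: "takeWhile (\<lambda>x. x = xi0) (replicate n xi0 @ xi1 # w) = replicate n xi0" for n w
    by (subst takeWhile_append2) auto
  have "replicate (k - 1) xi0 = replicate (l - 1) xi0"
    using Cons.prems(3) takeWhile[of "k - 1" "index_word ks"] takeWhile[of "l - 1" "index_word ls'"] ls
    by simp
  then have "k - 1 = l - 1" by (metis length_replicate)
  moreover have "k = l" using calculation Cons.prems(1,2) ls by auto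
  ultimately show ?case using Cons ls by simp
qed

lemma admissible_index_word:
  assumes "admissible w"
  obtains ks where "\<forall>k\<in>set ks. 1 \<le> k" "index_word ks = w" "summable (mzv_coeff ks)"
    "zeta_word w = suminf (mzv_coeff ks)"
proof -
  have "w = [] \<or> last w = xi1" using assms by (auto simp: admissible_def)
  then obtain ks where ks: "\<forall>k\<in>set ks. 1 \<le> k" "index_word ks = w" by (rule index_word_exists)
  have "ks = [] \<or> 2 \<le> hd ks"
  proof (cases ks)
    case (Cons k ks')
    then have "k \<noteq> 1" "1 \<le> k" using ks assms by (auto simp: admissible_def)
    with Cons show ?thesis by simp
  qed simp
  then have summable: "summable (mzv_coeff ks)" using ks by (intro summable_mzv_coeff)
  have "(THE ks. (\<forall>k\<in>set ks. 1 \<le> k) \<and> index_word ks = w) = ks"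
  proof (rule the_equality)
    show "(\<forall>k\<in>set ks. 1 \<le> k) \<and> index_word ks = w" using ks by blast
    show "ls = ks" if "(\<forall>k\<in>set ls. 1 \<le> k) \<and> index_word ls = w" for ls
      using that ks by (intro index_word_inject) simp_all
  qed
  then have "zeta_word w = suminf (mzv_coeff ks)"
    by (simp add: zeta_word_def mzv_eq_suminf[OF summable])
  with ks summable that show ?thesis by blast
qed

text \<open>
  Abel's theorem in the easy case: the coefficients are nonnegative and summable, hence they
  dominate the series for all \<open>x < 1\<close>.
\<close>

lemma polylog_tendsto_zeta:
  assumes "admissible w"
  shows "((\<lambda>x. polylog w (complex_of_real x)) \<longlongrightarrow> complex_of_real (zeta_word w)) (at_left 1)"
proof -
  obtain ks where ks: "\<forall>k\<in>set ks. 1 \<le> k" "index_word ks = w" "summable (mzv_coeff ks)"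
    "zeta_word w = suminf (mzv_coeff ks)"
    using admissible_index_word[OF assms] by blast
  have coeff: "polylog_coeff w m = complex_of_real (mzv_coeff ks m)" for m
    using polylog_coeff_index_word[OF ks(1)] ks(2) by simp
  have unit: "\<forall>\<^sub>F x in at_left (1::real). 0 < x \<and> x < 1"
    by (rule eventually_at_leftI[of 0]) auto
  have "((\<lambda>x. suminf (\<lambda>m. polylog_coeff w m * complex_of_real x ^ m)) \<longlongrightarrow> suminf (\<lambda>m. complex_of_real (mzv_coeff ks m))) (at_left 1)"
  proof (rule tannerys_theorem[THEN conjunct2, THEN conjunct2])
    show "((\<lambda>x. polylog_coeff w m * complex_of_real x ^ m) \<longlongrightarrow> complex_of_real (mzv_coeff ks m)) (at_left 1)" for m
      by (rule tendsto_eq_intros refl | simp add: coeff)+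
    have "\<forall>\<^sub>F (m, x) in sequentially \<times>\<^sub>F at_left 1. 0 < x \<and> x < (1::real)"
      using eventually_prod2[of sequentially "\<lambda>x. 0 < x \<and> x < (1::real)" "at_left 1"] unit
      by (simp add: case_prod_unfold)
    then show "\<forall>\<^sub>F (m, x) in sequentially \<times>\<^sub>F at_left 1.
        norm (polylog_coeff w m * complex_of_real x ^ m) \<le> mzv_coeff ks m"
    proof (rule eventually_mono, clarify)
      fix m and x :: real assume "0 < x" "x < 1"
      then show "norm (polylog_coeff w m * complex_of_real x ^ m) \<le> mzv_coeff ks m"
        by (simp add: coeff norm_mult norm_power mzv_coeff_nonneg mult_left_le power_le_one)
    qed
  qed (use ks in auto)
  then show ?thesis by (simp add: polylog_def ks(4) suminf_of_real[OF ks(3)])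
qed

text \<open>
  In the decomposition of \<open>w\<close> only the terms without a factor \<open>\<xi>\<^sub>1\<close> contribute, a factor \<open>\<xi>\<^sub>0\<close> gives
  \<open>log z \<longrightarrow> 0\<close>, and on admissible words the regularized polylogarithm is the convergent one.
\<close>

lemma regularized_polylog_tendsto:
  "((\<lambda>x. regularized_polylog (complex_of_real x) w) \<longlongrightarrow> zeta_map (reg10 (word w))) (at_left 1)"
proof -
  obtain W where W: "shuffle_decomposition (word w) W" "reg10 (word w) = W (0, 0)"
    by (rule reg10_word)
  have fin: "finite {ij. W ij \<noteq> 0}" and adm: "\<And>ij v. v \<in> Poly_Mapping.keys (W ij) \<Longrightarrow> admissible v"
    using W(1) by (auto simp: shuffle_decomposition_def S10_eq)
  have unit: "\<forall>\<^sub>F x in at_left (1::real). 0 < x \<and> x < 1"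
    by (rule eventually_at_leftI[of 0]) auto
  let ?p = "\<lambda>x ij. word_lin (\<lambda>v. polylog v (complex_of_real x)) (W ij)"
  let ?t = "\<lambda>x ij. if fst ij = 0 then ?p x ij * (Ln (complex_of_real x) ^ snd ij / fact (snd ij)) else 0"
  have eq: "\<forall>\<^sub>F x in at_left 1. (\<Sum>ij | W ij \<noteq> 0. ?t x ij) = regularized_polylog (complex_of_real x) w"
    using unit
  proof eventually_elim
    case (elim x)
    then have z: "norm (complex_of_real x) < 1" by simp
    have "word_lin (regularized_polylog (complex_of_real x)) (W ij) = ?p x ij" for ij
      unfolding word_lin_def using adm regularized_polylog_properties(4)[OF z]
      by (intro sum.cong) auto
    then show ?case
      by (simp add: word_lin_decomposition[OF W(1) regularized_polylog_properties(1,2)[OF z]]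
          regularized_polylog_properties(3)[OF z] cong: if_cong)
  qed
  have "((\<lambda>x. ?p x ij) \<longlongrightarrow> zeta_map (W ij)) (at_left 1)" for ij
    unfolding zeta_map_word_lin word_lin_def
    by (intro tendsto_intros polylog_tendsto_zeta adm)
  moreover have "((\<lambda>x. Ln (complex_of_real x)) \<longlongrightarrow> Ln (complex_of_real 1)) (at_left 1)"
    by (intro tendsto_intros) auto
  ultimately have "((\<lambda>x. \<Sum>ij | W ij \<noteq> 0. ?t x ij) \<longlongrightarrow> (\<Sum>ij | W ij \<noteq> 0.
      if fst ij = 0 then zeta_map (W ij) * (0 ^ snd ij / fact (snd ij)) else 0)) (at_left 1)"
    by (intro tendsto_sum) (auto intro!: tendsto_eq_intros)
  also have "(\<Sum>ij | W ij \<noteq> 0. if fst ij = 0 then zeta_map (W ij) * (0 ^ snd ij / fact (snd ij)) else 0)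
      = (\<Sum>ij | W ij \<noteq> 0. if ij = (0, 0) then zeta_map (W (0, 0)) else 0)"
    by (intro sum.cong) (auto simp: power_0_left)
  also have "\<dots> = zeta_map (W (0, 0))"
    using fin by (auto simp: zeta_map_word_lin)
  finally show ?thesis
    unfolding W(2) by (rule Lim_transform_eventually[OF _ eq])
qed

section \<open>Linear functionals on the homogeneous components\<close>

abbreviation clinear :: "(kz_lie uea \<Rightarrow> complex) \<Rightarrow> bool" where
  "clinear \<equiv> Vector_Spaces.linear (*\<^sub>C) (*)"

lemma clinearI:
  assumes "\<And>x y. \<phi> (x + y) = \<phi> x + \<phi> y" "\<And>c x. \<phi> (c *\<^sub>C x) = c * \<phi> x"
  shows "clinear \<phi>"
  unfolding Vector_Spaces.linear_iff using assms
  by (simp add: vector_space_def scaleC_add_left scaleC_add_right distrib_left distrib_right)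

lemma clinearD:
  assumes "clinear \<phi>"
  shows "\<phi> (x + y) = \<phi> x + \<phi> y" "\<phi> (c *\<^sub>C x) = c * \<phi> x" "\<phi> 0 = 0" "\<phi> (x - y) = \<phi> x - \<phi> y"
    "\<phi> (sum g A) = (\<Sum>a\<in>A. \<phi> (g a))"
proof -
  show add: "\<phi> (x + y) = \<phi> x + \<phi> y" and scale: "\<phi> (c *\<^sub>C x) = c * \<phi> x" for x y c
    using assms unfolding Vector_Spaces.linear_iff by auto
  show zero: "\<phi> 0 = 0" using add[of 0 0] by simp
  show "\<phi> (x - y) = \<phi> x - \<phi> y" using add[of "x - y" y] by simp
  show "\<phi> (sum g A) = (\<Sum>a\<in>A. \<phi> (g a))"
    by (induction A rule: infinite_finite_induct) (simp_all add: add zero)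
qed

lemma
  assumes "clinear \<phi>"
  shows clinear_mult_left: "clinear (\<lambda>x. \<phi> (a * x))" and clinear_mult_right: "clinear (\<lambda>x. \<phi> (x * a))"
  by (rule clinearI; simp add: clinearD[OF assms] distrib_left distrib_right)+

text \<open>
  The components are finite-dimensional. The coordinates are linear functionals on the whole algebra,
  as in the definition of \<^const>\<open>has_differential\<close>; they come from the extension of a basis.
\<close>

lemma uea_deg_coordinates:
  obtains E \<psi> where "finite E" "E \<subseteq> uea_deg n" "\<And>e. clinear (\<psi> e)"
    "\<And>x. x \<in> uea_deg n \<Longrightarrow> x = (\<Sum>e\<in>E. \<psi> e x *\<^sub>C e)"
proof -
  let ?G = "{uea_in (Omega i j) | i j. True}"
  let ?S = "{prod_list xs | xs. length xs = n \<and> set xs \<subseteq> ?G}"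
  have "?G = range (\<lambda>(i, j). uea_in (Omega i j))" by auto
  then have "finite ?G" by simp
  then have "finite {xs. set xs \<subseteq> ?G \<and> length xs = n}" by (rule finite_lists_length_eq)
  moreover have "?S = prod_list ` {xs. set xs \<subseteq> ?G \<and> length xs = n}" by auto
  ultimately have "finite ?S" by simp
  obtain B where B: "B \<subseteq> ?S" "\<not> complex_vector.dependent B" "?S \<subseteq> complex_vector.span B"
    using complex_vector.maximal_independent_subset[of ?S] by blast
  then have fin: "finite B" using \<open>finite ?S\<close> finite_subset by blast
  have "complex_vector.span ?S \<subseteq> complex_vector.span B"
    using B(3) complex_vector.span_minimal complex_vector.subspace_span by blast
  then have span: "uea_deg n \<subseteq> complex_vector.span B" by (simp add: uea_deg_def)
  let ?C = "complex_vector.extend_basis B"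
  have C: "\<not> complex_vector.dependent ?C" "complex_vector.span ?C = UNIV" "B \<subseteq> ?C"
    using B(2) complex_vector.independent_extend_basis complex_vector.span_extend_basis
      complex_vector.extend_basis_superset by blast+
  show ?thesis
  proof (rule that[of B "\<lambda>e x. complex_vector.representation ?C x e"])
    show "B \<subseteq> uea_deg n"
      using B(1) complex_vector.span_superset[of ?S] by (auto simp: uea_deg_def)
    show "clinear (\<lambda>x. complex_vector.representation ?C x e)" for e
      by (rule clinearI) (simp_all add: complex_vector.representation_add[OF C(1)]
        complex_vector.representation_scale[OF C(1)] C(2))
    fix x assume "x \<in> uea_deg n"
    then have x: "x \<in> complex_vector.span B" using span by auto
    have "complex_vector.representation ?C x = complex_vector.representation B x"
      using complex_vector.representation_extend[OF C(1) x C(3)] .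
    then show "x = (\<Sum>e\<in>B. complex_vector.representation ?C x e *\<^sub>C e)"
      using complex_vector.sum_representation_eq[OF B(2) x fin order_refl] by simp
  qed (rule fin)
qed

lemma uea_deg_eqI:
  assumes "x \<in> uea_deg n" "y \<in> uea_deg n" "\<And>\<phi>. clinear \<phi> \<Longrightarrow> \<phi> x = \<phi> y"
  shows "x = y"
proof -
  obtain E \<psi> where E: "\<And>e. clinear (\<psi> e)" "\<And>x. x \<in> uea_deg n \<Longrightarrow> x = (\<Sum>e\<in>E. \<psi> e x *\<^sub>C e)"
    by (rule uea_deg_coordinates[of n]) blast
  have "x = (\<Sum>e\<in>E. \<psi> e x *\<^sub>C e)" by (rule E(2)[OF assms(1)])
  also have "\<dots> = (\<Sum>e\<in>E. \<psi> e y *\<^sub>C e)" using assms(3)[OF E(1)] by simp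
  also have "\<dots> = y" by (rule E(2)[OF assms(2), symmetric])
  finally show ?thesis .
qed

section \<open>Components of the completed algebra\<close>

lemma component_in_deg [simp]: "component x n \<in> uea_deg n"
  using Rep_kz_compl[of x] by (simp add: component_def)

lemma kz_compl_eqI: "(\<And>n. component x n = component y n) \<Longrightarrow> x = y"
  by (simp add: component_def Rep_kz_compl_inject[symmetric] fps_eq_iff)

lemma component_zero [simp]: "component 0 n = 0"
  by (simp add: component_def zero_kz_compl.rep_eq)

lemma component_one: "component 1 n = (if n = 0 then 1 else 0)"
  by (simp add: component_def one_kz_compl.rep_eq)

lemma component_add [simp]: "component (x + y) n = component x n + component y n"
  by (simp add: component_def plus_kz_compl.rep_eq)

lemma component_diff [simp]: "component (x - y) n = component x n - component y n"
  by (simp add: component_def minus_kz_compl.rep_eq)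

lemma component_uminus [simp]: "component (- x) n = - component x n"
  by (simp add: component_def uminus_kz_compl.rep_eq)

lemma component_scaleC [simp]: "component (c *\<^sub>C x) n = c *\<^sub>C component x n"
  by (simp add: component_def scaleC_kz_compl.rep_eq)

lemma component_mult: "component (x * y) n = (\<Sum>i=0..n. component x i * component y (n - i))"
  by (simp add: component_def times_kz_compl.rep_eq fps_mult_nth)

lemma component_mult_0 [simp]: "component (x * y) 0 = component x 0 * component y 0"
  by (simp add: component_mult)

lemma component_formal_sum:
  assumes "finite A" "\<And>i. i \<notin> A \<Longrightarrow> component (f i) n = 0"
  shows "component (formal_sum f) n = (\<Sum>i\<in>A. component (f i) n)"
proof -
  have "component (formal_sum f) n = Sum_any (\<lambda>i. component (f i) n)"
    by (simp add: component_def formal_sum.rep_eq o_def)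
  also have "\<dots> = (\<Sum>i\<in>A. component (f i) n)"
    using assms by (intro Sum_any.expand_superset) auto
  finally show ?thesis .
qed

definition degree_one :: "kz_lie \<Rightarrow> bool" where
  "degree_one x \<longleftrightarrow> uea_in x \<in> uea_deg 1"

lemma component_of_deg1:
  assumes "degree_one x"
  shows "component (of_deg1 x) n = (if n = 1 then uea_in x else 0)"
proof -
  have "Rep_kz_compl (of_deg1 x) = Abs_fps (\<lambda>n. if n = 1 \<and> uea_in x \<in> uea_deg 1 then uea_in x else 0)"
    unfolding of_deg1_def
    by (rule Abs_kz_compl_inverse) (simp add: complex_vector.subspace_0[OF subspace_uea_deg])
  with assms show ?thesis by (simp add: component_def degree_one_def)
qed

lemma component_of_deg1_mult:
  assumes "degree_one x"
  shows "component (of_deg1 x * y) 0 = 0" "component (of_deg1 x * y) (Suc n) = uea_in x * component y n"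
    "component (y * of_deg1 x) 0 = 0" "component (y * of_deg1 x) (Suc n) = component y n * uea_in x"
proof -
  have "component (of_deg1 x * y) (Suc n) = (\<Sum>i=0..Suc n. if i = 1 then uea_in x * component y n else 0)"
    unfolding component_mult by (intro sum.cong) (auto simp: component_of_deg1[OF assms])
  then show "component (of_deg1 x * y) (Suc n) = uea_in x * component y n" by simp
  have "component (y * of_deg1 x) (Suc n) = (\<Sum>i=0..Suc n. if i = n then component y n * uea_in x else 0)"
    unfolding component_mult by (intro sum.cong) (auto simp: component_of_deg1[OF assms])
  then show "component (y * of_deg1 x) (Suc n) = component y n * uea_in x" by simp
qed (simp_all add: component_of_deg1[OF assms])

lemma component_of_deg1_power:
  assumes "degree_one x"
  shows "component (of_deg1 x ^ k) n = (if n = k then uea_in x ^ k else 0)"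
proof (induction k arbitrary: n)
  case (Suc k)
  show ?case
    by (cases n) (simp_all add: component_of_deg1_mult[OF assms] component_of_deg1[OF assms] Suc)
qed (simp add: component_one)

definition order_ge :: "nat \<Rightarrow> kz_compl \<Rightarrow> bool" where
  "order_ge n x \<longleftrightarrow> (\<forall>k<n. component x k = 0)"

lemma component_mult_lowest_left:
  assumes "order_ge n x"
  shows "component (x * y) n = component x n * component y 0"
proof -
  have "component (x * y) n = (\<Sum>i=0..n. if i = n then component x n * component y 0 else 0)"
    unfolding component_mult using assms by (intro sum.cong) (auto simp: order_ge_def)
  then show ?thesis by simp
qed

lemma component_mult_lowest_right:
  assumes "order_ge n y"
  shows "component (x * y) n = component x 0 * component y n"
proof -
  have "component (x * y) n = (\<Sum>i=0..n. if i = 0 then component x 0 * component y n else 0)"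
    unfolding component_mult using assms by (intro sum.cong) (auto simp: order_ge_def)
  then show ?thesis by simp
qed

lemma order_ge_cancel_right:
  assumes "order_ge n (x * y)" "component y 0 = 1"
  shows "order_ge n x"
proof -
  have "k < n \<longrightarrow> component x k = 0" for k
  proof (induction k rule: less_induct)
    case (less k)
    show ?case
    proof
      assume k: "k < n"
      then have "order_ge k x" using less by (auto simp: order_ge_def)
      from component_mult_lowest_left[OF this, of y] show "component x k = 0"
        using assms k by (auto simp: order_ge_def)
    qed
  qed
  then show ?thesis by (simp add: order_ge_def)
qed

text \<open>
  By induction on the degree: the lowest component of \<open>x (y - z)\<close> is that of \<open>y - z\<close>.
\<close>

lemma left_cancel_unipotent:
  assumes "x * y = x * z" "component x 0 = 1"
  shows "y = z"
proof (rule kz_compl_eqI)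
  fix n
  have "component (y - z) n = 0" for n
  proof (induction n rule: less_induct)
    case (less n)
    then have "order_ge n (y - z)" by (auto simp: order_ge_def)
    from component_mult_lowest_right[OF this, of x] show ?case
      using assms by (simp add: right_diff_distrib)
  qed
  from this[of n] show "component y n = component z n" by simp
qed

section \<open>Limits and derivatives degree by degree\<close>

definition coordinate_functionals :: "(kz_compl \<Rightarrow> complex) set" where
  "coordinate_functionals = {\<lambda>x. \<phi> (component x n) | \<phi> n. clinear \<phi>}"

lemma coordinate_functionalI: "clinear \<phi> \<Longrightarrow> (\<lambda>x. \<phi> (component x n)) \<in> coordinate_functionals"
  by (auto simp: coordinate_functionals_def)

lemma coordinate_functional_linear:
  assumes "f \<in> coordinate_functionals"
  shows "f (x + y) = f x + f y" "f (x - y) = f x - f y" "f (c *\<^sub>C x) = c * f x" "f 0 = 0"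
  using assms by (auto simp: coordinate_functionals_def clinearD)

lemma kz_compl_eq_functionalI:
  assumes "\<And>f. f \<in> coordinate_functionals \<Longrightarrow> f x = f y"
  shows "x = y"
proof (rule kz_compl_eqI)
  show "component x n = component y n" for n
    by (rule uea_deg_eqI[of _ n]) (simp_all add: assms[OF coordinate_functionalI])
qed

text \<open>
  By finite-dimensionality a functional of a product is a finite sum of products of functionals of
  the factors. This reduces limits and derivatives of products to those of scalar functions.
\<close>

lemma coordinate_functional_mult:
  assumes "f \<in> coordinate_functionals"
  obtains I :: "(nat \<times> kz_lie uea) set" and \<alpha> \<beta> where "finite I"
    "\<And>i. \<alpha> i \<in> coordinate_functionals" "\<And>i. \<beta> i \<in> coordinate_functionals"
    "\<And>x y. f (x * y) = (\<Sum>i\<in>I. \<alpha> i x * \<beta> i y)"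
proof -
  obtain \<phi> n where f: "f = (\<lambda>x. \<phi> (component x n))" and \<phi>: "clinear \<phi>"
    using assms by (auto simp: coordinate_functionals_def)
  have "\<forall>k. \<exists>E \<psi>. finite E \<and> (\<forall>e. clinear (\<psi> e)) \<and> (\<forall>x\<in>uea_deg k. x = (\<Sum>e\<in>E. \<psi> e x *\<^sub>C e))"
  proof
    show "\<exists>E \<psi>. finite E \<and> (\<forall>e. clinear (\<psi> e)) \<and> (\<forall>x\<in>uea_deg k. x = (\<Sum>e\<in>E. \<psi> e x *\<^sub>C e))" for k
      by (rule uea_deg_coordinates[of k]) blast
  qed
  then obtain E \<psi> where E: "\<And>k. finite (E k)" "\<And>k e. clinear (\<psi> k e)"
    "\<And>k x. x \<in> uea_deg k \<Longrightarrow> x = (\<Sum>e\<in>E k. \<psi> k e x *\<^sub>C e)"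
    by metis
  show ?thesis
  proof (rule that[of "SIGMA k:{0..n}. E k" "\<lambda>i x. \<psi> (fst i) (snd i) (component x (fst i))"
        "\<lambda>i y. \<phi> (snd i * component y (n - fst i))"])
    show "finite (SIGMA k:{0..n}. E k)" using E(1) by auto
    show "(\<lambda>x. \<psi> (fst i) (snd i) (component x (fst i))) \<in> coordinate_functionals" for i
      by (intro coordinate_functionalI E)
    show "(\<lambda>y. \<phi> (snd i * component y (n - fst i))) \<in> coordinate_functionals" for i
      by (intro coordinate_functionalI clinear_mult_left \<phi>)
    fix x y
    have "\<phi> (component x k * z) = (\<Sum>e\<in>E k. \<psi> k e (component x k) * \<phi> (e * z))" for k z
      by (subst E(3)[OF component_in_deg[of x k]])
        (simp add: sum_distrib_right clinearD[OF \<phi>])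
    then show "f (x * y) = (\<Sum>i\<in>(SIGMA k:{0..n}. E k).
        \<psi> (fst i) (snd i) (component x (fst i)) * \<phi> (snd i * component y (n - fst i)))"
      using E(1) by (simp add: f component_mult clinearD[OF \<phi>] sum.Sigma split_beta)
  qed
qed

definition kz_tendsto :: "('a \<Rightarrow> kz_compl) \<Rightarrow> kz_compl \<Rightarrow> 'a filter \<Rightarrow> bool" where
  "kz_tendsto g L F \<longleftrightarrow> (\<forall>f\<in>coordinate_functionals. ((\<lambda>x. f (g x)) \<longlongrightarrow> f L) F)"

lemma kz_tendsto_const: "kz_tendsto (\<lambda>x. c) c F"
  by (simp add: kz_tendsto_def)

lemma kz_tendsto_diff: "kz_tendsto g L F \<Longrightarrow> kz_tendsto h M F \<Longrightarrow> kz_tendsto (\<lambda>x. g x - h x) (L - M) F"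
  by (auto simp: kz_tendsto_def coordinate_functional_linear intro!: tendsto_intros)

lemma kz_tendsto_mult:
  assumes "kz_tendsto g L F" "kz_tendsto h M F"
  shows "kz_tendsto (\<lambda>x. g x * h x) (L * M) F"
  unfolding kz_tendsto_def
proof
  fix f assume "f \<in> coordinate_functionals"
  then obtain I :: "(nat \<times> kz_lie uea) set" and \<alpha> \<beta> where *: "finite I"
    "\<And>i. \<alpha> i \<in> coordinate_functionals" "\<And>i. \<beta> i \<in> coordinate_functionals"
    "\<And>x y. f (x * y) = (\<Sum>i\<in>I. \<alpha> i x * \<beta> i y)"
    by (rule coordinate_functional_mult) blast
  show "((\<lambda>x. f (g x * h x)) \<longlongrightarrow> f (L * M)) F"
    unfolding *(4) using assms *(2,3) by (intro tendsto_intros) (auto simp: kz_tendsto_def)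
qed

lemma kz_tendsto_component_const:
  assumes "kz_tendsto g L F" "F \<noteq> bot" "\<forall>\<^sub>F x in F. component (g x) n = c"
  shows "component L n = c"
proof (rule uea_deg_eqI[of _ n])
  obtain x where "component (g x) n = c" using assms(2,3) eventually_happens' by blast
  then show "c \<in> uea_deg n" by (metis component_in_deg)
  fix \<phi> assume \<phi>: "clinear \<phi>"
  have "((\<lambda>x. \<phi> (component (g x) n)) \<longlongrightarrow> \<phi> (component L n)) F"
    using assms(1) coordinate_functionalI[OF \<phi>] by (auto simp: kz_tendsto_def)
  moreover have "((\<lambda>x. \<phi> (component (g x) n)) \<longlongrightarrow> \<phi> c) F"
    by (rule tendsto_eventually) (use assms(3) in eventually_elim, auto)
  ultimately show "\<phi> (component L n) = \<phi> c" using tendsto_unique assms(2) by blast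
qed simp

lemma has_differential_iff:
  "has_differential G G' w \<longleftrightarrow>
    (\<forall>f\<in>coordinate_functionals. ((\<lambda>v. f (G v)) has_derivative (\<lambda>h. f (G' h))) (at w))"
  by (auto simp: has_differential_def coordinate_functionals_def)

lemma has_differential_diff:
  "has_differential F F' w \<Longrightarrow> has_differential G G' w \<Longrightarrow>
     has_differential (\<lambda>v. F v - G v) (\<lambda>h. F' h - G' h) w"
  by (auto simp: has_differential_iff coordinate_functional_linear intro!: derivative_intros)

lemma has_differential_mult:
  assumes "has_differential F F' w" "has_differential G G' w"
  shows "has_differential (\<lambda>v. F v * G v) (\<lambda>h. F' h * G w + F w * G' h) w"
  unfolding has_differential_iff
proof
  fix f assume f: "f \<in> coordinate_functionals"
  then obtain I :: "(nat \<times> kz_lie uea) set" and \<alpha> \<beta> where *: "finite I"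
    "\<And>i. \<alpha> i \<in> coordinate_functionals" "\<And>i. \<beta> i \<in> coordinate_functionals"
    "\<And>x y. f (x * y) = (\<Sum>i\<in>I. \<alpha> i x * \<beta> i y)"
    by (rule coordinate_functional_mult) blast
  have "((\<lambda>v. \<Sum>i\<in>I. \<alpha> i (F v) * \<beta> i (G v)) has_derivative
      (\<lambda>h. \<Sum>i\<in>I. \<alpha> i (F w) * \<beta> i (G' h) + \<alpha> i (F' h) * \<beta> i (G w))) (at w)"
    using assms *(2,3) by (intro has_derivative_sum has_derivative_mult) (auto simp: has_differential_iff)
  then show "((\<lambda>v. f (F v * G v)) has_derivative (\<lambda>h. f (F' h * G w + F w * G' h))) (at w)"
    by (simp add: coordinate_functional_linear(1)[OF f] *(4) sum.distrib add.commute)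
qed

lemma has_differential_const: "has_differential (\<lambda>v. c) (\<lambda>h. 0) w"
  by (simp add: has_differential_iff coordinate_functional_linear)

lemma has_differential_compose:
  assumes "has_differential G G' (g w)" "(g has_derivative g') (at w)"
  shows "has_differential (\<lambda>v. G (g v)) (\<lambda>h. G' (g' h)) w"
  unfolding has_differential_iff
proof
  fix f assume "f \<in> coordinate_functionals"
  then have "((\<lambda>v. f (G v)) has_derivative (\<lambda>h. f (G' h))) (at (g w))"
    using assms(1) by (simp add: has_differential_iff)
  from diff_chain_at[OF assms(2) this]
  show "((\<lambda>v. f (G (g v))) has_derivative (\<lambda>h. f (G' (g' h)))) (at w)" by (simp add: o_def)
qed

lemma has_differential_tendsto:
  assumes "has_differential G G' w" "(g \<longlongrightarrow> w) F"
  shows "kz_tendsto (\<lambda>x. G (g x)) (G w) F"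
  unfolding kz_tendsto_def
proof
  fix f assume "f \<in> coordinate_functionals"
  then have "isCont (\<lambda>v. f (G v)) w"
    using assms(1) has_derivative_continuous unfolding has_differential_iff by blast
  from isCont_tendsto_compose[OF this assms(2)] show "((\<lambda>x. f (G (g x))) \<longlongrightarrow> f (G w)) F" .
qed

lemma open_pentagon_image:
  "open_pentagon = (\<lambda>p. (complex_of_real (fst p), complex_of_real (snd p))) ` ({0<..<1} \<times> {0<..<1})"
  by (force simp: open_pentagon_def image_iff)

lemma convex_open_pentagon: "convex open_pentagon"
  unfolding open_pentagon_image
proof (rule convex_linear_image)
  show "linear (\<lambda>p. (complex_of_real (fst p), complex_of_real (snd p)))"
    by (rule linearI) (simp_all add: scaleR_conv_of_real)
  show "convex ({0<..<1} \<times> {0<..<1} :: (real \<times> real) set)"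
    by (intro convex_Times) auto
qed

lemma component_constant_on_pentagon:
  assumes "\<And>w. w \<in> open_pentagon \<Longrightarrow> has_differential D (D' w) w"
    and "\<And>w h. w \<in> open_pentagon \<Longrightarrow> component (D' w h) n = 0"
  obtains c where "\<And>w. w \<in> open_pentagon \<Longrightarrow> component (D w) n = c"
proof -
  define w0 where "w0 = (complex_of_real (1/2), complex_of_real (1/2))"
  have w0: "w0 \<in> open_pentagon" unfolding w0_def open_pentagon_image by (rule image_eqI[of _ _ "(1/2, 1/2)"]) auto
  have "component (D w) n = component (D w0) n" if w: "w \<in> open_pentagon" for w
  proof (rule uea_deg_eqI[of _ n])
    fix \<phi> assume \<phi>: "clinear \<phi>"
    have "((\<lambda>v. \<phi> (component (D v) n)) has_derivative (\<lambda>h. 0)) (at v within open_pentagon)"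
      if v: "v \<in> open_pentagon" for v
    proof (rule has_derivative_at_withinI)
      have "((\<lambda>v. \<phi> (component (D v) n)) has_derivative (\<lambda>h. \<phi> (component (D' v h) n))) (at v)"
        using assms(1)[OF v] \<phi> by (simp add: has_differential_def)
      then show "((\<lambda>v. \<phi> (component (D v) n)) has_derivative (\<lambda>h. 0)) (at v)"
        by (simp only: assms(2)[OF v] clinearD(3)[OF \<phi>])
    qed
    from has_derivative_zero_constant[OF convex_open_pentagon this]
    obtain c where "\<And>v. v \<in> open_pentagon \<Longrightarrow> \<phi> (component (D v) n) = c" by auto
    with w w0 show "\<phi> (component (D w) n) = \<phi> (component (D w0) n)" by simp
  qed simp_all
  then show ?thesis using that by blast
qed

section \<open>Exponentials and series over words\<close>

lemma component_exp_compl: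
  assumes "degree_one x"
  shows "component (exp_compl (s *\<^sub>C of_deg1 x)) n = (s ^ n / fact n) *\<^sub>C uea_in x ^ n"
proof -
  have power: "(s *\<^sub>C y) ^ k = (s ^ k) *\<^sub>C y ^ k" for y :: kz_compl and k
    by (induction k) simp_all
  have "component (exp_compl (s *\<^sub>C of_deg1 x)) n
      = (\<Sum>k\<in>{n}. component ((1 / fact k) *\<^sub>C (s *\<^sub>C of_deg1 x) ^ k) n)"
    unfolding exp_compl_def
    by (rule component_formal_sum) (simp_all add: power component_of_deg1_power[OF assms])
  then show ?thesis by (simp add: power component_of_deg1_power[OF assms])
qed

lemma component_pow_compl:
  assumes "degree_one x"
  shows "component (pow_compl t (of_deg1 x)) n = (Ln t ^ n / fact n) *\<^sub>C uea_in x ^ n"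
  unfolding pow_compl_def by (rule component_exp_compl[OF assms])

lemma pow_compl_commute:
  assumes "degree_one x" "of_deg1 x * y = y * of_deg1 x"
  shows "pow_compl t (of_deg1 x) * y = y * pow_compl t (of_deg1 x)"
proof -
  have step: "uea_in x * component y n = component y n * uea_in x" for n
    using arg_cong[OF assms(2), of "\<lambda>z. component z (Suc n)"] by (simp add: component_of_deg1_mult[OF assms(1)])
  have power: "uea_in x ^ k * component y n = component y n * uea_in x ^ k" for k n
    by (induction k) (simp_all add: mult.assoc step, simp add: mult.assoc[symmetric] step)
  show ?thesis
  proof (rule kz_compl_eqI)
    fix n
    have "component (pow_compl t (of_deg1 x) * y) n
        = (\<Sum>i=0..n. (Ln t ^ i / fact i) *\<^sub>C (component y (n - i) * uea_in x ^ i))"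
      by (simp add: component_mult component_pow_compl[OF assms(1)] power)
    also have "\<dots> = (\<Sum>i=0..n. (Ln t ^ (n - i) / fact (n - i)) *\<^sub>C (component y i * uea_in x ^ (n - i)))"
      by (subst sum.atLeastAtMost_rev) (auto intro!: sum.cong)
    also have "\<dots> = component (y * pow_compl t (of_deg1 x)) n"
      by (simp add: component_mult component_pow_compl[OF assms(1)])
    finally show "component (pow_compl t (of_deg1 x) * y) n = component (y * pow_compl t (of_deg1 x)) n" .
  qed
qed

lemma has_differential_pow_compl:
  assumes x: "degree_one x" and g: "(g has_derivative g') (at w)" and w: "g w \<notin> \<real>\<^sub>\<le>\<^sub>0"
  shows "has_differential (\<lambda>v. pow_compl (g v) (of_deg1 x))
     (\<lambda>h. (g' h / g w) *\<^sub>C (of_deg1 x * pow_compl (g w) (of_deg1 x))) w"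
  unfolding has_differential_def
proof (intro allI impI)
  fix n \<phi> assume \<phi>: "clinear \<phi>"
  show "((\<lambda>v. \<phi> (component (pow_compl (g v) (of_deg1 x)) n)) has_derivative
      (\<lambda>h. \<phi> (component ((g' h / g w) *\<^sub>C (of_deg1 x * pow_compl (g w) (of_deg1 x))) n))) (at w)"
  proof (cases n)
    case 0
    then show ?thesis
      by (simp add: component_pow_compl[OF x] component_of_deg1[OF x] clinearD[OF \<phi>])
  next
    case (Suc m)
    have "((\<lambda>t. Ln t ^ Suc m / fact (Suc m)) has_field_derivative Ln (g w) ^ m / fact m / g w) (at (g w))"
      using DERIV_cdivide[OF DERIV_power[OF has_field_derivative_Ln[OF w], of "Suc m"], of "fact (Suc m)"] w
      by (simp add: field_simps del: of_nat_Suc)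
    from diff_chain_at[OF g has_field_derivative_imp_has_derivative[OF this]]
    have "((\<lambda>v. Ln (g v) ^ Suc m / fact (Suc m)) has_derivative (\<lambda>h. Ln (g w) ^ m / fact m / g w * g' h)) (at w)"
      by (simp add: o_def)
    from has_derivative_mult_left[OF this, of "\<phi> (uea_in x ^ Suc m)"]
    show ?thesis
      unfolding Suc component_pow_compl[OF x] component_of_deg1_mult[OF x] component_scaleC clinearD[OF \<phi>]
      by (simp add: clinearD[OF \<phi>] mult_ac)
  qed
qed

lemma kz_tendsto_pow_compl:
  assumes x: "degree_one x" and "(t \<longlongrightarrow> t0) F" "t0 \<notin> \<real>\<^sub>\<le>\<^sub>0"
  shows "kz_tendsto (\<lambda>v. pow_compl (t v) (of_deg1 x)) (pow_compl t0 (of_deg1 x)) F"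
proof -
  have "((\<lambda>v. Ln (t v) ^ n / fact n * c) \<longlongrightarrow> Ln t0 ^ n / fact n * c) F" for n c
    using assms by (intro tendsto_intros) auto
  then show ?thesis
    by (auto simp: kz_tendsto_def coordinate_functionals_def component_pow_compl[OF x] clinearD)
qed

definition word_series :: "kz_lie \<Rightarrow> kz_lie \<Rightarrow> (letter list \<Rightarrow> complex) \<Rightarrow> kz_compl" where
  "word_series x y f = formal_sum (\<lambda>w. f w *\<^sub>C prod_list (map (letter_val (of_deg1 x) (of_deg1 y)) w))"

definition uea_word :: "kz_lie \<Rightarrow> kz_lie \<Rightarrow> letter list \<Rightarrow> kz_lie uea" where
  "uea_word x y w = prod_list (map (case_letter (uea_in x) (uea_in y)) w)"

lemma uea_word_simps [simp]: "uea_word x y [] = 1"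
  "uea_word x y (xi0 # w) = uea_in x * uea_word x y w" "uea_word x y (xi1 # w) = uea_in y * uea_word x y w"
  "uea_word x y (v @ w) = uea_word x y v * uea_word x y w"
  by (simp_all add: uea_word_def)

abbreviation words_of_length :: "nat \<Rightarrow> letter list set" where
  "words_of_length n \<equiv> {w. length w = n}"

lemma finite_words_of_length [simp]: "finite (words_of_length n)"
proof -
  have "(UNIV :: letter set) = {xi0, xi1}" by (auto intro: letter.exhaust)
  then have "finite (UNIV :: letter set)" by (metis finite.emptyI finite_insert)
  from finite_lists_length_eq[OF this, of n] show ?thesis by simp
qed

context
  fixes x y :: kz_lie
  assumes x: "degree_one x" and y: "degree_one y"
begin

lemma component_word:
  "component (prod_list (map (letter_val (of_deg1 x) (of_deg1 y)) w)) n =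
     (if n = length w then uea_word x y w else 0)"
proof (induction w arbitrary: n)
  case (Cons a w)
  show ?case
    by (cases n; cases a) (simp_all add: component_of_deg1_mult[OF x] component_of_deg1_mult[OF y]
        component_of_deg1[OF x] component_of_deg1[OF y] Cons)
qed (simp add: component_one)

lemma component_word_series:
  "component (word_series x y f) n = (\<Sum>w\<in>words_of_length n. f w *\<^sub>C uea_word x y w)"
  unfolding word_series_def
  by (subst component_formal_sum[of "words_of_length n"]) (auto simp: component_word intro!: sum.cong)

lemma word_series_mult: "word_series x y f * word_series x y g = word_series x y (conv f g)"
proof (rule kz_compl_eqI)
  fix n
  have split: "(\<Sum>a\<in>words_of_length i. \<Sum>b\<in>words_of_length (n - i). h a b (a @ b)) =
      (\<Sum>w\<in>words_of_length n. h (take i w) (drop i w) w)"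
    if "i \<le> n" for i and h :: "letter list \<Rightarrow> letter list \<Rightarrow> letter list \<Rightarrow> kz_lie uea"
  proof -
    have "(\<Sum>a\<in>words_of_length i. \<Sum>b\<in>words_of_length (n - i). h a b (a @ b))
        = (\<Sum>(a, b)\<in>words_of_length i \<times> words_of_length (n - i). h a b (a @ b))"
      by (rule sum.cartesian_product)
    also have "\<dots> = (\<Sum>w\<in>words_of_length n. h (take i w) (drop i w) w)"
      using that by (intro sum.reindex_bij_witness[of _ "\<lambda>w. (take i w, drop i w)" "\<lambda>(a, b). a @ b"]) auto
    finally show ?thesis .
  qed
  have "component (word_series x y f * word_series x y g) n =
     (\<Sum>i=0..n. \<Sum>a\<in>words_of_length i. \<Sum>b\<in>words_of_length (n - i).
        (f a * g b) *\<^sub>C uea_word x y (a @ b))"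
    by (simp add: component_mult component_word_series sum_product mult.commute[of "g _"])
  also have "\<dots> = (\<Sum>i=0..n. \<Sum>w\<in>words_of_length n. (f (take i w) * g (drop i w)) *\<^sub>C uea_word x y w)"
  proof (rule sum.cong[OF refl])
    fix i assume "i \<in> {0..n}"
    then show "(\<Sum>a\<in>words_of_length i. \<Sum>b\<in>words_of_length (n - i). (f a * g b) *\<^sub>C uea_word x y (a @ b))
        = (\<Sum>w\<in>words_of_length n. (f (take i w) * g (drop i w)) *\<^sub>C uea_word x y w)"
      using split[of i "\<lambda>a b w. (f a * g b) *\<^sub>C uea_word x y w"] by simp
  qed
  also have "\<dots> = (\<Sum>w\<in>words_of_length n. \<Sum>i=0..n. (f (take i w) * g (drop i w)) *\<^sub>C uea_word x y w)"
    by (rule sum.swap)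
  also have "\<dots> = component (word_series x y (conv f g)) n"
    unfolding component_word_series
    by (intro sum.cong refl) (simp add: conv_def complex_vector.scale_sum_left atMost_atLeast0)
  finally show "component (word_series x y f * word_series x y g) n = component (word_series x y (conv f g)) n" .
qed

lemma word_series_power_word:
  "word_series x y (power_word xi0 s) = exp_compl (s *\<^sub>C of_deg1 x)"
  "word_series x y (power_word xi1 s) = exp_compl (s *\<^sub>C of_deg1 y)"
proof -
  have *: "(\<Sum>w\<in>words_of_length n. power_word a s w *\<^sub>C uea_word x y w)
      = (s ^ n / fact n) *\<^sub>C uea_word x y (replicate n a)" for n a
  proof -
    have "(\<Sum>w\<in>words_of_length n. power_word a s w *\<^sub>C uea_word x y w)
        = (\<Sum>w\<in>words_of_length n. if w = replicate n a then (s ^ n / fact n) *\<^sub>C uea_word x y (replicate n a) else 0)"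
    proof (intro sum.cong refl)
      fix w assume w: "w \<in> words_of_length n"
      have "w = replicate n a" if "set w \<subseteq> {a}" using w that by (intro replicate_eqI) auto
      then show "power_word a s w *\<^sub>C uea_word x y w
          = (if w = replicate n a then (s ^ n / fact n) *\<^sub>C uea_word x y (replicate n a) else 0)"
        by (cases "set w \<subseteq> {a}") (auto simp: power_word_def)
    qed
    then show ?thesis by simp
  qed
  have pow: "uea_word x y (replicate n xi0) = uea_in x ^ n" "uea_word x y (replicate n xi1) = uea_in y ^ n" for n
    by (induction n) simp_all
  show "word_series x y (power_word xi0 s) = exp_compl (s *\<^sub>C of_deg1 x)"
    by (rule kz_compl_eqI) (simp add: component_word_series * component_exp_compl[OF x] pow)
  show "word_series x y (power_word xi1 s) = exp_compl (s *\<^sub>C of_deg1 y)"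
    by (rule kz_compl_eqI) (simp add: component_word_series * component_exp_compl[OF y] pow)
qed

lemma kz_tendsto_word_series:
  assumes "\<And>w. ((\<lambda>a. f a w) \<longlongrightarrow> g w) F"
  shows "kz_tendsto (\<lambda>a. word_series x y (f a)) (word_series x y g) F"
  unfolding kz_tendsto_def coordinate_functionals_def
  by (auto simp: component_word_series clinearD intro!: tendsto_intros assms)

end

lemma exp_compl_inverse:
  assumes x: "degree_one x"
  shows "exp_compl (s *\<^sub>C of_deg1 x) * exp_compl ((- s) *\<^sub>C of_deg1 x) = 1"
proof (rule kz_compl_eqI)
  fix n
  have "component (exp_compl (s *\<^sub>C of_deg1 x) * exp_compl ((- s) *\<^sub>C of_deg1 x)) n
      = (\<Sum>i=0..n. (s ^ i / fact i * ((- s) ^ (n - i) / fact (n - i))) *\<^sub>C uea_in x ^ n)"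
    unfolding component_mult component_exp_compl[OF x]
    by (intro sum.cong refl) (simp add: power_add[symmetric] mult.commute)
  also have "\<dots> = (\<Sum>i=0..n. (s ^ i / fact i * ((- s) ^ (n - i) / fact (n - i)))) *\<^sub>C uea_in x ^ n"
    by (simp add: complex_vector.scale_sum_left)
  also have "(\<Sum>i=0..n. (s ^ i / fact i * ((- s) ^ (n - i) / fact (n - i)))) = (s + (- s)) ^ n / fact n"
    unfolding binomial_ring by (simp add: sum_divide_distrib atMost_atLeast0 binomial_fact field_simps)
  finally show "component (exp_compl (s *\<^sub>C of_deg1 x) * exp_compl ((- s) *\<^sub>C of_deg1 x)) n = component 1 n"
    by (simp add: component_one power_0_left)
qed

section \<open>Relations in the Lie algebra\<close>

lemma Omega_symmetric: "Omega i j = Omega j i"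
  by transfer (rule omega_symmetric)

lemma Omega_diagonal [simp]: "Omega i i = 0"
  by transfer (rule omega_diagonal)

lemma Omega_commute: "{i, j} \<inter> {k, l} = {} \<Longrightarrow> bracket (Omega i j) (Omega k l) = 0"
  by transfer (rule omega_commute)

lemma bracket_simps [simp]:
  fixes x y z :: "'a::complex_lie_algebra"
  shows "bracket 0 y = 0" "bracket x 0 = 0" "bracket (- x) y = - bracket x y"
    "bracket x (- y) = - bracket x y" "bracket (x - y) z = bracket x z - bracket y z"
    "bracket x (y - z) = bracket x y - bracket x z"
proof -
  show l0: "bracket 0 y = 0" for y :: 'a using bracket_add_left[of 0 0 y] by simp
  show r0: "bracket x 0 = 0" for x :: 'a using bracket_add_right[of x 0 0] by simp
  show "bracket (- x) y = - bracket x y"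
    using bracket_add_left[of x "- x" y] l0 by (simp add: eq_neg_iff_add_eq_0 add.commute)
  show "bracket x (- y) = - bracket x y"
    using bracket_add_right[of x y "- y"] r0 by (simp add: eq_neg_iff_add_eq_0 add.commute)
  show "bracket (x - y) z = bracket x z - bracket y z"
    using bracket_add_left[of "x - y" y z] by simp
  show "bracket x (y - z) = bracket x y - bracket x z"
    using bracket_add_right[of x "y - z" z] by simp
qed

lemma Omega_row:
  "Omega 1 5 = - (Omega 1 2 + Omega 1 3 + Omega 1 4)"
  "Omega 2 5 = - (Omega 1 2 + Omega 2 3 + Omega 2 4)"
  "Omega 3 5 = - (Omega 1 3 + Omega 2 3 + Omega 3 4)"
  "Omega 4 5 = - (Omega 1 4 + Omega 2 4 + Omega 3 4)"
  "Omega 1 5 + Omega 2 5 + Omega 3 5 + Omega 4 5 = 0"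
  using Omega_row_sum[of 1] Omega_row_sum[of 2] Omega_row_sum[of 3] Omega_row_sum[of 4] Omega_row_sum[of 5]
    Omega_symmetric[of 2 1] Omega_symmetric[of 3 1] Omega_symmetric[of 3 2]
    Omega_symmetric[of 4 1] Omega_symmetric[of 4 2] Omega_symmetric[of 4 3]
    Omega_symmetric[of 5 1] Omega_symmetric[of 5 2] Omega_symmetric[of 5 3] Omega_symmetric[of 5 4]
    Omega_diagonal[of 1] Omega_diagonal[of 2] Omega_diagonal[of 3] Omega_diagonal[of 4] Omega_diagonal[of 5]
  by (simp_all only: add_0_left add_0_right eq_neg_iff_add_eq_0 add.assoc)
    (simp_all only: ac_simps)

text \<open>
  The five row sums only give twice this identity.
\<close>

lemma Omega_triangle: "Omega 1 2 + Omega 1 3 + Omega 2 3 = Omega 4 5"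
proof -
  let ?D = "Omega 1 2 + Omega 1 3 + Omega 2 3 - Omega 4 5"
  have "?D + ?D = - (Omega 1 5 + Omega 2 5 + Omega 3 5 + Omega 4 5)
      - (Omega 4 5 + Omega 1 4 + Omega 2 4 + Omega 3 4)"
    unfolding Omega_row(1-3) by (simp add: algebra_simps)
  also have "\<dots> = 0"
    unfolding Omega_row(5) unfolding Omega_row(4) by (simp add: algebra_simps)
  finally have "(1/2 + 1/2) *\<^sub>C ?D = 0"
    unfolding scaleC_add_left scaleC_add_right[symmetric] by (simp only: complex_vector.scale_zero_right)
  then show ?thesis by simp
qed

abbreviation sigma_iter :: "nat \<Rightarrow> kz_lie \<Rightarrow> kz_lie" where
  "sigma_iter \<alpha> \<equiv> sigma_aut ^^ \<alpha>"

lemma sigma_iter_hom: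
  "sigma_iter \<alpha> (x + y) = sigma_iter \<alpha> x + sigma_iter \<alpha> y"
  "sigma_iter \<alpha> (bracket x y) = bracket (sigma_iter \<alpha> x) (sigma_iter \<alpha> y)"
  "sigma_iter \<alpha> 0 = 0" "sigma_iter \<alpha> (- x) = - sigma_iter \<alpha> x"
  "sigma_iter \<alpha> (x - y) = sigma_iter \<alpha> x - sigma_iter \<alpha> y"
proof -
  show add: "sigma_iter \<alpha> (x + y) = sigma_iter \<alpha> x + sigma_iter \<alpha> y" for x y
    by (induction \<alpha>) (simp_all add: sigma_aut_hom)
  show "sigma_iter \<alpha> (bracket x y) = bracket (sigma_iter \<alpha> x) (sigma_iter \<alpha> y)"
    by (induction \<alpha>) (simp_all add: sigma_aut_hom)
  show zero: "sigma_iter \<alpha> 0 = 0" using add[of 0 0] by simp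
  show uminus: "sigma_iter \<alpha> (- x) = - sigma_iter \<alpha> x" for x
    using add[of x "- x"] zero by (simp add: eq_neg_iff_add_eq_0 add.commute)
  show "sigma_iter \<alpha> (x - y) = sigma_iter \<alpha> x - sigma_iter \<alpha> y"
    using add[of x "- y"] uminus by simp
qed

lemma sigma_iter_Suc: "sigma_iter (Suc \<alpha>) x = sigma_iter \<alpha> (sigma_aut x)"
  by (simp add: funpow_swap1)

lemma sigma_iter_Omega: "\<exists>k l. sigma_iter \<alpha> (Omega i j) = Omega k l"
  by (induction \<alpha>) (auto, blast)

lemma X1_eq: "X1 \<alpha> = sigma_iter \<alpha> (Omega 4 5)"
  by (simp only: X1_def Omega_triangle)

lemmas X_defs = X1_eq X2_def X11_def X22_def X12_def

text \<open>
  The integrability of the form. Every relation comes from the row sums, which rewrite a sum of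
  generators as one of generators whose indices are disjoint from the given pair; for example
  \<open>\<Omega>\<^sub>1\<^sub>2 + \<Omega>\<^sub>2\<^sub>4 = - (\<Omega>\<^sub>2\<^sub>3 + \<Omega>\<^sub>2\<^sub>5)\<close> commutes with \<open>\<Omega>\<^sub>1\<^sub>4\<close>.
\<close>

lemma X_relations:
  "bracket (X1 \<alpha>) (X2 \<alpha>) = 0"
  "bracket (X1 \<alpha>) (X22 \<alpha>) = 0"
  "bracket (X11 \<alpha>) (X2 \<alpha>) = 0"
  "bracket (X11 \<alpha>) (X22 \<alpha> + X12 \<alpha>) = 0"
  "bracket (X11 \<alpha> + X12 \<alpha>) (X22 \<alpha>) = 0"
  "bracket (X1 \<alpha> - X2 \<alpha>) (X12 \<alpha>) + bracket (X11 \<alpha>) (X22 \<alpha>) = 0"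
proof -
  have o: "bracket (Omega 4 5) (Omega 2 3) = 0" "bracket (Omega 4 5) (Omega 1 2) = 0"
    "bracket (Omega 1 4) (Omega 2 3) = 0" "bracket (Omega 1 4) (Omega 2 5) = 0"
    "bracket (Omega 3 4) (Omega 1 2) = 0" "bracket (Omega 1 3) (Omega 2 4) = 0"
    "bracket (Omega 3 5) (Omega 2 4) = 0"
    by (rule Omega_commute; simp)+
  have row2: "- Omega 1 2 + - Omega 2 4 = Omega 2 3 + Omega 2 5"
    using Omega_row(2) by (simp add: algebra_simps)
  have row4: "- Omega 1 4 + - Omega 2 4 = Omega 3 4 + Omega 4 5"
    using Omega_row(4) by (simp add: algebra_simps)
  have 4: "bracket (- Omega 1 4) (- Omega 1 2 + - Omega 2 4) = 0"
    unfolding row2 by (simp add: bracket_add_right o)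
  have 5: "bracket (- Omega 1 4 + - Omega 2 4) (- Omega 1 2) = 0"
    unfolding row4 by (simp add: bracket_add_left o)
  have 6: "bracket (Omega 4 5 - Omega 2 3) (- Omega 2 4) + bracket (- Omega 1 4) (- Omega 1 2) = 0"
  proof -
    have "Omega 4 5 - Omega 2 3 = Omega 1 3 + Omega 3 5 - Omega 1 4 - Omega 2 4"
      unfolding Omega_row(3,4) by (simp add: algebra_simps)
    then show ?thesis
      using 4 by (simp only:) (simp add: bracket_add_left bracket_add_right o bracket_self add.commute)
  qed
  show "bracket (X1 \<alpha>) (X2 \<alpha>) = 0" "bracket (X1 \<alpha>) (X22 \<alpha>) = 0" "bracket (X11 \<alpha>) (X2 \<alpha>) = 0"
    "bracket (X11 \<alpha>) (X22 \<alpha> + X12 \<alpha>) = 0" "bracket (X11 \<alpha> + X12 \<alpha>) (X22 \<alpha>) = 0"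
    "bracket (X1 \<alpha> - X2 \<alpha>) (X12 \<alpha>) + bracket (X11 \<alpha>) (X22 \<alpha>) = 0"
    unfolding X_defs sigma_iter_hom(1,2,5)[symmetric]
    using arg_cong[OF 4, of "sigma_iter \<alpha>"] arg_cong[OF 5, of "sigma_iter \<alpha>"] arg_cong[OF 6, of "sigma_iter \<alpha>"]
    by (simp_all add: o sigma_iter_hom(3))
qed

text \<open>
  The residues of the next form, expressed by those of the given one. They express that both are the
  same form in two coordinate systems.
\<close>

lemma X_successor:
  "X1 (Suc \<alpha>) = X2 \<alpha>" "X2 (Suc \<alpha>) = - X11 \<alpha>" "X22 (Suc \<alpha>) = - X1 \<alpha>"
  "X11 (Suc \<alpha>) + X22 (Suc \<alpha>) + X12 (Suc \<alpha>) = X22 \<alpha>"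
  "X2 (Suc \<alpha>) - X22 (Suc \<alpha>) - X12 (Suc \<alpha>) = X12 \<alpha>"
proof -
  have uminus: "sigma_aut (- x) = - sigma_aut x" for x
    using sigma_iter_hom(4)[of 1 x] by simp
  have perm: "index_perm 1 = 5" "index_perm 2 = 4" "index_perm 3 = 1" "index_perm 4 = 3" "index_perm 5 = 2"
    by (simp_all add: index_perm_def)
  note simps = X_defs sigma_iter_Suc sigma_aut_Omega uminus perm
    Omega_symmetric[of 3 2] Omega_symmetric[of 4 1] Omega_symmetric[of 5 4] Omega_symmetric[of 5 3] Omega_symmetric[of 4 3]
  show "X1 (Suc \<alpha>) = X2 \<alpha>" "X2 (Suc \<alpha>) = - X11 \<alpha>" "X22 (Suc \<alpha>) = - X1 \<alpha>"
    unfolding simps by (simp_all only: sigma_iter_hom minus_minus)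
  have "Omega 3 5 + Omega 3 4 + Omega 5 4 = Omega 2 1"
    using arg_cong[OF Omega_triangle, of "sigma_iter 4"]
    by (simp add: sigma_iter_hom(1) eval_nat_numeral sigma_aut_hom perm del: numeral_eq_Suc)
  then have "- Omega 3 5 + - Omega 4 5 + - Omega 3 4 = - Omega 1 2"
    by (simp add: Omega_symmetric[of 5 4] Omega_symmetric[of 2 1] algebra_simps)
  then show "X11 (Suc \<alpha>) + X22 (Suc \<alpha>) + X12 (Suc \<alpha>) = X22 \<alpha>"
    unfolding simps by (simp only: sigma_iter_hom(1)[symmetric])
  have "Omega 1 4 - - Omega 4 5 - - Omega 3 4 = - Omega 2 4"
    unfolding Omega_row(4) by (simp add: algebra_simps)
  then show "X2 (Suc \<alpha>) - X22 (Suc \<alpha>) - X12 (Suc \<alpha>) = X12 \<alpha>"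
    unfolding simps by (simp only: sigma_iter_hom(5)[symmetric])
qed

lemma X_period: "X1 5 = X1 0" "X2 5 = X2 0" "X11 5 = X11 0" "X22 5 = X22 0" "X12 5 = X12 0"
proof -
  have perm: "index_perm 1 = 5" "index_perm 2 = 4" "index_perm 3 = 1" "index_perm 4 = 3" "index_perm 5 = 2"
    by (simp_all add: index_perm_def)
  have "sigma_iter 5 (Omega i j) = Omega i j" for i j
    by (cases i rule: index5_cases; cases j rule: index5_cases)
      (simp_all only: eval_nat_numeral BitM.simps funpow.simps o_def id_def sigma_aut_Omega perm)
  then show "X1 5 = X1 0" "X2 5 = X2 0" "X11 5 = X11 0" "X22 5 = X22 0" "X12 5 = X12 0"
    unfolding X_defs by (simp_all add: sigma_iter_hom(4))
qed

section \<open>Elements of degree one\<close>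

lemma uea_in_simps [simp]:
  fixes x y :: "'l::complex_lie_algebra"
  shows "uea_in (x + y) = uea_in x + uea_in y" "uea_in (c *\<^sub>C x) = c *\<^sub>C uea_in x"
  "uea_in (bracket x y) = uea_in x * uea_in y - uea_in y * uea_in x"
  "uea_in (0 :: 'l) = 0" "uea_in (- x) = - uea_in x" "uea_in (x - y) = uea_in x - uea_in y"
proof -
  show add: "uea_in (x + y) = uea_in x + uea_in y" for x y :: 'l
    by transfer (rule uin_add)
  show "uea_in (c *\<^sub>C x) = c *\<^sub>C uea_in x" by transfer (rule uin_scale)
  show "uea_in (bracket x y) = uea_in x * uea_in y - uea_in y * uea_in x"
    by transfer (rule uin_bracket)
  show zero: "uea_in (0 :: 'l) = 0" using add[of 0 0] by simp
  show uminus: "uea_in (- x) = - uea_in x" for x :: 'l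
    using add[of x "- x"] zero by (simp add: eq_neg_iff_add_eq_0 add.commute)
  show "uea_in (x - y) = uea_in x - uea_in y"
    using add[of x "- y"] uminus by simp
qed

lemma degree_one_Omega: "degree_one (Omega i j)"
  unfolding degree_one_def uea_deg_def by (intro complex_vector.span_base CollectI exI[of _ "[uea_in (Omega i j)]"]) auto

lemma degree_one_uminus: "degree_one x \<Longrightarrow> degree_one (- x)"
  using complex_vector.subspace_neg[OF subspace_uea_deg] by (simp add: degree_one_def)

lemma degree_one_X [simp]:
  "degree_one (X1 \<alpha>)" "degree_one (X2 \<alpha>)" "degree_one (X11 \<alpha>)" "degree_one (X22 \<alpha>)" "degree_one (X12 \<alpha>)"
proof -
  have "degree_one (sigma_iter \<alpha> (Omega i j))" for i j
    using sigma_iter_Omega[of \<alpha> i j] degree_one_Omega by auto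
  then show "degree_one (X1 \<alpha>)" "degree_one (X2 \<alpha>)" "degree_one (X11 \<alpha>)" "degree_one (X22 \<alpha>)"
    "degree_one (X12 \<alpha>)"
    unfolding X_defs sigma_iter_hom(4) by (auto intro!: degree_one_uminus)
qed

lemma of_deg1_add:
  assumes "degree_one x" "degree_one y"
  shows "of_deg1 (x + y) = of_deg1 x + of_deg1 y"
proof -
  have "degree_one (x + y)" using assms complex_vector.subspace_add[OF subspace_uea_deg] by (simp add: degree_one_def)
  then show ?thesis by (intro kz_compl_eqI) (simp add: component_of_deg1 assms)
qed

lemma of_deg1_uminus: "degree_one x \<Longrightarrow> of_deg1 (- x) = - of_deg1 x"
  by (rule kz_compl_eqI) (simp add: component_of_deg1 degree_one_uminus)

lemma of_deg1_commute:
  assumes "degree_one x" "degree_one y" "bracket x y = 0"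
  shows "of_deg1 x * of_deg1 y = of_deg1 y * of_deg1 x"
proof (rule kz_compl_eqI)
  have "uea_in x * uea_in y = uea_in y * uea_in x"
    using arg_cong[OF assms(3), of uea_in] by simp
  then show "component (of_deg1 x * of_deg1 y) n = component (of_deg1 y * of_deg1 x) n" for n
    by (cases n) (simp_all add: component_of_deg1_mult assms component_of_deg1)
qed

section \<open>Formal power series in two variables\<close>

text \<open>
  A double sequence \<open>f\<close> stands for the formal power series \<open>\<Sum> f m k z\<^sub>1\<^sup>m z\<^sub>2\<^sup>k\<close>. The following three operators
  are the multiplications by \<open>a = z\<^sub>1 / (1 - z\<^sub>1)\<close>, \<open>b = z\<^sub>2 / (1 - z\<^sub>2)\<close> and
  \<open>c = z\<^sub>1 z\<^sub>2 / (1 - z\<^sub>1 z\<^sub>2)\<close>.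
\<close>

definition sum_left :: "(nat \<Rightarrow> nat \<Rightarrow> 'r::comm_monoid_add) \<Rightarrow> nat \<Rightarrow> nat \<Rightarrow> 'r" where
  "sum_left f m k = (\<Sum>l<m. f l k)"

definition sum_right :: "(nat \<Rightarrow> nat \<Rightarrow> 'r::comm_monoid_add) \<Rightarrow> nat \<Rightarrow> nat \<Rightarrow> 'r" where
  "sum_right f m k = (\<Sum>l<k. f m l)"

primrec sum_diag :: "(nat \<Rightarrow> nat \<Rightarrow> 'r::comm_monoid_add) \<Rightarrow> nat \<Rightarrow> nat \<Rightarrow> 'r" where
  "sum_diag f 0 k = 0"
| "sum_diag f (Suc m) k = (case k of 0 \<Rightarrow> 0 | Suc k' \<Rightarrow> f m k' + sum_diag f m k')"

lemma sum_left_simps [simp]: "sum_left f 0 k = 0" "sum_left f (Suc m) k = f m k + sum_left f m k"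
  by (simp_all add: sum_left_def add.commute)

lemma sum_right_simps [simp]: "sum_right f m 0 = 0" "sum_right f m (Suc k) = f m k + sum_right f m k"
  by (simp_all add: sum_right_def add.commute)

lemma sum_diag_0 [simp]: "sum_diag f m 0 = 0"
  by (cases m) simp_all

lemma double_sum_additive:
  assumes "\<And>x y. h (x + y) = h x + h y" "h 0 = 0"
  shows "sum_left (\<lambda>m k. h (f m k)) m k = h (sum_left f m k)"
    "sum_right (\<lambda>m k. h (f m k)) m k = h (sum_right f m k)"
    "sum_diag (\<lambda>m k. h (f m k)) m k = h (sum_diag f m k)"
proof -
  show "sum_left (\<lambda>m k. h (f m k)) m k = h (sum_left f m k)"
    by (induction m) (simp_all add: assms)
  show "sum_right (\<lambda>m k. h (f m k)) m k = h (sum_right f m k)"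
    by (induction k) (simp_all add: assms)
  show "sum_diag (\<lambda>m k. h (f m k)) m k = h (sum_diag f m k)"
    by (induction m arbitrary: k) (simp_all add: assms split: nat.split)
qed

lemma double_sum_add:
  "sum_left (\<lambda>m k. f m k + g m k) m k = sum_left f m k + sum_left g m k"
  "sum_right (\<lambda>m k. f m k + g m k) m k = sum_right f m k + sum_right g m k"
  "sum_diag (\<lambda>m k. f m k + g m k) m k = sum_diag f m k + sum_diag g m k"
proof -
  show "sum_diag (\<lambda>m k. f m k + g m k) m k = sum_diag f m k + sum_diag g m k"
    by (induction m arbitrary: k) (simp_all add: ac_simps split: nat.split)
qed (simp_all add: sum_left_def sum_right_def sum.distrib)

lemma double_sum_diff:
  fixes f g :: "nat \<Rightarrow> nat \<Rightarrow> 'r::ab_group_add"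
  shows "sum_left (\<lambda>m k. f m k - g m k) m k = sum_left f m k - sum_left g m k"
  "sum_right (\<lambda>m k. f m k - g m k) m k = sum_right f m k - sum_right g m k"
  "sum_diag (\<lambda>m k. f m k - g m k) m k = sum_diag f m k - sum_diag g m k"
proof -
  show "sum_diag (\<lambda>m k. f m k - g m k) m k = sum_diag f m k - sum_diag g m k"
    by (induction m arbitrary: k) (simp_all add: algebra_simps split: nat.split)
qed (simp_all add: sum_left_def sum_right_def sum_subtractf)

lemma double_sum_mult:
  fixes f :: "nat \<Rightarrow> nat \<Rightarrow> 'r::ring"
  shows "sum_left (\<lambda>m k. a * f m k) m k = a * sum_left f m k"
    "sum_right (\<lambda>m k. a * f m k) m k = a * sum_right f m k"
    "sum_diag (\<lambda>m k. a * f m k) m k = a * sum_diag f m k"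
    "sum_left (\<lambda>m k. f m k * a) m k = sum_left f m k * a"
    "sum_right (\<lambda>m k. f m k * a) m k = sum_right f m k * a"
    "sum_diag (\<lambda>m k. f m k * a) m k = sum_diag f m k * a"
  by (rule double_sum_additive; simp add: distrib_left distrib_right)+

lemma double_sum_transpose:
  "sum_left (\<lambda>m k. f k m) m k = sum_right f k m" "sum_diag (\<lambda>m k. f k m) m k = sum_diag f k m"
proof -
  show "sum_diag (\<lambda>m k. f k m) m k = sum_diag f k m"
    by (induction m arbitrary: k) (simp_all split: nat.split)
qed (simp add: sum_left_def sum_right_def)

lemma double_sum_commute:
  "sum_right (sum_left f) m k = sum_left (sum_right f) m k"
  "sum_diag (sum_left f) m k = sum_left (sum_diag f) m k"
  "sum_diag (sum_right f) m k = sum_right (sum_diag f) m k"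
proof -
  show "sum_right (sum_left f) m k = sum_left (sum_right f) m k"
    unfolding sum_right_def sum_left_def by (rule sum.swap)
  show diag_left: "sum_diag (sum_left f) m k = sum_left (sum_diag f) m k" for f :: "nat \<Rightarrow> nat \<Rightarrow> 'a" and m k
  proof (induction m arbitrary: k)
    case (Suc m)
    show ?case
    proof (cases k)
      case (Suc k')
      have "sum_left (sum_diag f) (Suc m) (Suc k') = sum_left f m k' + sum_left (sum_diag f) m k'"
      proof (induction m)
        case (Suc m)
        have "sum_left (sum_diag f) (Suc (Suc m)) (Suc k')
            = sum_diag f (Suc m) (Suc k') + sum_left (sum_diag f) (Suc m) (Suc k')"
          by (rule sum_left_simps)
        also have "\<dots> = sum_diag f (Suc m) (Suc k') + (sum_left f m k' + sum_left (sum_diag f) m k')"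
          by (simp only: Suc)
        also have "\<dots> = sum_left f (Suc m) k' + sum_left (sum_diag f) (Suc m) k'"
          by (simp add: ac_simps)
        finally show ?case .
      qed simp
      with Suc Suc.IH show ?thesis by simp
    qed (simp add: sum_left_def)
  qed simp
  let ?g = "\<lambda>m k. f k m"
  have "sum_left ?g = (\<lambda>m k. sum_right f k m)" "sum_diag ?g = (\<lambda>m k. sum_diag f k m)"
    by (intro ext double_sum_transpose)+
  then show "sum_diag (sum_right f) m k = sum_right (sum_diag f) m k"
    using diag_left[of ?g k m] double_sum_transpose(2)[of "sum_right f" k m]
      double_sum_transpose(1)[of "sum_diag f" k m] by simp
qed

text \<open>
  The identity \<open>ab = c + ca + cb\<close>, which relates the logarithmic forms of the three divisors.
\<close>

lemma sum_left_sum_right: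
  "sum_left (sum_right f) m k = sum_diag f m k + sum_left (sum_diag f) m k + sum_right (sum_diag f) m k"
proof (induction m arbitrary: k)
  case 0
  show ?case by (simp add: sum_right_def)
next
  case (Suc m)
  show ?case
  proof (cases k)
    case 0
    then show ?thesis by (simp add: sum_left_def)
  next
    case k: (Suc k')
    have l: "sum_left (sum_diag f) (Suc m) (Suc k') = sum_left f m k' + sum_left (sum_diag f) m k'"
      by (simp only: double_sum_commute(2)[symmetric]) simp
    have r: "sum_right (sum_diag f) (Suc m) (Suc k') = sum_right f m k' + sum_right (sum_diag f) m k'"
      by (simp only: double_sum_commute(3)[symmetric]) simp
    have "sum_left (sum_right f) (Suc m) (Suc k') =
        f m k' + sum_right f m k' + (sum_left f m k' + sum_left (sum_right f) m k')"
      by (simp add: double_sum_commute(1)[symmetric])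
    then show ?thesis unfolding k l r Suc by (simp add: ac_simps)
  qed
qed

text \<open>
  The derivation \<open>z\<^sub>2 \<partial>/\<partial>z\<^sub>2 - z\<^sub>1 \<partial>/\<partial>z\<^sub>1\<close> annihilates the functions of \<open>z\<^sub>1 z\<^sub>2\<close>.
\<close>

lemma scale_sum_diag:
  fixes f :: "nat \<Rightarrow> nat \<Rightarrow> 'r::complex_vector"
  shows "(of_nat k - of_nat m) *\<^sub>C sum_diag f m k
    = sum_diag (\<lambda>m k. (of_nat k - of_nat m) *\<^sub>C f m k) m k"
proof (induction m arbitrary: k)
  case (Suc m)
  show ?case
  proof (cases k)
    case (Suc k')
    have "(of_nat (Suc k') - of_nat (Suc m) :: complex) = of_nat k' - of_nat m" by simp
    with Suc Suc.IH[of k'] show ?thesis by (simp only: sum_diag.simps nat.case scaleC_add_right)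
  qed simp
qed simp

lemma norm_double_sum_le:
  assumes "\<And>m k. norm (c m k :: complex) \<le> C"
  shows "norm (sum_left c m k) \<le> C * real m" "norm (sum_right c m k) \<le> C * real k"
    "norm (sum_diag c m k) \<le> C * real m"
proof -
  have "0 \<le> C" using assms[of 0 0] norm_ge_zero order_trans by blast
  show "norm (sum_left c m k) \<le> C * real m"
    using sum_norm_le[of "{..<m}" "\<lambda>l. c l k" "\<lambda>l. C"] assms by (simp add: sum_left_def mult.commute)
  show "norm (sum_right c m k) \<le> C * real k"
    using sum_norm_le[of "{..<k}" "\<lambda>l. c m l" "\<lambda>l. C"] assms by (simp add: sum_right_def mult.commute)
  show "norm (sum_diag c m k) \<le> C * real m"
  proof (induction m arbitrary: k)
    case (Suc m)
    show ?case
    proof (cases k)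
      case (Suc k')
      have "norm (sum_diag c (Suc m) k) \<le> norm (c m k') + norm (sum_diag c m k')"
        by (simp add: Suc norm_triangle_ineq)
      then show ?thesis using assms[of m k'] Suc.IH[of k'] by (simp add: algebra_simps)
    qed (use \<open>0 \<le> C\<close> in simp)
  qed simp
qed

text \<open>
  The regular part \<open>H\<close> satisfies \<open>z\<^sub>1 \<partial>H/\<partial>z\<^sub>1 = [x, H] + (s a + t c) H\<close>, where \<open>s\<close> is the function that
  belongs to \<open>S\<close> and \<open>t = z\<^sub>1 z\<^sub>2 / (1 - z\<^sub>1 z\<^sub>2)\<close>; the term \<open>- H x\<close> comes from the power \<open>z\<^sub>1\<^sup>x\<close> that
  follows \<open>H\<close> in the solution. The same form with exchanged variables holds for \<open>z\<^sub>2\<close>.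
\<close>

definition connection ::
    "'r::ring \<Rightarrow> 'r \<Rightarrow> 'r \<Rightarrow> ((nat \<Rightarrow> nat \<Rightarrow> 'r) \<Rightarrow> nat \<Rightarrow> nat \<Rightarrow> 'r) \<Rightarrow> (nat \<Rightarrow> nat \<Rightarrow> 'r) \<Rightarrow> nat \<Rightarrow> nat \<Rightarrow> 'r" where
  "connection x a c S f m k = x * f m k - f m k * x + a * S f m k + c * sum_diag f m k"

text \<open>
  The integrability condition in terms of coefficients: if \<open>f\<close> is obtained by integrating the form
  given by \<open>g\<close>, then the form given by \<open>f\<close> is closed. When the equations for \<open>f\<close> are inserted, the
  difference of the two sides becomes quadratic in the residues. After the product \<open>ab\<close> is replaced by
  \<open>c + ca + cb\<close>, the coefficients of \<open>1\<close>, \<open>a\<close>, \<open>b\<close>, \<open>c\<close>, \<open>ca\<close>, \<open>cb\<close> are the commutators in the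
  hypothesis.
\<close>

lemma connection_closed:
  fixes y1 y2 y11 y22 y12 :: "'r::complex_algebra_1"
  defines "d1 \<equiv> connection y1 y11 y12 sum_left" and "d2 \<equiv> connection y2 y22 y12 sum_right"
  assumes rel: "y1 * y2 - y2 * y1 = 0" "y1 * y22 - y22 * y1 = 0" "y11 * y2 - y2 * y11 = 0"
      "y11 * (y22 + y12) - (y22 + y12) * y11 = 0" "(y11 + y12) * y22 - y22 * (y11 + y12) = 0"
      "(y1 - y2) * y12 - y12 * (y1 - y2) + (y11 * y22 - y22 * y11) = 0"
    and f1: "\<And>m k. of_nat m *\<^sub>C f m k = d1 g m k" and f2: "\<And>m k. of_nat k *\<^sub>C f m k = d2 g m k"
  shows "of_nat k *\<^sub>C d1 f m k = of_nat m *\<^sub>C d2 f m k"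
proof -
  define G where "G = g m k"
  define A where "A = sum_left g m k"
  define B where "B = sum_right g m k"
  define D where "D = sum_diag g m k"
  define Q where "Q = sum_left (sum_diag g) m k"
  define R where "R = sum_right (sum_diag g) m k"
  define DD where "DD = sum_diag (sum_diag g) m k"
  have AB: "sum_left (sum_right g) m k = D + Q + R"
    by (simp add: D_def Q_def R_def sum_left_sum_right)
  have left: "sum_left (d2 g) m k = y2 * A - A * y2 + y22 * (D + Q + R) + y12 * Q"
    unfolding d2_def connection_def double_sum_add double_sum_diff double_sum_mult AB A_def Q_def ..
  have right: "sum_right (d1 g) m k = y1 * B - B * y1 + y11 * (D + Q + R) + y12 * R"
    unfolding d1_def connection_def double_sum_add double_sum_diff double_sum_mult
      double_sum_commute(1) AB B_def R_def ..
  have diag1: "sum_diag (d1 g) m k = y1 * D - D * y1 + y11 * Q + y12 * DD"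
    unfolding d1_def connection_def double_sum_add double_sum_diff double_sum_mult
      double_sum_commute(2) D_def Q_def DD_def ..
  have diag2: "sum_diag (d2 g) m k = y2 * D - D * y2 + y22 * R + y12 * DD"
    unfolding d2_def connection_def double_sum_add double_sum_diff double_sum_mult
      double_sum_commute(3) D_def R_def DD_def ..
  have scale: "c *\<^sub>C sum_left f m k = sum_left (\<lambda>m k. c *\<^sub>C f m k) m k"
    "c *\<^sub>C sum_right f m k = sum_right (\<lambda>m k. c *\<^sub>C f m k) m k" for c
    by (rule double_sum_additive[symmetric]; simp add: scaleC_add_right)+
  have sl: "of_nat k *\<^sub>C sum_left f m k = sum_left (d2 g) m k"
    unfolding scale by (simp add: sum_left_def f2)
  have sr: "of_nat m *\<^sub>C sum_right f m k = sum_right (d1 g) m k"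
    unfolding scale by (simp add: sum_right_def f1)
  have "(of_nat k - of_nat m) *\<^sub>C sum_diag f m k = sum_diag (\<lambda>m k. d2 g m k - d1 g m k) m k"
    by (simp only: scale_sum_diag) (simp only: complex_vector.scale_left_diff_distrib f1 f2)
  then have sd: "of_nat k *\<^sub>C sum_diag f m k - of_nat m *\<^sub>C sum_diag f m k = sum_diag (d2 g) m k - sum_diag (d1 g) m k"
    by (simp add: complex_vector.scale_left_diff_distrib double_sum_diff)
  have E1: "d1 g m k = y1 * G - G * y1 + y11 * A + y12 * D" and E2: "d2 g m k = y2 * G - G * y2 + y22 * B + y12 * D"
    by (simp_all add: d1_def d2_def connection_def G_def A_def B_def D_def)
  have "of_nat k *\<^sub>C d1 f m k - of_nat m *\<^sub>C d2 f m k =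
      (y1 * (of_nat k *\<^sub>C f m k) - (of_nat k *\<^sub>C f m k) * y1 + y11 * (of_nat k *\<^sub>C sum_left f m k))
      - (y2 * (of_nat m *\<^sub>C f m k) - (of_nat m *\<^sub>C f m k) * y2 + y22 * (of_nat m *\<^sub>C sum_right f m k))
      + y12 * (of_nat k *\<^sub>C sum_diag f m k - of_nat m *\<^sub>C sum_diag f m k)"
    unfolding d1_def d2_def connection_def
    by (simp add: complex_vector.scale_right_diff_distrib scaleC_add_right right_diff_distrib)
  also have "\<dots> = (y1 * y2 - y2 * y1) * G - G * (y1 * y2 - y2 * y1) + (y1 * y22 - y22 * y1) * B
      + (y11 * y2 - y2 * y11) * A
      + ((y1 - y2) * y12 - y12 * (y1 - y2) + (y11 * y22 - y22 * y11)) * D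
      + (y11 * (y22 + y12) - (y22 + y12) * y11) * Q
      + ((y11 + y12) * y22 - y22 * (y11 + y12)) * R"
    unfolding f1 f2 sl sr sd left right diag1 diag2 E1 E2 by (simp add: algebra_simps)
  also have "\<dots> = 0" unfolding rel by simp
  finally show ?thesis by simp
qed

section \<open>The coefficients of the regular part\<close>

abbreviation connection1 :: "nat \<Rightarrow> (nat \<Rightarrow> nat \<Rightarrow> kz_lie uea) \<Rightarrow> nat \<Rightarrow> nat \<Rightarrow> kz_lie uea" where
  "connection1 \<alpha> \<equiv> connection (uea_in (X1 \<alpha>)) (uea_in (X11 \<alpha>)) (uea_in (X12 \<alpha>)) sum_left"

abbreviation connection2 :: "nat \<Rightarrow> (nat \<Rightarrow> nat \<Rightarrow> kz_lie uea) \<Rightarrow> nat \<Rightarrow> nat \<Rightarrow> kz_lie uea" where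
  "connection2 \<alpha> \<equiv> connection (uea_in (X2 \<alpha>)) (uea_in (X22 \<alpha>)) (uea_in (X12 \<alpha>)) sum_right"

text \<open>
  The component of degree \<open>n\<close> of the coefficient of \<open>z\<^sub>1\<^sup>m z\<^sub>2\<^sup>k\<close> in the regular part. It is obtained by
  integration along the rays from the origin: the Euler operator multiplies the monomial by \<open>m + k\<close>.
  For \<open>m = k = 0\<close> the factor \<open>1 / 0 = 0\<close> gives the constant term 0 in positive degrees.
\<close>

primrec kz_coeff :: "nat \<Rightarrow> nat \<Rightarrow> nat \<Rightarrow> nat \<Rightarrow> kz_lie uea" where
  "kz_coeff \<alpha> 0 = (\<lambda>m k. if m = 0 \<and> k = 0 then 1 else 0)"
| "kz_coeff \<alpha> (Suc n) = (\<lambda>m k. (1 / of_nat (m + k)) *\<^sub>C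
     (connection1 \<alpha> (kz_coeff \<alpha> n) m k + connection2 \<alpha> (kz_coeff \<alpha> n) m k))"

lemma connection_0 [simp]: "connection x a c sum_left (\<lambda>m k. 0) m k = 0" "connection x a c sum_right (\<lambda>m k. 0) m k = 0"
proof -
  have "sum_diag (\<lambda>m k. 0 :: 'a::ring) m k = 0" for m k
    by (induction m arbitrary: k) (simp_all split: nat.split)
  then show "connection x a c sum_left (\<lambda>m k. 0) m k = 0" "connection x a c sum_right (\<lambda>m k. 0) m k = 0"
    for x a c :: 'a by (simp_all add: connection_def sum_left_def sum_right_def)
qed

text \<open>
  The Poincare lemma for power series, applied in each degree to a form that is closed by induction.
\<close>

lemma kz_coeff_equations:
  "of_nat m *\<^sub>C kz_coeff \<alpha> (Suc n) m k = connection1 \<alpha> (kz_coeff \<alpha> n) m k"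
  "of_nat k *\<^sub>C kz_coeff \<alpha> (Suc n) m k = connection2 \<alpha> (kz_coeff \<alpha> n) m k"
proof -
  have rel: "uea_in (X1 \<alpha>) * uea_in (X2 \<alpha>) - uea_in (X2 \<alpha>) * uea_in (X1 \<alpha>) = 0"
    "uea_in (X1 \<alpha>) * uea_in (X22 \<alpha>) - uea_in (X22 \<alpha>) * uea_in (X1 \<alpha>) = 0"
    "uea_in (X11 \<alpha>) * uea_in (X2 \<alpha>) - uea_in (X2 \<alpha>) * uea_in (X11 \<alpha>) = 0"
    "uea_in (X11 \<alpha>) * (uea_in (X22 \<alpha>) + uea_in (X12 \<alpha>)) - (uea_in (X22 \<alpha>) + uea_in (X12 \<alpha>)) * uea_in (X11 \<alpha>) = 0"
    "(uea_in (X11 \<alpha>) + uea_in (X12 \<alpha>)) * uea_in (X22 \<alpha>) - uea_in (X22 \<alpha>) * (uea_in (X11 \<alpha>) + uea_in (X12 \<alpha>)) = 0"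
    "(uea_in (X1 \<alpha>) - uea_in (X2 \<alpha>)) * uea_in (X12 \<alpha>) - uea_in (X12 \<alpha>) * (uea_in (X1 \<alpha>) - uea_in (X2 \<alpha>))
      + (uea_in (X11 \<alpha>) * uea_in (X22 \<alpha>) - uea_in (X22 \<alpha>) * uea_in (X11 \<alpha>)) = 0"
    using X_relations[of \<alpha>, THEN arg_cong[of _ _ uea_in]] by (simp_all only: uea_in_simps)
  have step: "of_nat m *\<^sub>C kz_coeff \<alpha> (Suc n) m k = connection1 \<alpha> (kz_coeff \<alpha> n) m k \<and>
      of_nat k *\<^sub>C kz_coeff \<alpha> (Suc n) m k = connection2 \<alpha> (kz_coeff \<alpha> n) m k"
    if "\<And>m k. of_nat k *\<^sub>C connection1 \<alpha> (kz_coeff \<alpha> n) m k = of_nat m *\<^sub>C connection2 \<alpha> (kz_coeff \<alpha> n) m k"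
    for n m k
  proof (cases "m + k = 0")
    case True
    have "kz_coeff \<alpha> n 0 0 \<in> {0, 1}" by (cases n) simp_all
    with True show ?thesis by (auto simp: connection_def)
  next
    case False
    let ?d1 = "connection1 \<alpha> (kz_coeff \<alpha> n) m k" and ?d2 = "connection2 \<alpha> (kz_coeff \<alpha> n) m k"
    have nz: "(of_nat m + of_nat k :: complex) \<noteq> 0" using False by (metis of_nat_add of_nat_eq_0_iff)
    have "of_nat m *\<^sub>C kz_coeff \<alpha> (Suc n) m k = (1 / (of_nat m + of_nat k)) *\<^sub>C (of_nat m *\<^sub>C ?d1 + of_nat m *\<^sub>C ?d2)"
      by (simp add: scaleC_add_right)
    also have "\<dots> = ((1 / (of_nat m + of_nat k)) * (of_nat m + of_nat k)) *\<^sub>C ?d1"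
      unfolding that[symmetric] scaleC_add_left[symmetric] by simp
    finally have 1: "of_nat m *\<^sub>C kz_coeff \<alpha> (Suc n) m k = ?d1" using nz by simp
    have "of_nat k *\<^sub>C kz_coeff \<alpha> (Suc n) m k = (1 / (of_nat m + of_nat k)) *\<^sub>C (of_nat k *\<^sub>C ?d1 + of_nat k *\<^sub>C ?d2)"
      by (simp add: scaleC_add_right)
    also have "\<dots> = ((1 / (of_nat m + of_nat k)) * (of_nat m + of_nat k)) *\<^sub>C ?d2"
      unfolding that scaleC_add_left[symmetric] by simp
    finally show ?thesis using 1 nz by simp
  qed
  have "\<forall>m k. of_nat m *\<^sub>C kz_coeff \<alpha> (Suc n) m k = connection1 \<alpha> (kz_coeff \<alpha> n) m k \<and>
      of_nat k *\<^sub>C kz_coeff \<alpha> (Suc n) m k = connection2 \<alpha> (kz_coeff \<alpha> n) m k"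
  proof (induction n)
    case 0
    show ?case
    proof (intro allI step)
      show "of_nat k *\<^sub>C connection1 \<alpha> (kz_coeff \<alpha> 0) m k = of_nat m *\<^sub>C connection2 \<alpha> (kz_coeff \<alpha> 0) m k" for m k
        by (rule connection_closed[OF rel, of _ "\<lambda>m k. 0"]) auto
    qed
  next
    case (Suc n)
    show ?case
    proof (intro allI step)
      show "of_nat k *\<^sub>C connection1 \<alpha> (kz_coeff \<alpha> (Suc n)) m k = of_nat m *\<^sub>C connection2 \<alpha> (kz_coeff \<alpha> (Suc n)) m k" for m k
        by (rule connection_closed[OF rel, of _ "kz_coeff \<alpha> n"]) (use Suc in blast)+
    qed
  qed
  then show "of_nat m *\<^sub>C kz_coeff \<alpha> (Suc n) m k = connection1 \<alpha> (kz_coeff \<alpha> n) m k"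
    "of_nat k *\<^sub>C kz_coeff \<alpha> (Suc n) m k = connection2 \<alpha> (kz_coeff \<alpha> n) m k"
    by blast+
qed

lemma kz_coeff_in_deg: "kz_coeff \<alpha> n m k \<in> uea_deg n"
proof (induction n arbitrary: m k)
  case 0
  show ?case by (simp add: uea_deg_one complex_vector.subspace_0[OF subspace_uea_deg])
next
  case (Suc n)
  note sub = complex_vector.subspace_add[OF subspace_uea_deg] complex_vector.subspace_diff[OF subspace_uea_deg]
    complex_vector.subspace_0[OF subspace_uea_deg] complex_vector.subspace_scale[OF subspace_uea_deg]
  have mult: "uea_in x * y \<in> uea_deg (Suc n)" "y * uea_in x \<in> uea_deg (Suc n)"
    if "degree_one x" "y \<in> uea_deg n" for x y
    using uea_deg_mult[of "uea_in x" 1 y n] uea_deg_mult[of y n "uea_in x" 1] that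
    by (simp_all add: degree_one_def)
  have "sum_left (kz_coeff \<alpha> n) m k \<in> uea_deg n" "sum_right (kz_coeff \<alpha> n) m k \<in> uea_deg n"
    using Suc by (simp_all add: sum_left_def sum_right_def uea_deg_sum)
  moreover have "sum_diag (kz_coeff \<alpha> n) m k \<in> uea_deg n" for m k
    by (induction m arbitrary: k) (simp_all add: sub Suc split: nat.split)
  ultimately show ?case
    by (simp add: connection_def sub mult Suc)
qed

text \<open>
  The sums in the recursion have at most \<open>m + k\<close> terms, which the division by \<open>m + k\<close> compensates.
\<close>

lemma kz_coeff_bounded:
  assumes "clinear \<phi>"
  shows "\<exists>C. \<forall>m k. norm (\<phi> (kz_coeff \<alpha> n m k)) \<le> C"
  using assms
proof (induction n arbitrary: \<phi>)
  case 0
  then show ?case by (intro exI[of _ "norm (\<phi> 1)"]) (simp add: clinearD)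
next
  case (Suc n)
  let ?f = "kz_coeff \<alpha> n"
  have ops: "norm (\<psi> (S ?f m k)) \<le> C * real (m + k)"
    if S: "S \<in> {sum_left, sum_right, sum_diag}" and \<psi>: "clinear \<psi>" and C: "\<And>m k. norm (\<psi> (?f m k)) \<le> C"
    for S \<psi> C m k
  proof -
    have "0 \<le> C" using C[of 0 0] norm_ge_zero order_trans by blast
    then have "C * real m \<le> C * real (m + k)" "C * real k \<le> C * real (m + k)" by (auto intro: mult_left_mono)
    with norm_double_sum_le[of "\<lambda>m k. \<psi> (?f m k)" C, OF C, of m k] double_sum_additive[of \<psi> ?f m k] S
    show ?thesis by (auto simp: clinearD[OF \<psi>])
  qed
  have conn: "\<exists>C. \<forall>m k. norm (\<phi> (connection x a c S ?f m k)) \<le> C * (real (m + k) + 1)"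
    if S: "S \<in> {sum_left, sum_right}" for x a c S
  proof -
    have lin: "clinear (\<lambda>y. \<phi> (x * y))" "clinear (\<lambda>y. \<phi> (y * x))" "clinear (\<lambda>y. \<phi> (a * y))" "clinear (\<lambda>y. \<phi> (c * y))"
      by (intro clinear_mult_left clinear_mult_right Suc.prems)+
    from Suc.IH[OF lin(1)] Suc.IH[OF lin(2)] Suc.IH[OF lin(3)] Suc.IH[OF lin(4)]
    obtain C1 C2 C3 C4 where C: "\<And>m k. norm (\<phi> (x * ?f m k)) \<le> C1" "\<And>m k. norm (\<phi> (?f m k * x)) \<le> C2"
      "\<And>m k. norm (\<phi> (a * ?f m k)) \<le> C3" "\<And>m k. norm (\<phi> (c * ?f m k)) \<le> C4" by blast
    have pos: "0 \<le> C1" "0 \<le> C2" "0 \<le> C3" "0 \<le> C4"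
      using C[of 0 0] norm_ge_zero order_trans by blast+
    have "norm (\<phi> (connection x a c S ?f m k)) \<le> (C1 + C2 + C3 + C4) * (real (m + k) + 1)" for m k
    proof -
      have "norm (\<phi> (connection x a c S ?f m k)) \<le> norm (\<phi> (x * ?f m k)) + norm (\<phi> (?f m k * x))
          + norm (\<phi> (a * S ?f m k)) + norm (\<phi> (c * sum_diag ?f m k))"
        unfolding connection_def clinearD[OF Suc.prems]
        by (rule order_trans[OF norm_triangle_ineq] add_mono order_refl norm_triangle_ineq4)+
      also have "\<dots> \<le> C1 + C2 + C3 * real (m + k) + C4 * real (m + k)"
        using C(1,2)[of m k] ops[OF _ lin(3) C(3), of S m k] ops[OF _ lin(4) C(4), of sum_diag m k] S by auto
      also have "\<dots> \<le> (C1 + C2 + C3 + C4) * (real (m + k) + 1)"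
        using pos by (simp add: algebra_simps)
      finally show ?thesis .
    qed
    then show ?thesis by blast
  qed
  from conn[of sum_left] conn[of sum_right] obtain C1 C2 where
    C: "\<And>m k. norm (\<phi> (connection1 \<alpha> ?f m k)) \<le> C1 * (real (m + k) + 1)"
       "\<And>m k. norm (\<phi> (connection2 \<alpha> ?f m k)) \<le> C2 * (real (m + k) + 1)" by blast
  have "0 \<le> C1 + C2" using norm_ge_zero order_trans C[of 0 0] by (metis add_nonneg_nonneg add_cancel_right_left mult.right_neutral of_nat_0)
  have "norm (\<phi> (kz_coeff \<alpha> (Suc n) m k)) \<le> 2 * (C1 + C2)" for m k
  proof (cases "m + k = 0")
    case True
    then show ?thesis using \<open>0 \<le> C1 + C2\<close> by (simp add: clinearD[OF Suc.prems])
  next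
    case False
    then have "1 \<le> m + k" by linarith
    then have mk: "real (m + k) \<ge> 1" by (metis of_nat_1 of_nat_le_iff)
    have "norm (\<phi> (kz_coeff \<alpha> (Suc n) m k))
        = norm (\<phi> (connection1 \<alpha> ?f m k) + \<phi> (connection2 \<alpha> ?f m k)) / real (m + k)"
      by (simp add: clinearD[OF Suc.prems] norm_divide norm_mult del: of_nat_add)
    also have "\<dots> \<le> (C1 * (real (m + k) + 1) + C2 * (real (m + k) + 1)) / real (m + k)"
      using norm_triangle_le[OF add_mono[OF C(1)[of m k] C(2)[of m k]]] mk by (intro divide_right_mono) auto
    also have "\<dots> \<le> ((C1 + C2) * (2 * real (m + k))) / real (m + k)"
      unfolding distrib_right[symmetric] using mk \<open>0 \<le> C1 + C2\<close> by (intro divide_right_mono mult_left_mono) auto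
    also have "\<dots> = 2 * (C1 + C2)"
    proof -
      have "(c * (2 * x)) / x = 2 * c" if "x \<ge> 1" for c x :: real using that by simp
      from this[OF mk] show ?thesis .
    qed
    finally show ?thesis .
  qed
  then show ?case by blast
qed

section \<open>Convergence of double power series\<close>

definition double_series :: "(nat \<Rightarrow> nat \<Rightarrow> complex) \<Rightarrow> complex \<times> complex \<Rightarrow> complex" where
  "double_series c z = (\<Sum>\<^sub>\<infinity>(m, k)\<in>UNIV. c m k * fst z ^ m * snd z ^ k)"

text \<open>
  A growth condition under which the series converges absolutely on the bidisc. It holds for bounded
  sequences, for their first derivatives and for their partial sums.
\<close>

definition tame :: "(nat \<Rightarrow> nat \<Rightarrow> complex) \<Rightarrow> bool" where
  "tame c \<longleftrightarrow> (\<exists>C. \<forall>m k. norm (c m k) \<le> C * (real (Suc m) * real (Suc k)))"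

definition bidisc :: "(complex \<times> complex) set" where
  "bidisc = {z. norm (fst z) < 1 \<and> norm (snd z) < 1}"

lemma summable_on_double_geometric:
  assumes "0 \<le> r" "r < 1" "0 \<le> s" "s < 1"
  shows "(\<lambda>(m, k). (real (Suc m) * r ^ m) * (real (Suc k) * s ^ k)) summable_on UNIV"
proof -
  have one: "(\<lambda>m. real (Suc m) * r ^ m) summable_on UNIV" if "0 \<le> r" "r < 1" for r
  proof -
    have "summable (\<lambda>m. real (Suc m) * r ^ m)"
      using geometric_deriv_sums[of r] that by (simp add: sums_iff)
    then show ?thesis using that by (subst summable_on_UNIV_nonneg_real_iff) auto
  qed
  let ?f = "\<lambda>(m, k). (real (Suc m) * r ^ m) * (real (Suc k) * s ^ k)"
  have "(\<lambda>p. norm (?f p)) summable_on UNIV \<times> UNIV"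
    unfolding Infinite_Sum.abs_summable_on_Sigma_iff
  proof (intro conjI ballI)
    show "(\<lambda>k. norm (?f (m, k))) summable_on UNIV" for m
      using assms summable_on_cmult_right[OF one[of s], of "real (Suc m) * r ^ m"]
      by (simp add: abs_mult power_abs)
    have "(\<lambda>m. norm ((real (Suc m) * r ^ m) * (\<Sum>\<^sub>\<infinity>k. real (Suc k) * s ^ k))) summable_on UNIV"
      using assms summable_on_cmult_left[OF one[of r], of "\<Sum>\<^sub>\<infinity>k. real (Suc k) * s ^ k"]
        infsum_nonneg[of UNIV "\<lambda>k. real (Suc k) * s ^ k"]
      by (simp add: abs_mult power_abs)
    moreover have "(\<Sum>\<^sub>\<infinity>k. norm (?f (m, k))) = (real (Suc m) * r ^ m) * (\<Sum>\<^sub>\<infinity>k. real (Suc k) * s ^ k)" for m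
      using assms infsum_cmult_right'[of "real (Suc m) * r ^ m" "\<lambda>k. real (Suc k) * s ^ k" UNIV]
      by (simp add: abs_mult power_abs)
    ultimately show "(\<lambda>m. norm (\<Sum>\<^sub>\<infinity>k. norm (?f (m, k)))) summable_on UNIV"
      by presburger
  qed
  then show ?thesis
    unfolding UNIV_Times_UNIV by (rule abs_summable_summable)
qed

lemma summable_double_series:
  assumes "tame c" "z \<in> bidisc"
  shows "(\<lambda>(m, k). c m k * fst z ^ m * snd z ^ k) summable_on UNIV"
proof -
  obtain C where C: "\<And>m k. norm (c m k) \<le> C * (real (Suc m) * real (Suc k))"
    using assms(1) by (auto simp: tame_def)
  define r s where "r = norm (fst z)" and "s = norm (snd z)"
  have rs: "0 \<le> r" "r < 1" "0 \<le> s" "s < 1" using assms(2) by (auto simp: r_def s_def bidisc_def)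
  have "(\<lambda>p. C * (case p of (m, k) \<Rightarrow> (real (Suc m) * r ^ m) * (real (Suc k) * s ^ k))) summable_on UNIV"
    by (intro summable_on_cmult_right summable_on_double_geometric rs)
  then have "(\<lambda>p. norm (case p of (m, k) \<Rightarrow> c m k * fst z ^ m * snd z ^ k)) summable_on UNIV"
  proof (rule summable_on_comparison_test)
    show "norm (case p of (m, k) \<Rightarrow> c m k * fst z ^ m * snd z ^ k)
        \<le> C * (case p of (m, k) \<Rightarrow> (real (Suc m) * r ^ m) * (real (Suc k) * s ^ k))" for p
    proof (cases p)
      case (Pair m k)
      have "norm (c m k) * (r ^ m * s ^ k) \<le> C * (real (Suc m) * real (Suc k)) * (r ^ m * s ^ k)"
        using rs by (intro mult_right_mono C) simp
      then show ?thesis by (simp add: Pair norm_mult norm_power r_def s_def mult_ac)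
    qed
  qed simp
  then show ?thesis by (rule abs_summable_summable)
qed

lemma tame_bounded: "(\<And>m k. norm (c m k) \<le> C) \<Longrightarrow> tame c"
proof -
  assume C: "\<And>m k. norm (c m k) \<le> C"
  have "0 \<le> C" using C[of 0 0] norm_ge_zero order_trans by blast
  have "norm (c m k) \<le> C * (real (Suc m) * real (Suc k))" for m k
  proof -
    have "1 * 1 \<le> real (Suc m) * real (Suc k)" by (intro mult_mono) auto
    from mult_left_mono[OF this \<open>0 \<le> C\<close>] C[of m k] show ?thesis by simp
  qed
  then show ?thesis by (auto simp: tame_def)
qed

lemma tame_add: "tame c \<Longrightarrow> tame d \<Longrightarrow> tame (\<lambda>m k. c m k + d m k)"
proof -
  assume "tame c" "tame d"
  then obtain C D where "\<And>m k. norm (c m k) \<le> C * (real (Suc m) * real (Suc k))"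
    "\<And>m k. norm (d m k) \<le> D * (real (Suc m) * real (Suc k))" by (auto simp: tame_def)
  then have "norm (c m k + d m k) \<le> (C + D) * (real (Suc m) * real (Suc k))" for m k
    unfolding distrib_right[of C D] by (intro norm_triangle_le add_mono)
  then show ?thesis unfolding tame_def by blast
qed

lemma tame_scale: "tame c \<Longrightarrow> tame (\<lambda>m k. a * c m k)"
proof -
  assume "tame c"
  then obtain C where "\<And>m k. norm (c m k) \<le> C * (real (Suc m) * real (Suc k))" by (auto simp: tame_def)
  then have "norm (a * c m k) \<le> (norm a * C) * (real (Suc m) * real (Suc k))" for m k
    unfolding norm_mult mult.assoc[of "norm a"] by (intro mult_left_mono) auto
  then show ?thesis unfolding tame_def by blast
qed

lemma tame_sum: "(\<And>e. e \<in> E \<Longrightarrow> tame (c e)) \<Longrightarrow> tame (\<lambda>m k. \<Sum>e\<in>E. c e m k)"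
proof (induction E rule: infinite_finite_induct)
  case (insert e E)
  then show ?case using tame_add[of "c e" "\<lambda>m k. \<Sum>e\<in>E. c e m k"] by simp
qed (use tame_bounded[of "\<lambda>m k. 0" 0] in auto)

lemma tame_linear_growth:
  assumes "\<And>m k. norm (c m k) \<le> C"
  shows "tame (\<lambda>m k. of_nat (Suc m) * c (Suc m) k)" "tame (\<lambda>m k. of_nat (Suc k) * c m (Suc k))"
    "tame (\<lambda>m k. of_nat m * c m k)" "tame (\<lambda>m k. of_nat k * c m k)"
    "tame (sum_left c)" "tame (sum_right c)" "tame (sum_diag c)"
proof -
  have "0 \<le> C" using assms[of 0 0] norm_ge_zero order_trans by blast
  have bound: "x \<le> C * (real (Suc m) * real (Suc k))" if "x \<le> C * real l" "l \<le> Suc m \<or> l \<le> Suc k" for x l m k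
  proof -
    have "l \<le> Suc m * Suc k" using that(2) by (auto intro: order_trans)
    then have "real l \<le> real (Suc m) * real (Suc k)" by (metis of_nat_mono of_nat_mult)
    with that(1) \<open>0 \<le> C\<close> show ?thesis by (meson mult_left_mono order_trans)
  qed
  have mult: "norm (of_nat l * c m k) \<le> C * real l" for l m k
    using mult_right_mono[OF assms[of m k], of "real l"] by (simp add: norm_mult mult.commute)
  show "tame (\<lambda>m k. of_nat (Suc m) * c (Suc m) k)" "tame (\<lambda>m k. of_nat (Suc k) * c m (Suc k))"
    "tame (\<lambda>m k. of_nat m * c m k)" "tame (\<lambda>m k. of_nat k * c m k)"
    unfolding tame_def by (intro exI[of _ C] allI bound[OF mult]; simp)+
  show "tame (sum_left c)" "tame (sum_right c)" "tame (sum_diag c)"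
    unfolding tame_def using norm_double_sum_le[of c C, OF assms] by (blast intro: bound le_SucI)+
qed

lemma double_series_add:
  assumes "tame c" "tame d" "z \<in> bidisc"
  shows "double_series (\<lambda>m k. c m k + d m k) z = double_series c z + double_series d z"
  unfolding double_series_def
  using infsum_add[OF summable_double_series[OF assms(1,3)] summable_double_series[OF assms(2,3)]]
  by (simp add: case_prod_unfold distrib_right)

lemma double_series_scale: "double_series (\<lambda>m k. a * c m k) z = a * double_series c z"
  unfolding double_series_def by (simp add: case_prod_unfold infsum_cmult_right'[symmetric] mult.assoc)

lemma double_series_0 [simp]: "double_series (\<lambda>m k. 0) z = 0"
  by (simp add: double_series_def case_prod_unfold)

lemma double_series_diff:
  assumes "tame c" "tame d" "z \<in> bidisc"
  shows "double_series (\<lambda>m k. c m k - d m k) z = double_series c z - double_series d z"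
  using double_series_add[OF assms(1) tame_scale[OF assms(2), of "-1"] assms(3)]
    double_series_scale[of "-1" d z] by simp

lemma double_series_sum:
  assumes "\<And>e. e \<in> E \<Longrightarrow> tame (c e)" "z \<in> bidisc"
  shows "double_series (\<lambda>m k. \<Sum>e\<in>E. c e m k) z = (\<Sum>e\<in>E. double_series (c e) z)"
  using assms(1)
proof (induction E rule: infinite_finite_induct)
  case (insert e E)
  then show ?case using double_series_add[OF _ tame_sum[of E c] assms(2), of "c e"] by simp
qed simp_all

lemma has_sum_inj:
  assumes "inj h" "\<And>p. p \<notin> range h \<Longrightarrow> F p = 0"
  shows "(F has_sum S) UNIV \<longleftrightarrow> ((F \<circ> h) has_sum S) UNIV"
  unfolding has_sum_reindex[OF assms(1), symmetric]
  by (rule has_sum_cong_neutral) (use assms(2) in auto)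

lemma infsum_eqI_has_sum:
  fixes F :: "'a \<Rightarrow> complex" and G :: "'b \<Rightarrow> complex"
  assumes "\<And>S. (F has_sum S) A \<longleftrightarrow> (G has_sum S) B"
  shows "infsum F A = infsum G B"
  using assms by (metis has_sum_infsum infsumI infsum_not_exists summable_on_def)

lemma has_sum_shift:
  fixes F :: "nat \<Rightarrow> nat \<Rightarrow> complex"
  shows "(\<And>k. F 0 k = 0) \<Longrightarrow> ((\<lambda>(m, k). F m k) has_sum S) UNIV \<longleftrightarrow> ((\<lambda>(m, k). F (Suc m) k) has_sum S) UNIV"
    and "(\<And>m. F m 0 = 0) \<Longrightarrow> ((\<lambda>(m, k). F m k) has_sum S) UNIV \<longleftrightarrow> ((\<lambda>(m, k). F m (Suc k)) has_sum S) UNIV"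
proof -
  let ?h1 = "\<lambda>(m :: nat, k :: nat). (Suc m, k)" and ?h2 = "\<lambda>(m :: nat, k :: nat). (m, Suc k)"
  have comp: "(\<lambda>(m, k). F m k) \<circ> ?h1 = (\<lambda>(m, k). F (Suc m) k)" "(\<lambda>(m, k). F m k) \<circ> ?h2 = (\<lambda>(m, k). F m (Suc k))"
    by (auto simp: fun_eq_iff)
  have range: "p \<notin> range ?h1 \<Longrightarrow> fst p = 0" "p \<notin> range ?h2 \<Longrightarrow> snd p = 0" for p
    by (cases p; cases "fst p"; cases "snd p"; force)+
  show "((\<lambda>(m, k). F m k) has_sum S) UNIV \<longleftrightarrow> ((\<lambda>(m, k). F (Suc m) k) has_sum S) UNIV" if "\<And>k. F 0 k = 0"
    unfolding comp(1)[symmetric]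
  proof (rule has_sum_inj)
    show "(case p of (m, k) \<Rightarrow> F m k) = 0" if "p \<notin> range ?h1" for p
      using range(1)[OF that] \<open>\<And>k. F 0 k = 0\<close> by (cases p) simp
  qed (auto simp: inj_on_def)
  show "((\<lambda>(m, k). F m k) has_sum S) UNIV \<longleftrightarrow> ((\<lambda>(m, k). F m (Suc k)) has_sum S) UNIV" if "\<And>m. F m 0 = 0"
    unfolding comp(2)[symmetric]
  proof (rule has_sum_inj)
    show "(case p of (m, k) \<Rightarrow> F m k) = 0" if "p \<notin> range ?h2" for p
      using range(2)[OF that] \<open>\<And>m. F m 0 = 0\<close> by (cases p) simp
  qed (auto simp: inj_on_def)
qed

lemma double_series_shift_left:
  assumes "\<And>k. c 0 k = 0"
  shows "double_series c z = fst z * double_series (\<lambda>m k. c (Suc m) k) z"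
  unfolding double_series_def
  using infsum_eqI_has_sum[OF has_sum_shift(1)[of "\<lambda>m k. c m k * fst z ^ m * snd z ^ k"]]
  by (simp add: assms case_prod_unfold infsum_cmult_right'[symmetric] mult_ac)

lemma double_series_shift_right:
  assumes "\<And>m. c m 0 = 0"
  shows "double_series c z = snd z * double_series (\<lambda>m k. c m (Suc k)) z"
  unfolding double_series_def
  using infsum_eqI_has_sum[OF has_sum_shift(2)[of "\<lambda>m k. c m k * fst z ^ m * snd z ^ k"]]
  by (simp add: assms case_prod_unfold infsum_cmult_right'[symmetric] mult_ac)

text \<open>
  Each of the sums \<open>x\<close> solves an equation \<open>x = t (c + x)\<close> for \<open>t = z\<^sub>1\<close>, \<open>z\<^sub>2\<close> or \<open>z\<^sub>1 z\<^sub>2\<close>.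
\<close>

lemma double_series_sums:
  assumes C: "\<And>m k. norm (c m k) \<le> C" and z: "z \<in> bidisc"
  shows "double_series (sum_left c) z = fst z / (1 - fst z) * double_series c z"
    "double_series (sum_right c) z = snd z / (1 - snd z) * double_series c z"
    "double_series (sum_diag c) z = fst z * snd z / (1 - fst z * snd z) * double_series c z"
proof -
  have solve: "x = t / (1 - t) * y" if "x = t * (y + x)" "norm t < 1" for x y t :: complex
  proof -
    have "t \<noteq> 1" using that(2) by auto
    then show ?thesis using that(1) by (simp add: field_simps)
  qed
  have t: "norm (fst z) < 1" "norm (snd z) < 1" "norm (fst z * snd z) < 1"
    using z mult_left_le[of "norm (snd z)" "norm (fst z)"] by (auto simp: bidisc_def norm_mult)
  note tame = tame_bounded[of c C, OF C] tame_linear_growth(5-7)[OF C]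
  have shift: "(\<lambda>m k. sum_left c (Suc m) k) = (\<lambda>m k. c m k + sum_left c m k)"
    "(\<lambda>m k. sum_right c m (Suc k)) = (\<lambda>m k. c m k + sum_right c m k)"
    "(\<lambda>m k. sum_diag c (Suc m) (Suc k)) = (\<lambda>m k. c m k + sum_diag c m k)"
    by (intro ext; simp)+
  show "double_series (sum_left c) z = fst z / (1 - fst z) * double_series c z"
    by (rule solve[OF _ t(1)])
      (use double_series_shift_left[of "sum_left c" z] shift(1) double_series_add[OF tame(1,2) z] in simp)
  show "double_series (sum_right c) z = snd z / (1 - snd z) * double_series c z"
    by (rule solve[OF _ t(2)])
      (use double_series_shift_right[of "sum_right c" z] shift(2) double_series_add[OF tame(1,3) z] in simp)
  show "double_series (sum_diag c) z = fst z * snd z / (1 - fst z * snd z) * double_series c z"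
    by (rule solve[OF _ t(3)])
      (use double_series_shift_left[of "sum_diag c" z] shift(3) double_series_add[OF tame(1,4) z]
        double_series_shift_right[of "\<lambda>m k. sum_diag c (Suc m) k" z] in \<open>simp del: sum_diag.simps(2) add: mult.assoc\<close>)
qed

lemma double_series_origin: "double_series c (0, 0) = c 0 0"
proof -
  have "double_series c (0, 0) = (\<Sum>\<^sub>\<infinity>(m, k)\<in>{(0, 0)}. c m k * 0 ^ m * 0 ^ k)"
    unfolding double_series_def by (rule infsum_cong_neutral) (auto simp: power_0_left split: if_splits)
  then show ?thesis by simp
qed

lemma sums_prod_decode:
  "((F :: nat \<times> nat \<Rightarrow> complex) has_sum S) UNIV \<Longrightarrow> (\<lambda>i. F (prod_decode i)) sums S"
  using has_sum_reindex_bij_betw[OF bij_prod_decode] has_sum_imp_sums by blast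

text \<open>
  Termwise differentiation: with the monomials enumerated by one index, the derivatives are dominated
  by a convergent series on a bidisc of radius \<open>r < 1\<close>.
\<close>

lemma double_series_has_derivative:
  assumes C: "\<And>m k. norm (c m k) \<le> C" and z: "z \<in> bidisc"
  shows "(double_series c has_derivative (\<lambda>h.
      fst h * double_series (\<lambda>m k. of_nat (Suc m) * c (Suc m) k) z
    + snd h * double_series (\<lambda>m k. of_nat (Suc k) * c m (Suc k)) z)) (at z)"
proof -
  have "0 \<le> C" using C[of 0 0] norm_ge_zero order_trans by blast
  have "max (norm (fst z)) (norm (snd z)) < 1" using z by (simp add: bidisc_def)
  then obtain r where r: "max (norm (fst z)) (norm (snd z)) < r" "r < 1" using dense by blast
  have "0 < r" using r(1) norm_ge_zero[of "fst z"] by linarith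
  define S where "S = ball (0 :: complex) r \<times> ball (0 :: complex) r"
  have S: "open S" "convex S" "z \<in> S" "\<And>v. v \<in> S \<Longrightarrow> norm (fst v) < r \<and> norm (snd v) < r"
    using r by (auto simp: S_def open_Times convex_Times mem_Times_iff)
  have S_bidisc: "v \<in> bidisc" if "v \<in> S" for v using S(4)[OF that] r(2) by (auto simp: bidisc_def)
  define f where "f i v = (case prod_decode i of (m, k) \<Rightarrow> c m k * fst v ^ m * snd v ^ k)" for i v
  define f' where "f' i v h = (case prod_decode i of (m, k) \<Rightarrow>
      c m k * (of_nat m * fst v ^ (m - 1) * fst h * snd v ^ k + fst v ^ m * (of_nat k * snd v ^ (k - 1) * snd h)))"
    for i and v h :: "complex \<times> complex"
  define M where "M i = (2 * C / r) * (case prod_decode i of (m, k) \<Rightarrow> (real (Suc m) * r ^ m) * (real (Suc k) * r ^ k))" for i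
  have "summable M"
    unfolding M_def
  proof (intro summable_mult summable_on_imp_summable)
    show "(\<lambda>i. case prod_decode i of (m, k) \<Rightarrow> (real (Suc m) * r ^ m) * (real (Suc k) * r ^ k)) summable_on UNIV"
      using summable_on_double_geometric[of r r] \<open>0 < r\<close> r(2)
      unfolding summable_on_reindex_bij_betw[OF bij_prod_decode] by simp
  qed
  have bound: "norm (f' i v h) \<le> M i * norm h" if v: "v \<in> S" for i v h
  proof -
    obtain m k where mk: "prod_decode i = (m, k)" by (cases "prod_decode i")
    have power: "norm t ^ l \<le> r ^ l" "norm t ^ l \<le> real (Suc l) * r ^ l"
        "real l * norm t ^ (l - 1) \<le> real (Suc l) * r ^ l / r"
      if "norm t < r" for l and t :: complex
    proof -
      show 1: "norm t ^ l \<le> r ^ l" for l using that by (intro power_mono) auto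
      also have "r ^ l \<le> real (Suc l) * r ^ l" using \<open>0 < r\<close> by simp
      finally show "norm t ^ l \<le> real (Suc l) * r ^ l" .
      show "real l * norm t ^ (l - 1) \<le> real (Suc l) * r ^ l / r"
      proof (cases l)
        case (Suc l')
        have "real l * norm t ^ l' \<le> real (Suc l) * r ^ l'" using 1 by (intro mult_mono) auto
        then show ?thesis using Suc \<open>0 < r\<close> by simp
      qed (use \<open>0 < r\<close> in simp)
    qed
    have v1: "norm (fst v) < r" and v2: "norm (snd v) < r" using S(4)[OF v] by auto
    have h: "norm (fst h) \<le> norm h" "norm (snd h) \<le> norm h" using norm_fst_le[of "fst h" "snd h"] norm_snd_le[of "snd h" "fst h"] by simp_all
    let ?R = "(real (Suc m) * r ^ m / r) * (real (Suc k) * r ^ k)"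
    have 1: "(real m * norm (fst v) ^ (m - 1)) * norm (snd v) ^ k * norm (fst h) \<le> ?R * norm h"
      using power[OF v1] power[OF v2] h \<open>0 < r\<close> by (intro mult_mono) auto
    have 2: "norm (fst v) ^ m * (real k * norm (snd v) ^ (k - 1)) * norm (snd h)
        \<le> (real (Suc m) * r ^ m) * (real (Suc k) * r ^ k / r) * norm h"
      using power[OF v1] power[OF v2] h \<open>0 < r\<close> by (intro mult_mono) auto
    have "norm (of_nat m * fst v ^ (m - 1) * fst h * snd v ^ k) \<le> ?R * norm h"
      using 1 by (simp add: norm_mult norm_power mult_ac)
    moreover have "norm (fst v ^ m * (of_nat k * snd v ^ (k - 1) * snd h)) \<le> ?R * norm h"
      using 2 by (simp add: norm_mult norm_power mult_ac)
    ultimately have "norm (of_nat m * fst v ^ (m - 1) * fst h * snd v ^ k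
        + fst v ^ m * (of_nat k * snd v ^ (k - 1) * snd h)) \<le> 2 * (?R * norm h)"
      unfolding mult_2 by (intro norm_triangle_le add_mono)
    moreover have "norm (f' i v h) = norm (c m k) * norm (of_nat m * fst v ^ (m - 1) * fst h * snd v ^ k
        + fst v ^ m * (of_nat k * snd v ^ (k - 1) * snd h))"
      by (simp add: f'_def mk norm_mult)
    moreover have "M i * norm h = C * (2 * (?R * norm h))"
      by (simp add: M_def mk field_simps)
    ultimately show ?thesis
      using C[of m k] \<open>0 \<le> C\<close> by (simp only:) (intro mult_mono; simp)
  qed
  define g' where "g' v h = suminf (\<lambda>i. f' i v h)" for v h
  have "\<exists>g. \<forall>v\<in>S. (\<lambda>n. f n v) sums g v \<and> (g has_derivative g' v) (at v within S)"
  proof (rule has_derivative_series[OF S(2)])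
    show "(f i has_derivative f' i v) (at v within S)" if "v \<in> S" for i v
    proof (cases "prod_decode i")
      case (Pair m k)
      then show ?thesis
        unfolding f_def[abs_def] f'_def[abs_def]
        by (auto intro!: derivative_eq_intros simp: algebra_simps)
    qed
    show "\<forall>\<^sub>F n in sequentially. \<forall>v\<in>S. \<forall>h. norm (sum (\<lambda>i. f' i v h) {..<n} - g' v h) \<le> e * norm h"
      if "e > 0" for e
    proof -
      have "(\<lambda>n. suminf M - sum M {..<n}) \<longlonglongrightarrow> suminf M - suminf M"
        using \<open>summable M\<close> by (intro tendsto_intros summable_LIMSEQ)
      then have "\<forall>\<^sub>F n in sequentially. suminf M - sum M {..<n} < e"
        using \<open>e > 0\<close> by (intro order_tendstoD(2)) auto
      then show ?thesis
      proof eventually_elim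
        case (elim n)
        show ?case
        proof (intro ballI allI)
          fix v and h :: "complex \<times> complex" assume v: "v \<in> S"
          have sM: "summable (\<lambda>i. M i * norm h)" using \<open>summable M\<close> by (rule summable_mult2)
          have sf: "summable (\<lambda>i. f' i v h)"
            by (rule summable_comparison_test'[OF sM, of 0]) (rule bound[OF v])
          have "norm (g' v h - sum (\<lambda>i. f' i v h) {..<n}) = norm (suminf (\<lambda>i. f' (i + n) v h))"
            by (simp add: g'_def suminf_minus_initial_segment[OF sf])
          also have "\<dots> \<le> suminf (\<lambda>i. M (i + n) * norm h)"
            by (rule norm_suminf_le) (use bound[OF v] sM summable_ignore_initial_segment in blast)+
          also have "\<dots> = (suminf M - sum M {..<n}) * norm h"
            using \<open>summable M\<close> by (simp add: suminf_mult2[symmetric] suminf_minus_initial_segment summable_ignore_initial_segment)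
          also have "\<dots> \<le> e * norm h" using elim by (intro mult_right_mono) auto
          finally show "norm (sum (\<lambda>i. f' i v h) {..<n} - g' v h) \<le> e * norm h"
            by (simp add: norm_minus_commute)
        qed
      qed
    qed
    show "z \<in> S" by (rule S(3))
    show "(\<lambda>n. f n z) sums double_series c z"
      using sums_prod_decode[OF has_sum_infsum[OF summable_double_series[OF tame_bounded[OF C] z]]]
      by (simp add: f_def double_series_def case_prod_unfold)
  qed
  then obtain g where g: "\<And>v. v \<in> S \<Longrightarrow> (\<lambda>n. f n v) sums g v" "(g has_derivative g' z) (at z within S)"
    using S(3) by blast
  have g_eq: "g v = double_series c v" if "v \<in> S" for v
  proof -
    have "(\<lambda>n. f n v) sums double_series c v"
      using sums_prod_decode[OF has_sum_infsum[OF summable_double_series[OF tame_bounded[OF C] S_bidisc[OF that]]]]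
      by (simp add: f_def double_series_def case_prod_unfold)
    then show ?thesis using g(1)[OF that] sums_unique2 by blast
  qed
  have "(double_series c has_derivative g' z) (at z within S)"
    using has_derivative_transform[OF S(3) _ g(2)] g_eq by metis
  then have derivative: "(double_series c has_derivative g' z) (at z)"
    using at_within_open[OF S(3,1)] by simp
  have g'_eq: "g' z h = fst h * double_series (\<lambda>m k. of_nat (Suc m) * c (Suc m) k) z
      + snd h * double_series (\<lambda>m k. of_nat (Suc k) * c m (Suc k)) z" for h
  proof -
    let ?F1 = "\<lambda>m k. of_nat m * c m k * fst z ^ (m - 1) * snd z ^ k"
    let ?F2 = "\<lambda>m k. of_nat k * c m k * fst z ^ m * snd z ^ (k - 1)"
    have s1: "((\<lambda>(m, k). ?F1 m k) has_sum double_series (\<lambda>m k. of_nat (Suc m) * c (Suc m) k) z) UNIV"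
      using has_sum_infsum[OF summable_double_series[OF tame_linear_growth(1)[of c C, OF C] z]]
      by (subst has_sum_shift(1)[where F = ?F1]) (simp_all add: double_series_def)
    have s2: "((\<lambda>(m, k). ?F2 m k) has_sum double_series (\<lambda>m k. of_nat (Suc k) * c m (Suc k)) z) UNIV"
      using has_sum_infsum[OF summable_double_series[OF tame_linear_growth(2)[of c C, OF C] z]]
      by (subst has_sum_shift(2)[where F = ?F2]) (simp_all add: double_series_def)
    let ?G = "fst h * double_series (\<lambda>m k. of_nat (Suc m) * c (Suc m) k) z + snd h * double_series (\<lambda>m k. of_nat (Suc k) * c m (Suc k)) z"
    have "(\<lambda>i. fst h * (case prod_decode i of (m, k) \<Rightarrow> ?F1 m k) + snd h * (case prod_decode i of (m, k) \<Rightarrow> ?F2 m k))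
       sums ?G"
      by (intro sums_add sums_mult sums_prod_decode s1 s2)
    then have "(\<lambda>i. f' i z h) sums ?G"
      by (simp add: f'_def case_prod_unfold algebra_simps)
    then show ?thesis unfolding g'_def by (simp add: sums_iff)
  qed
  show ?thesis using derivative unfolding g'_eq .
qed

section \<open>The regular part as a holomorphic function\<close>

lemma kz_compl_eqI_functional:
  "(\<And>n \<phi>. clinear \<phi> \<Longrightarrow> \<phi> (component x n) = \<phi> (component y n)) \<Longrightarrow> x = y"
  by (rule kz_compl_eq_functionalI) (auto simp: coordinate_functionals_def)

text \<open>
  The sum of the series is assembled from its finitely many coordinates in each degree.
\<close>

lemma kz_series_exists:
  assumes deg: "\<And>n m k. h n m k \<in> uea_deg n"
    and tame: "\<And>n \<phi>. clinear \<phi> \<Longrightarrow> tame (\<lambda>m k. \<phi> (h n m k))" and z: "z \<in> bidisc"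
  shows "\<exists>X. \<forall>\<phi> n. clinear \<phi> \<longrightarrow> \<phi> (component X n) = double_series (\<lambda>m k. \<phi> (h n m k)) z"
proof -
  have "\<exists>x. x \<in> uea_deg n \<and> (\<forall>\<phi>. clinear \<phi> \<longrightarrow> \<phi> x = double_series (\<lambda>m k. \<phi> (h n m k)) z)" for n
  proof -
    obtain E \<psi> where E: "finite E" "E \<subseteq> uea_deg n" "\<And>e. clinear (\<psi> e)"
      "\<And>x. x \<in> uea_deg n \<Longrightarrow> x = (\<Sum>e\<in>E. \<psi> e x *\<^sub>C e)"
      by (rule uea_deg_coordinates[of n]) blast
    define x where "x = (\<Sum>e\<in>E. double_series (\<lambda>m k. \<psi> e (h n m k)) z *\<^sub>C e)"
    have "x \<in> uea_deg n"
      unfolding x_def using E(2)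
      by (intro uea_deg_sum complex_vector.subspace_scale[OF subspace_uea_deg]) auto
    moreover have "\<phi> x = double_series (\<lambda>m k. \<phi> (h n m k)) z" if \<phi>: "clinear \<phi>" for \<phi>
    proof -
      have "\<phi> (h n m k) = (\<Sum>e\<in>E. \<phi> e * \<psi> e (h n m k))" for m k
        by (subst E(4)[OF deg[of n m k]]) (simp add: clinearD[OF \<phi>] mult.commute)
      then have "double_series (\<lambda>m k. \<phi> (h n m k)) z = (\<Sum>e\<in>E. \<phi> e * double_series (\<lambda>m k. \<psi> e (h n m k)) z)"
        using double_series_sum[of E "\<lambda>e m k. \<phi> e * \<psi> e (h n m k)" z] tame_scale[OF tame[OF E(3)]] z
        by (simp add: double_series_scale)
      then show ?thesis by (simp add: x_def clinearD[OF \<phi>] mult.commute)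
    qed
    ultimately show ?thesis by blast
  qed
  then obtain x where x: "\<And>n. x n \<in> uea_deg n"
    "\<And>n \<phi>. clinear \<phi> \<Longrightarrow> \<phi> (x n) = double_series (\<lambda>m k. \<phi> (h n m k)) z" by metis
  have "component (Abs_kz_compl (Abs_fps x)) n = x n" for n
    by (simp add: component_def Abs_kz_compl_inverse x(1))
  then show ?thesis using x(2) by (intro exI[of _ "Abs_kz_compl (Abs_fps x)"]) simp
qed

definition kz_series :: "(nat \<Rightarrow> nat \<Rightarrow> nat \<Rightarrow> kz_lie uea) \<Rightarrow> complex \<times> complex \<Rightarrow> kz_compl" where
  "kz_series h z = (SOME X. \<forall>\<phi> n. clinear \<phi> \<longrightarrow> \<phi> (component X n) = double_series (\<lambda>m k. \<phi> (h n m k)) z)"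

lemma kz_series_functional:
  assumes "\<And>n m k. h n m k \<in> uea_deg n" "\<And>n \<phi>. clinear \<phi> \<Longrightarrow> tame (\<lambda>m k. \<phi> (h n m k))"
    "z \<in> bidisc" "clinear \<phi>"
  shows "\<phi> (component (kz_series h z) n) = double_series (\<lambda>m k. \<phi> (h n m k)) z"
  using someI_ex[OF kz_series_exists[of h z, OF assms(1-3)]] assms(4) unfolding kz_series_def by blast

definition regular_part :: "nat \<Rightarrow> complex \<times> complex \<Rightarrow> kz_compl" where
  "regular_part \<alpha> = kz_series (kz_coeff \<alpha>)"

lemma tame_kz_coeff: "clinear \<phi> \<Longrightarrow> tame (\<lambda>m k. \<phi> (kz_coeff \<alpha> n m k))"
  using kz_coeff_bounded[of \<phi> \<alpha> n] tame_bounded[of "\<lambda>m k. \<phi> (kz_coeff \<alpha> n m k)"] by blast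

lemma regular_part_functional:
  "z \<in> bidisc \<Longrightarrow> clinear \<phi> \<Longrightarrow>
     \<phi> (component (regular_part \<alpha> z) n) = double_series (\<lambda>m k. \<phi> (kz_coeff \<alpha> n m k)) z"
  unfolding regular_part_def by (intro kz_series_functional kz_coeff_in_deg tame_kz_coeff)

lemma double_series_connection:
  assumes z: "z \<in> bidisc" and \<phi>: "clinear \<phi>"
    and S: "\<And>c C. (\<And>m k. norm (c m k) \<le> C) \<Longrightarrow> tame (T c) \<and> double_series (T c) z = t * double_series c z"
    and T: "\<And>\<psi> m k. clinear \<psi> \<Longrightarrow> \<psi> (S (kz_coeff \<alpha> n) m k) = T (\<lambda>m k. \<psi> (kz_coeff \<alpha> n m k)) m k"
  shows "double_series (\<lambda>m k. \<phi> (connection x a c S (kz_coeff \<alpha> n) m k)) z =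
     \<phi> (x * component (regular_part \<alpha> z) n) - \<phi> (component (regular_part \<alpha> z) n * x)
     + t * \<phi> (a * component (regular_part \<alpha> z) n)
     + fst z * snd z / (1 - fst z * snd z) * \<phi> (c * component (regular_part \<alpha> z) n)"
proof -
  let ?f = "kz_coeff \<alpha> n"
  have lin: "clinear (\<lambda>y. \<phi> (x * y))" "clinear (\<lambda>y. \<phi> (y * x))" "clinear (\<lambda>y. \<phi> (a * y))" "clinear (\<lambda>y. \<phi> (c * y))"
    by (intro clinear_mult_left clinear_mult_right \<phi>)+
  obtain C3 where C3: "\<And>m k. norm (\<phi> (a * ?f m k)) \<le> C3" using kz_coeff_bounded[OF lin(3), of \<alpha> n] by blast
  obtain C4 where C4: "\<And>m k. norm (\<phi> (c * ?f m k)) \<le> C4" using kz_coeff_bounded[OF lin(4), of \<alpha> n] by blast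
  note t12 = tame_kz_coeff[OF lin(1), of \<alpha> n] tame_kz_coeff[OF lin(2), of \<alpha> n]
  have t12': "tame (\<lambda>m k. \<phi> (x * ?f m k) - \<phi> (?f m k * x))"
    using tame_add[OF t12(1) tame_scale[OF t12(2), of "-1"]] by simp
  have t3: "tame (T (\<lambda>m k. \<phi> (a * ?f m k)))"
    and s3: "double_series (T (\<lambda>m k. \<phi> (a * ?f m k))) z = t * double_series (\<lambda>m k. \<phi> (a * ?f m k)) z"
    using S[OF C3] by auto
  have t4: "tame (sum_diag (\<lambda>m k. \<phi> (c * ?f m k)))" by (rule tame_linear_growth(7)[OF C4])
  have s4: "double_series (sum_diag (\<lambda>m k. \<phi> (c * ?f m k))) z
      = fst z * snd z / (1 - fst z * snd z) * double_series (\<lambda>m k. \<phi> (c * ?f m k)) z"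
    by (rule double_series_sums(3)[OF C4 z])
  have eq: "\<phi> (connection x a c S ?f m k) = \<phi> (x * ?f m k) - \<phi> (?f m k * x)
      + T (\<lambda>m k. \<phi> (a * ?f m k)) m k + sum_diag (\<lambda>m k. \<phi> (c * ?f m k)) m k" for m k
    using T[OF lin(3), of m k] double_sum_additive(3)[of "\<lambda>y. \<phi> (c * y)" ?f m k]
    by (simp add: connection_def clinearD[OF \<phi>] distrib_left)
  show ?thesis
    unfolding eq regular_part_functional[OF z lin(1)] regular_part_functional[OF z lin(2)]
      regular_part_functional[OF z lin(3)] regular_part_functional[OF z lin(4)] s3[symmetric] s4[symmetric]
    by (simp add: double_series_add double_series_diff t12 t12' tame_add t3 t4 z)
qed

text \<open>
  For \<open>C = z\<^sub>1 \<partial>H/\<partial>z\<^sub>1\<close> and \<open>C = z\<^sub>2 \<partial>H/\<partial>z\<^sub>2\<close>, with \<open>H\<close> the regular part, this turns the equations between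
  coefficients into the differential equations.
\<close>

lemma kz_series_connection:
  assumes z: "z \<in> bidisc" and deg: "degree_one x" "degree_one a"
    and S: "\<And>c C. (\<And>m k. norm (c m k) \<le> C) \<Longrightarrow> tame (T c) \<and> double_series (T c) z = t * double_series c z"
    and T: "\<And>\<psi> n m k. clinear \<psi> \<Longrightarrow> \<psi> (S (kz_coeff \<alpha> n) m k) = T (\<lambda>m k. \<psi> (kz_coeff \<alpha> n m k)) m k"
    and h: "\<And>m k. h 0 m k = 0"
      "\<And>n m k. h (Suc n) m k = connection (uea_in x) (uea_in a) (uea_in (X12 \<alpha>)) S (kz_coeff \<alpha> n) m k"
    and C: "\<And>\<phi> n. clinear \<phi> \<Longrightarrow> \<phi> (component C n) = double_series (\<lambda>m k. \<phi> (h n m k)) z"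
  shows "C = (of_deg1 x + t *\<^sub>C of_deg1 a + (fst z * snd z / (1 - fst z * snd z)) *\<^sub>C of_deg1 (X12 \<alpha>))
      * regular_part \<alpha> z - regular_part \<alpha> z * of_deg1 x" (is "_ = ?R")
proof (rule kz_compl_eqI_functional)
  fix n \<phi> assume \<phi>: "clinear \<phi>"
  show "\<phi> (component C n) = \<phi> (component ?R n)"
  proof (cases n)
    case 0
    then show ?thesis
      by (simp add: C[OF \<phi>] h clinearD[OF \<phi>] component_of_deg1 deg)
  next
    case (Suc l)
    have "\<phi> (component C n) = double_series (\<lambda>m k. \<phi> (connection (uea_in x) (uea_in a) (uea_in (X12 \<alpha>)) S (kz_coeff \<alpha> l) m k)) z"
      by (simp add: C[OF \<phi>] Suc h(2))
    also have "\<dots> = \<phi> (uea_in x * component (regular_part \<alpha> z) l) - \<phi> (component (regular_part \<alpha> z) l * uea_in x)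
        + t * \<phi> (uea_in a * component (regular_part \<alpha> z) l)
        + fst z * snd z / (1 - fst z * snd z) * \<phi> (uea_in (X12 \<alpha>) * component (regular_part \<alpha> z) l)"
      by (rule double_series_connection[where T = T, OF z \<phi>]) (fact S, fact T)
    also have "\<dots> = \<phi> (component ?R n)"
      by (simp add: Suc distrib_right component_of_deg1_mult deg clinearD[OF \<phi>])
    finally show ?thesis .
  qed
qed

lemma bidisc_eq: "bidisc = ball 0 1 \<times> ball 0 1"
  by (auto simp: bidisc_def)

lemma open_bidisc: "open bidisc" and convex_bidisc: "convex bidisc"
  unfolding bidisc_eq by (intro open_Times convex_Times open_ball convex_ball)+

lemma regular_part_differential:
  assumes z: "z \<in> bidisc"
  obtains A B where "has_differential (regular_part \<alpha>) (\<lambda>h. fst h *\<^sub>C A + snd h *\<^sub>C B) z"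
    "fst z *\<^sub>C A = (of_deg1 (X1 \<alpha>) + (fst z / (1 - fst z)) *\<^sub>C of_deg1 (X11 \<alpha>)
        + (fst z * snd z / (1 - fst z * snd z)) *\<^sub>C of_deg1 (X12 \<alpha>)) * regular_part \<alpha> z
        - regular_part \<alpha> z * of_deg1 (X1 \<alpha>)"
    "snd z *\<^sub>C B = (of_deg1 (X2 \<alpha>) + (snd z / (1 - snd z)) *\<^sub>C of_deg1 (X22 \<alpha>)
        + (fst z * snd z / (1 - fst z * snd z)) *\<^sub>C of_deg1 (X12 \<alpha>)) * regular_part \<alpha> z
        - regular_part \<alpha> z * of_deg1 (X2 \<alpha>)"
proof -
  let ?hA = "\<lambda>n m k. of_nat (Suc m) *\<^sub>C kz_coeff \<alpha> n (Suc m) k"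
  let ?hB = "\<lambda>n m k. of_nat (Suc k) *\<^sub>C kz_coeff \<alpha> n m (Suc k)"
  define A where "A = kz_series ?hA z"
  define B where "B = kz_series ?hB z"
  have A: "\<phi> (component A n) = double_series (\<lambda>m k. of_nat (Suc m) * \<phi> (kz_coeff \<alpha> n (Suc m) k)) z"
    and B: "\<phi> (component B n) = double_series (\<lambda>m k. of_nat (Suc k) * \<phi> (kz_coeff \<alpha> n m (Suc k))) z"
    if \<phi>: "clinear \<phi>" for \<phi> n
  proof -
    have deg: "?hA n m k \<in> uea_deg n" "?hB n m k \<in> uea_deg n" for n m k
      by (intro complex_vector.subspace_scale[OF subspace_uea_deg] kz_coeff_in_deg)+
    have tame: "tame (\<lambda>m k. \<phi> (?hA n m k))" "tame (\<lambda>m k. \<phi> (?hB n m k))" if \<phi>: "clinear \<phi>" for n \<phi>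
    proof -
      obtain C where "\<And>m k. norm (\<phi> (kz_coeff \<alpha> n m k)) \<le> C" using kz_coeff_bounded[OF \<phi>] by blast
      from tame_linear_growth(1,2)[OF this]
      show "tame (\<lambda>m k. \<phi> (?hA n m k))" "tame (\<lambda>m k. \<phi> (?hB n m k))" by (simp_all only: clinearD(2)[OF \<phi>])
    qed
    show "\<phi> (component A n) = double_series (\<lambda>m k. of_nat (Suc m) * \<phi> (kz_coeff \<alpha> n (Suc m) k)) z"
      "\<phi> (component B n) = double_series (\<lambda>m k. of_nat (Suc k) * \<phi> (kz_coeff \<alpha> n m (Suc k))) z"
      using kz_series_functional[of ?hA z \<phi> n, OF deg(1) tame(1) z \<phi>]
        kz_series_functional[of ?hB z \<phi> n, OF deg(2) tame(2) z \<phi>]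
      by (simp_all only: A_def B_def clinearD(2)[OF \<phi>])
  qed
  show ?thesis
  proof (rule that[of A B])
    show "has_differential (regular_part \<alpha>) (\<lambda>h. fst h *\<^sub>C A + snd h *\<^sub>C B) z"
      unfolding has_differential_def
    proof (intro allI impI)
      fix n \<phi> assume \<phi>: "clinear \<phi>"
      obtain C where C: "\<And>m k. norm (\<phi> (kz_coeff \<alpha> n m k)) \<le> C" using kz_coeff_bounded[OF \<phi>] by blast
      have "(double_series (\<lambda>m k. \<phi> (kz_coeff \<alpha> n m k)) has_derivative
         (\<lambda>h. \<phi> (component (fst h *\<^sub>C A + snd h *\<^sub>C B) n))) (at z)"
        using double_series_has_derivative[of "\<lambda>m k. \<phi> (kz_coeff \<alpha> n m k)" C, OF C z]
        by (simp add: clinearD[OF \<phi>] A[OF \<phi>] B[OF \<phi>])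
      then show "((\<lambda>v. \<phi> (component (regular_part \<alpha> v) n)) has_derivative
         (\<lambda>h. \<phi> (component (fst h *\<^sub>C A + snd h *\<^sub>C B) n))) (at z)"
        by (rule has_derivative_transform_within_open[OF _ open_bidisc z])
          (simp add: regular_part_functional \<phi>)
    qed
    have S1: "tame (sum_left c) \<and> double_series (sum_left c) z = fst z / (1 - fst z) * double_series c z"
      and S2: "tame (sum_right c) \<and> double_series (sum_right c) z = snd z / (1 - snd z) * double_series c z"
      if "\<And>m k. norm (c m k) \<le> C" for c C
      using tame_linear_growth(5,6)[of c C, OF that] double_series_sums(1,2)[of c C, OF that z] by auto
    have T1: "\<psi> (sum_left f m k) = sum_left (\<lambda>m k. \<psi> (f m k)) m k"
      and T2: "\<psi> (sum_right f m k) = sum_right (\<lambda>m k. \<psi> (f m k)) m k"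
      if "clinear \<psi>" for \<psi> f m k
      using double_sum_additive(1,2)[of \<psi> f m k] clinearD[OF that] by auto
    show "fst z *\<^sub>C A = (of_deg1 (X1 \<alpha>) + (fst z / (1 - fst z)) *\<^sub>C of_deg1 (X11 \<alpha>)
        + (fst z * snd z / (1 - fst z * snd z)) *\<^sub>C of_deg1 (X12 \<alpha>)) * regular_part \<alpha> z
        - regular_part \<alpha> z * of_deg1 (X1 \<alpha>)"
    proof (rule kz_series_connection[OF z degree_one_X(1,3), where T = sum_left and S = sum_left
        and h = "\<lambda>n m k. of_nat m *\<^sub>C kz_coeff \<alpha> n m k"])
      show "\<phi> (component (fst z *\<^sub>C A) n) = double_series (\<lambda>m k. \<phi> (of_nat m *\<^sub>C kz_coeff \<alpha> n m k)) z"
        if "clinear \<phi>" for \<phi> n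
        by (subst double_series_shift_left) (simp_all add: clinearD[OF that] A[OF that])
    qed (fact S1, fact T1, simp, rule kz_coeff_equations)
    show "snd z *\<^sub>C B = (of_deg1 (X2 \<alpha>) + (snd z / (1 - snd z)) *\<^sub>C of_deg1 (X22 \<alpha>)
        + (fst z * snd z / (1 - fst z * snd z)) *\<^sub>C of_deg1 (X12 \<alpha>)) * regular_part \<alpha> z
        - regular_part \<alpha> z * of_deg1 (X2 \<alpha>)"
    proof (rule kz_series_connection[OF z degree_one_X(2,4), where T = sum_right and S = sum_right
        and h = "\<lambda>n m k. of_nat k *\<^sub>C kz_coeff \<alpha> n m k"])
      show "\<phi> (component (snd z *\<^sub>C B) n) = double_series (\<lambda>m k. \<phi> (of_nat k *\<^sub>C kz_coeff \<alpha> n m k)) z"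
        if "clinear \<phi>" for \<phi> n
        by (subst double_series_shift_right) (simp_all add: clinearD[OF that] B[OF that])
    qed (fact S2, fact T2, simp, rule kz_coeff_equations)
  qed
qed

lemma double_series_single:
  assumes "\<And>m k. m \<noteq> 0 \<or> k \<noteq> 0 \<Longrightarrow> c m k = 0"
  shows "double_series c z = c 0 0"
proof -
  have "double_series c z = (\<Sum>\<^sub>\<infinity>(m, k)\<in>{(0, 0)}. c m k * fst z ^ m * snd z ^ k)"
    unfolding double_series_def
  proof (rule infsum_cong_neutral)
    fix p :: "nat \<times> nat" assume "p \<in> UNIV - {(0, 0)}"
    then show "(case p of (m, k) \<Rightarrow> c m k * fst z ^ m * snd z ^ k) = 0"
      using assms[of "fst p" "snd p"] by (auto simp: case_prod_unfold prod_eq_iff)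
  qed auto
  then show ?thesis by simp
qed

lemma component_regular_part_0:
  assumes "z \<in> bidisc"
  shows "component (regular_part \<alpha> z) 0 = 1"
proof (rule uea_deg_eqI[of _ 0])
  fix \<phi> assume \<phi>: "clinear \<phi>"
  show "\<phi> (component (regular_part \<alpha> z) 0) = \<phi> 1"
    unfolding regular_part_functional[OF assms \<phi>]
    by (subst double_series_single) (auto simp: clinearD[OF \<phi>])
qed (simp_all add: uea_deg_one)

lemma origin_bidisc [simp]: "(0, 0) \<in> bidisc"
  by (simp add: bidisc_def)

lemma regular_part_origin: "regular_part \<alpha> (0, 0) = 1"
proof (rule kz_compl_eqI)
  show "component (regular_part \<alpha> (0, 0)) n = component 1 n" for n
  proof (rule uea_deg_eqI[of _ n])
    fix \<phi> assume \<phi>: "clinear \<phi>"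
    show "\<phi> (component (regular_part \<alpha> (0, 0)) n) = \<phi> (component 1 n)"
      unfolding regular_part_functional[OF origin_bidisc \<phi>] double_series_origin
      by (cases n) (simp_all add: component_one clinearD[OF \<phi>])
  qed simp_all
qed

section \<open>Existence and uniqueness of normalized solutions\<close>

definition vertex_solution :: "nat \<Rightarrow> complex \<times> complex \<Rightarrow> kz_compl" where
  "vertex_solution \<alpha> w = regular_part \<alpha> w * pow_compl (fst w) (of_deg1 (X1 \<alpha>)) * pow_compl (snd w) (of_deg1 (X2 \<alpha>))"

text \<open>
  The terms \<open>- H X\<^sub>i\<close> in the equations of the regular part cancel against the derivatives of the powers.
  For this \<open>X\<^sub>2\<close> has to be moved across the power of \<open>X\<^sub>1\<close>, with which it commutes.
\<close>

lemma vertex_solution_differential: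
  assumes w: "w \<in> bidisc" "fst w \<notin> \<real>\<^sub>\<le>\<^sub>0" "snd w \<notin> \<real>\<^sub>\<le>\<^sub>0"
  shows "has_differential (vertex_solution \<alpha>) (\<lambda>h. KZE2_form \<alpha> w h * vertex_solution \<alpha> w) w"
proof -
  obtain A B where AB: "has_differential (regular_part \<alpha>) (\<lambda>h. fst h *\<^sub>C A + snd h *\<^sub>C B) w"
    "fst w *\<^sub>C A = (of_deg1 (X1 \<alpha>) + (fst w / (1 - fst w)) *\<^sub>C of_deg1 (X11 \<alpha>)
        + (fst w * snd w / (1 - fst w * snd w)) *\<^sub>C of_deg1 (X12 \<alpha>)) * regular_part \<alpha> w
        - regular_part \<alpha> w * of_deg1 (X1 \<alpha>)"
    "snd w *\<^sub>C B = (of_deg1 (X2 \<alpha>) + (snd w / (1 - snd w)) *\<^sub>C of_deg1 (X22 \<alpha>)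
        + (fst w * snd w / (1 - fst w * snd w)) *\<^sub>C of_deg1 (X12 \<alpha>)) * regular_part \<alpha> w
        - regular_part \<alpha> w * of_deg1 (X2 \<alpha>)"
    by (rule regular_part_differential[OF w(1)]) blast
  define H where "H = regular_part \<alpha> w"
  define P1 where "P1 = pow_compl (fst w) (of_deg1 (X1 \<alpha>))"
  define P2 where "P2 = pow_compl (snd w) (of_deg1 (X2 \<alpha>))"
  define x1 x2 where "x1 = of_deg1 (X1 \<alpha>)" and "x2 = of_deg1 (X2 \<alpha>)"
  have nz: "fst w \<noteq> 0" "snd w \<noteq> 0" using w by auto
  have comm: "P1 * x2 = x2 * P1"
    unfolding P1_def x2_def by (intro pow_compl_commute of_deg1_commute X_relations(1) degree_one_X)
  have D1: "has_differential (\<lambda>v. pow_compl (fst v) (of_deg1 (X1 \<alpha>))) (\<lambda>h. (fst h / fst w) *\<^sub>C (x1 * P1)) w"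
    unfolding x1_def P1_def by (rule has_differential_pow_compl[where g = fst and g' = fst, OF degree_one_X(1) _ w(2)]) (auto intro: derivative_intros)
  have D2: "has_differential (\<lambda>v. pow_compl (snd v) (of_deg1 (X2 \<alpha>))) (\<lambda>h. (snd h / snd w) *\<^sub>C (x2 * P2)) w"
    unfolding x2_def P2_def by (rule has_differential_pow_compl[where g = snd and g' = snd, OF degree_one_X(2) _ w(3)]) (auto intro: derivative_intros)
  have "has_differential (vertex_solution \<alpha>) (\<lambda>h.
      ((fst h *\<^sub>C A + snd h *\<^sub>C B) * P1 + H * ((fst h / fst w) *\<^sub>C (x1 * P1))) * P2
      + (H * P1) * ((snd h / snd w) *\<^sub>C (x2 * P2))) w"
    unfolding vertex_solution_def[abs_def] H_def P1_def P2_def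
    by (intro has_differential_mult AB(1) D1[unfolded P1_def] D2[unfolded P2_def])
  moreover have "((fst h *\<^sub>C A + snd h *\<^sub>C B) * P1 + H * ((fst h / fst w) *\<^sub>C (x1 * P1))) * P2
      + (H * P1) * ((snd h / snd w) *\<^sub>C (x2 * P2)) = KZE2_form \<alpha> w h * vertex_solution \<alpha> w" for h
  proof -
    define a1 a2 where "a1 = fst h / fst w" and "a2 = snd h / snd w"
    define F where "F = KZE2_form \<alpha> w h"
    have "fst h *\<^sub>C A + snd h *\<^sub>C B = a1 *\<^sub>C (fst w *\<^sub>C A) + a2 *\<^sub>C (snd w *\<^sub>C B)"
      using nz by (simp add: a1_def a2_def)
    also have "\<dots> = (a1 *\<^sub>C x1 + (a1 * (fst w / (1 - fst w))) *\<^sub>C of_deg1 (X11 \<alpha>) + a2 *\<^sub>C x2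
        + (a2 * (snd w / (1 - snd w))) *\<^sub>C of_deg1 (X22 \<alpha>)
        + (a1 * (fst w * snd w / (1 - fst w * snd w)) + a2 * (fst w * snd w / (1 - fst w * snd w))) *\<^sub>C of_deg1 (X12 \<alpha>)) * H
        - a1 *\<^sub>C (H * x1) - a2 *\<^sub>C (H * x2)"
      unfolding AB(2,3) H_def[symmetric] x1_def[symmetric] x2_def[symmetric]
      by (simp add: complex_vector.scale_right_diff_distrib scaleC_add_right scaleC_add_left distrib_right)
    also have "a1 *\<^sub>C x1 + (a1 * (fst w / (1 - fst w))) *\<^sub>C of_deg1 (X11 \<alpha>) + a2 *\<^sub>C x2
        + (a2 * (snd w / (1 - snd w))) *\<^sub>C of_deg1 (X22 \<alpha>)
        + (a1 * (fst w * snd w / (1 - fst w * snd w)) + a2 * (fst w * snd w / (1 - fst w * snd w))) *\<^sub>C of_deg1 (X12 \<alpha>) = F"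
    proof -
      have "a1 * (fst w / (1 - fst w)) = fst h / (1 - fst w)" "a2 * (snd w / (1 - snd w)) = snd h / (1 - snd w)"
        using nz by (simp_all add: a1_def a2_def)
      moreover have "a1 * (fst w * snd w / (1 - fst w * snd w)) + a2 * (fst w * snd w / (1 - fst w * snd w))
          = (snd w * fst h + fst w * snd h) / (1 - fst w * snd w)"
        using nz by (simp add: a1_def a2_def add_divide_distrib mult_ac)
      ultimately show ?thesis
        by (simp only: F_def KZE2_form_def case_prod_unfold a1_def[symmetric] a2_def[symmetric] x1_def[symmetric] x2_def[symmetric])
    qed
    finally have dH: "fst h *\<^sub>C A + snd h *\<^sub>C B = F * H - a1 *\<^sub>C (H * x1) - a2 *\<^sub>C (H * x2)" .
    have "((fst h *\<^sub>C A + snd h *\<^sub>C B) * P1 + H * (a1 *\<^sub>C (x1 * P1))) * P2 + (H * P1) * (a2 *\<^sub>C (x2 * P2))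
        = F * H * P1 * P2 - a2 *\<^sub>C (H * (x2 * P1) * P2) + a2 *\<^sub>C (H * (P1 * x2) * P2)"
      unfolding dH by (simp add: algebra_simps)
    then show ?thesis
      unfolding comm by (simp add: a1_def a2_def F_def vertex_solution_def H_def P1_def P2_def mult.assoc)
  qed
  ultimately show ?thesis by simp
qed

lemma open_pentagon_bidisc:
  assumes "w \<in> open_pentagon"
  shows "w \<in> bidisc" "fst w \<notin> \<real>\<^sub>\<le>\<^sub>0" "snd w \<notin> \<real>\<^sub>\<le>\<^sub>0"
  using assms by (auto simp: open_pentagon_def bidisc_def complex_nonpos_Reals_iff)

lemma bidisc_mult_ne_1:
  assumes "w \<in> bidisc"
  shows "fst w * snd w \<noteq> 1"
proof -
  have "norm (fst w * snd w) < 1"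
    using assms mult_left_le[of "norm (snd w)" "norm (fst w)"] by (auto simp: bidisc_def norm_mult)
  then show ?thesis by auto
qed

lemma open_pentagon_regular:
  assumes "(z1, z2) \<in> open_pentagon"
  shows "z1 \<noteq> 0" "z2 \<noteq> 0" "1 - z1 \<noteq> 0" "1 - z2 \<noteq> 0" "1 - z1 * z2 \<noteq> 0"
  using assms bidisc_mult_ne_1[OF open_pentagon_bidisc(1)[OF assms]] by (auto simp: open_pentagon_def)

text \<open>
  The part of the bidisc where both coordinates have positive real parts is convex, and there the
  principal logarithms are holomorphic.
\<close>

lemma normalized_vertex_solution: "normalized_solution \<alpha> (vertex_solution \<alpha>)"
proof -
  define D where "D = bidisc \<inter> {w. 0 < Re (fst w)} \<inter> {w. 0 < Re (snd w)}"
  have halfplanes: "{w :: complex \<times> complex. 0 < Re (fst w)} = {z. 0 < Re z} \<times> UNIV"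
    "{w :: complex \<times> complex. 0 < Re (snd w)} = UNIV \<times> {z. 0 < Re z}" by auto
  have "convex D"
    unfolding D_def halfplanes
    by (intro convex_Int convex_Times convex_halfspace_Re_gt convex_bidisc convex_UNIV)
  then have "connected D" by (rule convex_connected)
  moreover have "open D"
    unfolding D_def halfplanes by (intro open_Int open_bidisc open_Times open_UNIV open_halfspace_Re_gt)
  moreover have "open_pentagon \<subseteq> D"
    by (auto simp: D_def open_pentagon_def bidisc_def)
  moreover have "D \<subseteq> regular_points"
  proof
    fix w assume w: "w \<in> D"
    then have "fst w * snd w \<noteq> 1" by (intro bidisc_mult_ne_1) (simp add: D_def)
    then show "w \<in> regular_points"
      using w by (auto simp: D_def bidisc_def regular_points_def)
  qed
  moreover have "KZE2_solution_on \<alpha> D (vertex_solution \<alpha>)"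
    unfolding KZE2_solution_on_def
    by (intro ballI vertex_solution_differential) (auto simp: D_def complex_nonpos_Reals_iff)
  moreover have "holomorphic2_on (regular_part \<alpha>) bidisc"
    unfolding holomorphic2_on_def by (metis regular_part_differential)
  ultimately show ?thesis
    unfolding normalized_solution_def
  proof (intro conjI)
    show "\<exists>N H. open N \<and> (0, 0) \<in> N \<and> holomorphic2_on H N \<and> H (0, 0) = 1 \<and>
        (\<forall>w\<in>N \<inter> open_pentagon. vertex_solution \<alpha> w =
          H w * pow_compl (fst w) (of_deg1 (X1 \<alpha>)) * pow_compl (snd w) (of_deg1 (X2 \<alpha>)))"
      using \<open>holomorphic2_on (regular_part \<alpha>) bidisc\<close> open_bidisc regular_part_origin
      by (intro exI[of _ bidisc] exI[of _ "regular_part \<alpha>"]) (simp add: vertex_solution_def)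
  qed blast
qed

lemma component_form_0: "component (KZE2_form \<alpha> w h) 0 = 0"
  by (simp add: KZE2_form_def case_prod_unfold component_of_deg1)

lemma normalized_solution_differential:
  assumes "normalized_solution \<alpha> G" "w \<in> open_pentagon"
  shows "has_differential G (\<lambda>h. KZE2_form \<alpha> w h * G w) w"
  using assms unfolding normalized_solution_def KZE2_solution_on_def by blast

lemma component_pow_compl_0: "degree_one x \<Longrightarrow> component (pow_compl t (of_deg1 x)) 0 = 1"
  by (simp add: component_pow_compl)

text \<open>
  The comparison principle. As the form \<open>F\<close> has no constant term, the derivative of the lowest
  component of \<open>D\<close> vanishes, and this component is constant. The hypothesis \<open>lowest\<close> has to exclude a
  nonzero constant, usually by a limit along some path.
\<close>

lemma solution_zeroI:
  assumes D: "\<And>w. w \<in> open_pentagon \<Longrightarrow> has_differential D (\<lambda>h. F w h * D w) w"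
    and F: "\<And>w h. component (F w h) 0 = 0"
    and lowest: "\<And>n c. (\<And>w. w \<in> open_pentagon \<Longrightarrow> order_ge n (D w)) \<Longrightarrow>
      (\<And>w. w \<in> open_pentagon \<Longrightarrow> component (D w) n = c) \<Longrightarrow> c = 0"
    and w: "w \<in> open_pentagon"
  shows "D w = 0"
proof -
  have "\<forall>w\<in>open_pentagon. order_ge n (D w)" for n
  proof (induction n)
    case (Suc n)
    obtain c where c: "\<And>w. w \<in> open_pentagon \<Longrightarrow> component (D w) n = c"
      by (rule component_constant_on_pentagon[OF D, of n])
        (use Suc F in \<open>auto simp: component_mult_lowest_right\<close>)
    moreover have "c = 0" by (rule lowest[of n]) (use Suc c in auto)
    ultimately show ?case using Suc by (auto simp: order_ge_def less_Suc_eq)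
  qed (simp add: order_ge_def)
  then show ?thesis using w by (intro kz_compl_eqI) (auto simp: order_ge_def)
qed

lemma real_point_pentagon: "0 < s \<Longrightarrow> s < 1 \<Longrightarrow> 0 < t \<Longrightarrow> t < 1 \<Longrightarrow> (complex_of_real s, complex_of_real t) \<in> open_pentagon"
  by (auto simp: open_pentagon_def)

lemma holomorphic2_tendsto:
  assumes "holomorphic2_on H N" "w \<in> N" "(g \<longlongrightarrow> w) F"
  shows "kz_tendsto (\<lambda>x. H (g x)) (H w) F"
  using assms has_differential_tendsto unfolding holomorphic2_on_def by blast

lemma inverse_sequence_tendsto_0: "(\<lambda>j. complex_of_real (1 / real (j + 2))) \<longlonglongrightarrow> 0"
  using tendsto_of_real[OF LIMSEQ_ignore_initial_segment[OF lim_1_over_n, of 2], where 'a = complex] by simp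

text \<open>
  In the lowest degree the powers act as 1, so the constant is the limit of \<open>H - H'\<close> at the vertex,
  which is \<open>1 - 1\<close>.
\<close>

lemma normalized_solution_unique:
  assumes G: "normalized_solution \<alpha> G" and G': "normalized_solution \<alpha> G'" and w: "w \<in> open_pentagon"
  shows "G w = G' w"
proof -
  obtain N H where H: "open N" "(0, 0) \<in> N" "holomorphic2_on H N" "H (0, 0) = 1"
    "\<And>w. w \<in> N \<inter> open_pentagon \<Longrightarrow>
       G w = H w * pow_compl (fst w) (of_deg1 (X1 \<alpha>)) * pow_compl (snd w) (of_deg1 (X2 \<alpha>))"
    using G unfolding normalized_solution_def by blast
  obtain N' H' where H': "open N'" "(0, 0) \<in> N'" "holomorphic2_on H' N'" "H' (0, 0) = 1"
    "\<And>w. w \<in> N' \<inter> open_pentagon \<Longrightarrow>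
       G' w = H' w * pow_compl (fst w) (of_deg1 (X1 \<alpha>)) * pow_compl (snd w) (of_deg1 (X2 \<alpha>))"
    using G' unfolding normalized_solution_def by blast
  have "G w - G' w = 0"
  proof (rule solution_zeroI[of "\<lambda>w. G w - G' w" "KZE2_form \<alpha>", OF _ component_form_0 _ w])
    show "has_differential (\<lambda>w. G w - G' w) (\<lambda>h. KZE2_form \<alpha> w h * (G w - G' w)) w"
      if "w \<in> open_pentagon" for w
      using has_differential_diff[OF normalized_solution_differential[OF G that] normalized_solution_differential[OF G' that]]
      by (simp add: right_diff_distrib)
    fix n c
    assume low: "\<And>w. w \<in> open_pentagon \<Longrightarrow> order_ge n (G w - G' w)"
      and c: "\<And>w. w \<in> open_pentagon \<Longrightarrow> component (G w - G' w) n = c"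
    let ?w = "\<lambda>j. (complex_of_real (1 / real (j + 2)), complex_of_real (1 / real (j + 2)))"
    have pent: "?w j \<in> open_pentagon" for j by (intro real_point_pentagon) auto
    have lim: "?w \<longlonglongrightarrow> (0, 0)" by (intro tendsto_Pair inverse_sequence_tendsto_0)
    have "\<forall>\<^sub>F j in sequentially. ?w j \<in> N \<inter> N'"
      using lim H(1,2) H'(1,2) by (intro topological_tendstoD) auto
    then have "\<forall>\<^sub>F j in sequentially. component (H (?w j) - H' (?w j)) n = c"
    proof eventually_elim
      case (elim j)
      let ?P = "pow_compl (fst (?w j)) (of_deg1 (X1 \<alpha>)) * pow_compl (snd (?w j)) (of_deg1 (X2 \<alpha>))"
      have P: "component ?P 0 = 1" by (simp add: component_pow_compl_0)
      have eq: "G (?w j) - G' (?w j) = (H (?w j) - H' (?w j)) * ?P"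
        using elim pent[of j] H(5)[of "?w j"] H'(5)[of "?w j"] by (simp add: left_diff_distrib mult.assoc)
      from low[OF pent[of j]] have "order_ge n (H (?w j) - H' (?w j))"
        unfolding eq using P by (rule order_ge_cancel_right)
      from component_mult_lowest_left[OF this, of ?P] show ?case
        using c[OF pent[of j]] unfolding eq P by simp
    qed
    moreover have "kz_tendsto (\<lambda>j. H (?w j) - H' (?w j)) (1 - 1) sequentially"
      using kz_tendsto_diff[OF holomorphic2_tendsto[OF H(3,2) lim] holomorphic2_tendsto[OF H'(3,2) lim]]
      by (simp only: H(4) H'(4))
    ultimately have "component (1 - 1) n = c"
      by (intro kz_tendsto_component_const) auto
    then show "c = 0" by simp
  qed
  then show ?thesis by simp
qed

lemma KZ_solution_eq: "KZ_solution \<alpha> = restrict (vertex_solution \<alpha>) open_pentagon"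
  unfolding KZ_solution_def
proof (rule the_equality)
  show "\<exists>G. normalized_solution \<alpha> G \<and> restrict (vertex_solution \<alpha>) open_pentagon = restrict G open_pentagon"
    using normalized_vertex_solution by blast
  fix L assume "\<exists>G. normalized_solution \<alpha> G \<and> L = restrict G open_pentagon"
  then obtain G where G: "normalized_solution \<alpha> G" "L = restrict G open_pentagon" by blast
  then show "L = restrict (vertex_solution \<alpha>) open_pentagon"
    using normalized_solution_unique[OF G(1) normalized_vertex_solution] by (auto intro: restrict_ext)
qed

section \<open>Restriction to an edge of the pentagon\<close>

lemma double_series_snd_0:
  assumes "tame c" "norm z < 1"
  shows "(\<lambda>m. c m 0 * z ^ m) sums double_series c (z, 0)"
proof -
  have zb: "(z, 0) \<in> bidisc" using assms(2) by (simp add: bidisc_def)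
  have "(case p of (m, k) \<Rightarrow> c m k * z ^ m * 0 ^ k) = 0" if "p \<notin> range (\<lambda>m. (m, 0))" for p
    using that by (cases p) (auto simp: power_0_left image_iff)
  with has_sum_infsum[OF summable_double_series[OF assms(1) zb]]
  have "((\<lambda>(m, k). c m k * z ^ m * 0 ^ k) \<circ> (\<lambda>m. (m, 0)) has_sum double_series c (z, 0)) UNIV"
    by (subst has_sum_inj[symmetric]) (simp_all add: double_series_def inj_on_def)
  then show ?thesis by (intro has_sum_imp_sums) (simp add: o_def)
qed

lemma sum_delete_first:
  "(\<Sum>w\<in>words_of_length (Suc n). delete_first a f w *\<^sub>C uea_word x y w)
     = (\<Sum>v\<in>words_of_length n. f v *\<^sub>C uea_word x y (a # v))"
proof -
  have "(\<Sum>w\<in>words_of_length (Suc n). delete_first a f w *\<^sub>C uea_word x y w)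
      = (\<Sum>w\<in>(#) a ` words_of_length n. delete_first a f w *\<^sub>C uea_word x y w)"
    by (intro sum.mono_neutral_right) (auto simp: delete_first_def split: list.split)
  then show ?thesis by (simp add: sum.reindex)
qed

lemma sum_delete_last:
  "(\<Sum>w\<in>words_of_length (Suc n). delete_last a f w *\<^sub>C uea_word x y w)
     = (\<Sum>v\<in>words_of_length n. f v *\<^sub>C uea_word x y (v @ [a]))"
proof -
  have zero: "delete_last a f w = 0" if "w \<in> words_of_length (Suc n)" "w \<notin> (\<lambda>v. v @ [a]) ` words_of_length n" for w
    using that by (cases w rule: rev_cases) (auto simp: image_iff)
  have "(\<Sum>w\<in>words_of_length (Suc n). delete_last a f w *\<^sub>C uea_word x y w)
      = (\<Sum>w\<in>(\<lambda>v. v @ [a]) ` words_of_length n. delete_last a f w *\<^sub>C uea_word x y w)"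
    by (intro sum.mono_neutral_right) (use zero in auto)
  then show ?thesis by (simp add: sum.reindex inj_on_def)
qed

text \<open>
  On the edge \<open>z\<^sub>2 = 0\<close> only the residues \<open>X\<^sub>1\<close> and \<open>X\<^sub>1\<^sub>1\<close> are left, and the equation for \<open>z\<^sub>1\<close> is the recursion
  of the polylogarithms.
\<close>

lemma kz_coeff_one_variable:
  "kz_coeff \<alpha> n m 0 = (\<Sum>w\<in>words_of_length n. polylog_coeff w m *\<^sub>C uea_word (X1 \<alpha>) (X11 \<alpha>) w)"
proof (induction n arbitrary: m)
  case 0
  show ?case by simp
next
  case (Suc n)
  let ?u = "uea_word (X1 \<alpha>) (X11 \<alpha>)"
  show ?case
  proof (cases "m = 0")
    case True
    have "(\<Sum>w\<in>words_of_length (Suc n). polylog_coeff w 0 *\<^sub>C ?u w) = 0"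
      by (intro sum.neutral) (auto simp: polylog_coeff_0)
    with True show ?thesis by simp
  next
    case False
    have "of_nat m *\<^sub>C kz_coeff \<alpha> (Suc n) m 0
        = uea_in (X1 \<alpha>) * kz_coeff \<alpha> n m 0 - kz_coeff \<alpha> n m 0 * uea_in (X1 \<alpha>)
          + uea_in (X11 \<alpha>) * (\<Sum>l<m. kz_coeff \<alpha> n l 0)"
      unfolding kz_coeff_equations(1) by (simp add: connection_def sum_left_def)
    also have "(\<Sum>l<m. kz_coeff \<alpha> n l 0) = (\<Sum>w\<in>words_of_length n. (\<Sum>l<m. polylog_coeff w l) *\<^sub>C ?u w)"
      unfolding Suc by (subst sum.swap) (simp add: complex_vector.scale_sum_left)
    also have "uea_in (X1 \<alpha>) * kz_coeff \<alpha> n m 0 - kz_coeff \<alpha> n m 0 * uea_in (X1 \<alpha>)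
          + uea_in (X11 \<alpha>) * (\<Sum>w\<in>words_of_length n. (\<Sum>l<m. polylog_coeff w l) *\<^sub>C ?u w)
        = (\<Sum>v\<in>words_of_length n. polylog_coeff v m *\<^sub>C ?u (xi0 # v))
          - (\<Sum>v\<in>words_of_length n. polylog_coeff v m *\<^sub>C ?u (v @ [xi0]))
          + (\<Sum>v\<in>words_of_length n. (\<Sum>l<m. polylog_coeff v l) *\<^sub>C ?u (xi1 # v))"
      unfolding Suc by (simp add: sum_distrib_left sum_distrib_right)
    also have "\<dots> = (\<Sum>w\<in>words_of_length (Suc n). (of_nat m * polylog_coeff w m) *\<^sub>C ?u w)"
      unfolding sum_delete_first[symmetric] sum_delete_last[symmetric] polylog_coeff_rec
      by (simp add: scaleC_add_left complex_vector.scale_left_diff_distrib sum.distrib sum_subtractf)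
    also have "\<dots> = of_nat m *\<^sub>C (\<Sum>w\<in>words_of_length (Suc n). polylog_coeff w m *\<^sub>C ?u w)"
      by (simp add: complex_vector.scale_sum_right)
    finally show ?thesis using False by (simp only: complex_vector.scale_left_imp_eq[of "of_nat m :: complex"] of_nat_eq_0_iff complex_vector.scale_cancel_left) simp
  qed
qed

lemma regular_part_one_variable:
  assumes z: "norm z < 1"
  shows "regular_part \<alpha> (z, 0) = word_series (X1 \<alpha>) (X11 \<alpha>) (\<lambda>w. polylog w z)"
proof (rule kz_compl_eqI_functional)
  fix n \<phi> assume \<phi>: "clinear \<phi>"
  have zb: "(z, 0) \<in> bidisc" using z by (simp add: bidisc_def)
  have "(\<lambda>m. \<phi> (kz_coeff \<alpha> n m 0) * z ^ m) sums \<phi> (component (regular_part \<alpha> (z, 0)) n)"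
    unfolding regular_part_functional[OF zb \<phi>] by (rule double_series_snd_0[OF tame_kz_coeff[OF \<phi>] z])
  moreover have "(\<lambda>m. \<phi> (kz_coeff \<alpha> n m 0) * z ^ m) sums
      (\<Sum>w\<in>words_of_length n. \<phi> (uea_word (X1 \<alpha>) (X11 \<alpha>) w) * polylog w z)"
  proof -
    have "(\<lambda>m. polylog_coeff w m * z ^ m) sums polylog w z" for w
      unfolding polylog_def
      by (intro summable_sums summable_norm_cancel[OF summable_bounded_power[OF norm_polylog_coeff z]])
    then have "(\<lambda>m. \<Sum>w\<in>words_of_length n. \<phi> (uea_word (X1 \<alpha>) (X11 \<alpha>) w) * (polylog_coeff w m * z ^ m)) sums
      (\<Sum>w\<in>words_of_length n. \<phi> (uea_word (X1 \<alpha>) (X11 \<alpha>) w) * polylog w z)"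
      by (intro sums_sum sums_mult)
    then show ?thesis
      by (simp add: kz_coeff_one_variable clinearD[OF \<phi>] sum_distrib_left sum_distrib_right mult_ac)
  qed
  ultimately have "\<phi> (component (regular_part \<alpha> (z, 0)) n)
      = (\<Sum>w\<in>words_of_length n. \<phi> (uea_word (X1 \<alpha>) (X11 \<alpha>) w) * polylog w z)"
    by (rule sums_unique2)
  then show "\<phi> (component (regular_part \<alpha> (z, 0)) n) = \<phi> (component (word_series (X1 \<alpha>) (X11 \<alpha>) (\<lambda>w. polylog w z)) n)"
    by (simp add: component_word_series clinearD[OF \<phi>] mult.commute)
qed

lemma regularized_one_variable:
  assumes "norm z < 1"
  shows "pow_compl (1 - z) (of_deg1 (X11 \<alpha>)) * regular_part \<alpha> (z, 0) * pow_compl z (of_deg1 (X1 \<alpha>))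
     = word_series (X1 \<alpha>) (X11 \<alpha>) (regularized_polylog z)"
  unfolding regular_part_one_variable[OF assms] pow_compl_def
    word_series_power_word[of "X1 \<alpha>" "X11 \<alpha>", OF degree_one_X(1,3), symmetric]
    word_series_mult[OF degree_one_X(1,3)] regularized_polylog_def ..

lemma Phi_word_series: "Phi \<alpha> = word_series (X1 \<alpha>) (X11 \<alpha>) (\<lambda>w. zeta_map (reg10 (word w)))"
  by (simp add: Phi_def Phi_KZ_def word_series_def)

lemma of_deg1_commute_uea:
  assumes "degree_one x" "degree_one y" "of_deg1 x * of_deg1 y = of_deg1 y * of_deg1 x"
  shows "uea_in x * uea_in y = uea_in y * uea_in x"
  using arg_cong[OF assms(3), of "\<lambda>z. component z (Suc (Suc 0))"] assms(1,2)
  by (simp add: component_of_deg1_mult component_of_deg1)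

lemma word_series_commute:
  assumes deg: "degree_one x" "degree_one y" "degree_one c"
    and comm: "of_deg1 c * of_deg1 x = of_deg1 x * of_deg1 c" "of_deg1 c * of_deg1 y = of_deg1 y * of_deg1 c"
  shows "of_deg1 c * word_series x y f = word_series x y f * of_deg1 c"
proof (rule kz_compl_eqI)
  have xy: "uea_in c * uea_in x = uea_in x * uea_in c" "uea_in c * uea_in y = uea_in y * uea_in c"
    using deg comm by (auto intro: of_deg1_commute_uea)
  have word: "uea_in c * uea_word x y w = uea_word x y w * uea_in c" for w
  proof (induction w)
    case (Cons a w)
    then show ?case by (cases a) (simp_all add: mult.assoc[symmetric] xy, simp_all add: mult.assoc)
  qed simp
  show "component (of_deg1 c * word_series x y f) n = component (word_series x y f * of_deg1 c) n" for n
    using deg by (cases n) (simp_all add: component_of_deg1 component_of_deg1_mult component_word_series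
        sum_distrib_left sum_distrib_right word)
qed

section \<open>Conjugation of the regular part by powers\<close>

lemma regular_part_derivative_at_origin:
  obtains B where "kz_tendsto (\<lambda>t. (1 / t) *\<^sub>C (regular_part \<alpha> (0, t) - 1)) B (at 0)"
proof -
  obtain A B where "has_differential (regular_part \<alpha>) (\<lambda>h. fst h *\<^sub>C A + snd h *\<^sub>C B) (0, 0)"
    by (rule regular_part_differential[OF origin_bidisc]) blast
  then have "has_differential (regular_part \<alpha>) (\<lambda>h. fst h *\<^sub>C A + snd h *\<^sub>C B) ((\<lambda>t. (0, t)) 0)" by simp
  have "kz_tendsto (\<lambda>t. (1 / t) *\<^sub>C (regular_part \<alpha> (0, t) - 1)) B (at 0)"
    unfolding kz_tendsto_def
  proof
    fix f assume f: "f \<in> coordinate_functionals"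
    have "((\<lambda>v. f (regular_part \<alpha> v)) has_derivative (\<lambda>h. f (fst h *\<^sub>C A + snd h *\<^sub>C B))) (at ((\<lambda>t. (0, t)) (0 :: complex)))"
      using \<open>has_differential _ _ _\<close> f by (simp add: has_differential_iff)
    moreover have "((\<lambda>t. (0 :: complex, t)) has_derivative (\<lambda>h. (0, h))) (at (0 :: complex))"
      by (auto intro!: derivative_eq_intros)
    ultimately have "((\<lambda>t. f (regular_part \<alpha> (0, t))) has_derivative
        (\<lambda>h. f (fst (0 :: complex, h) *\<^sub>C A + snd (0 :: complex, h) *\<^sub>C B))) (at 0)"
      by (rule has_derivative_compose[rotated])
    moreover have "(\<lambda>h. f (fst (0 :: complex, h) *\<^sub>C A + snd (0 :: complex, h) *\<^sub>C B)) = (*) (f B)"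
      by (simp add: fun_eq_iff coordinate_functional_linear[OF f] mult.commute)
    ultimately have "((\<lambda>t. f (regular_part \<alpha> (0, t))) has_field_derivative f B) (at 0)"
      by (simp only: has_field_derivative_def)
    then have "((\<lambda>t. (f (regular_part \<alpha> (0, t)) - f 1) / t) \<longlongrightarrow> f B) (at 0)"
      unfolding has_field_derivative_iff by (simp add: regular_part_origin)
    then show "((\<lambda>t. f ((1 / t) *\<^sub>C (regular_part \<alpha> (0, t) - 1))) \<longlongrightarrow> f B) (at 0)"
      by (simp only: coordinate_functional_linear[OF f]) simp
  qed
  then show ?thesis by (rule that)
qed

text \<open>
  A sequence of which the logarithm and the square root are explicit.
\<close>

definition fast_sequence :: "nat \<Rightarrow> real" where
  "fast_sequence j = exp (- 2 * real (Suc j))"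

lemma fast_sequence: "0 < fast_sequence j" "fast_sequence j < 1" "fast_sequence \<longlonglongrightarrow> 0"
  "filterlim (\<lambda>j. complex_of_real (fast_sequence j)) (at 0) sequentially"
proof -
  show 1: "0 < fast_sequence j" "fast_sequence j < 1" for j by (simp_all add: fast_sequence_def)
  have "fast_sequence = (\<lambda>j. exp (-2) ^ Suc j)"
    unfolding fast_sequence_def[abs_def] exp_of_nat_mult[symmetric] by (simp only: mult.commute)
  moreover have "(\<lambda>j. exp (-2 :: real) ^ Suc j) \<longlonglongrightarrow> 0"
    by (rule LIMSEQ_Suc[OF LIMSEQ_power_zero]) simp
  ultimately show lim: "fast_sequence \<longlonglongrightarrow> 0" by simp
  have "(\<lambda>j. complex_of_real (fast_sequence j)) \<longlonglongrightarrow> 0"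
    using tendsto_of_real[OF lim, where 'a = complex] by simp
  then show "filterlim (\<lambda>j. complex_of_real (fast_sequence j)) (at 0) sequentially"
    using 1(1) by (auto simp: filterlim_at less_imp_neq[symmetric] intro!: always_eventually)
qed

lemma scaled_pow_compl_tendsto_0:
  assumes x: "degree_one x"
  shows "kz_tendsto (\<lambda>j. complex_of_real (exp (- real (Suc j))) *\<^sub>C
     pow_compl (complex_of_real (fast_sequence j)) (of_deg1 x)) 0 sequentially"
proof -
  have "(\<lambda>j. complex_of_real (exp (- real (Suc j))) * (Ln (complex_of_real (fast_sequence j)) ^ n / fact n * c)) \<longlonglongrightarrow> 0"
    for n c
  proof -
    have "filterlim (\<lambda>j. real (Suc j)) at_top sequentially"
      by (rule filterlim_compose[OF filterlim_real_sequentially filterlim_Suc])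
    from filterlim_compose[OF tendsto_power_div_exp_0[of n] this]
    have "(\<lambda>j. complex_of_real (real (Suc j) ^ n / exp (real (Suc j))) * ((-2) ^ n / fact n * c)) \<longlonglongrightarrow> complex_of_real 0 * ((-2) ^ n / fact n * c)"
      by (intro tendsto_intros)
    moreover have "complex_of_real (exp (- real (Suc j))) * (Ln (complex_of_real (fast_sequence j)) ^ n / fact n * c)
        = complex_of_real (real (Suc j) ^ n / exp (real (Suc j))) * ((-2) ^ n / fact n * c)" for j
    proof -
      have key: "complex_of_real (exp (- a)) * ((b * complex_of_real a) ^ n / fact n * c)
          = complex_of_real (a ^ n / exp a) * (b ^ n / fact n * c)" for a :: real and b :: complex
        by (simp add: power_mult_distrib exp_minus divide_inverse mult_ac)
      have "Ln (complex_of_real (exp (- 2 * a))) = - 2 * complex_of_real a" for a :: real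
        by (subst Ln_of_real) simp_all
      from this[of "real (Suc j)"] show ?thesis unfolding fast_sequence_def by (simp only: key)
    qed
    ultimately show ?thesis by simp
  qed
  then show ?thesis
    by (auto simp: kz_tendsto_def coordinate_functionals_def component_pow_compl[OF x] clinearD mult.assoc)
qed

text \<open>
  The regular part differs from 1 by \<open>O(t)\<close> at \<open>(0, t)\<close>, whereas the components of the powers of \<open>t\<close> grow like
  powers of \<open>log t\<close>. The factor \<open>t\<close> is split as \<open>\<surd>t \<cdot> \<surd>t\<close>, one half for each of the powers.
\<close>

lemma conjugated_regular_part_tendsto:
  assumes x: "degree_one x"
  shows "kz_tendsto (\<lambda>j. pow_compl (complex_of_real (fast_sequence j)) (of_deg1 x)
      * regular_part \<alpha> (0, complex_of_real (fast_sequence j))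
      * pow_compl (complex_of_real (fast_sequence j)) (of_deg1 (- x))) 1 sequentially"
proof -
  obtain B where B: "kz_tendsto (\<lambda>t. (1 / t) *\<^sub>C (regular_part \<alpha> (0, t) - 1)) B (at 0)"
    by (rule regular_part_derivative_at_origin)
  let ?e = "\<lambda>j. complex_of_real (fast_sequence j)" and ?r = "\<lambda>j. complex_of_real (exp (- real (Suc j)))"
  let ?P = "\<lambda>j. pow_compl (?e j) (of_deg1 x)" and ?Q = "\<lambda>j. pow_compl (?e j) (of_deg1 (- x))"
  let ?K = "\<lambda>j. (1 / ?e j) *\<^sub>C (regular_part \<alpha> (0, ?e j) - 1)"
  have K: "kz_tendsto ?K B sequentially"
    using B filterlim_compose[OF _ fast_sequence(4)] unfolding kz_tendsto_def by blast
  have inv: "?P j * ?Q j = 1" for j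
    using exp_compl_inverse[OF x, of "Ln (?e j)"] by (simp add: pow_compl_def of_deg1_uminus[OF x])
  \<comment> \<open>\<open>?r j\<close> is the square root of \<open>?e j\<close>\<close>
  let ?T = "\<lambda>j. (?r j *\<^sub>C ?P j) * ?K j * (?r j *\<^sub>C ?Q j)"
  have "kz_tendsto (\<lambda>j. 1 - (0 - ?T j)) (1 - (0 - 0 * B * 0)) sequentially"
    by (intro kz_tendsto_diff kz_tendsto_mult kz_tendsto_const K scaled_pow_compl_tendsto_0 x degree_one_uminus)
  moreover have "1 - (0 - ?T j) = ?P j * regular_part \<alpha> (0, ?e j) * ?Q j" for j
  proof -
    have "?r j * ?r j = ?e j"
      by (simp add: fast_sequence_def exp_of_real[symmetric] exp_add[symmetric])
    moreover have "?e j \<noteq> 0" using fast_sequence(1)[of j] by simp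
    ultimately have "?T j = ?P j * (regular_part \<alpha> (0, ?e j) - 1) * ?Q j"
      by (simp add: mult_ac)
    then show ?thesis by (simp only:) (simp add: right_diff_distrib left_diff_distrib inv)
  qed
  ultimately show ?thesis by (simp only: mult_zero_left mult_zero_right diff_zero)
qed

section \<open>Connection of neighbouring vertices\<close>

lemma next_coords_pentagon: "w \<in> open_pentagon \<Longrightarrow> next_coords w \<in> open_pentagon"
proof -
  assume "w \<in> open_pentagon"
  then obtain s t where w: "w = (complex_of_real s, complex_of_real t)" and st: "0 < s" "s < 1" "0 < t" "t < 1"
    by (auto simp: open_pentagon_def)
  have "s * t < s" using st by simp
  then have "s * t < 1" using st by linarith
  then have "0 < 1 - s * t" "0 < 1 - s" "1 - s < 1 - s * t" using st \<open>s * t < s\<close> by linarith+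
  then have "0 < (1 - s) / (1 - s * t)" "(1 - s) / (1 - s * t) < 1"
    by (simp_all only: divide_pos_pos divide_less_eq_1_pos)
  from real_point_pentagon[OF st(3,4) this] show ?thesis
    by (simp add: next_coords_def w)
qed

lemma next_coords_differential:
  assumes "fst w * snd w \<noteq> 1"
  shows "(next_coords has_derivative (\<lambda>h. (snd h,
      (- fst h * (1 - fst w * snd w) + (1 - fst w) * (snd w * fst h + fst w * snd h)) / (1 - fst w * snd w)\<^sup>2))) (at w)"
proof -
  have "((\<lambda>v. (snd v, (1 - fst v) / (1 - fst v * snd v))) has_derivative (\<lambda>h. (snd h,
      (- fst h * (1 - fst w * snd w) + (1 - fst w) * (snd w * fst h + fst w * snd h)) / (1 - fst w * snd w)\<^sup>2))) (at w)"
    using assms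
    by (auto intro!: derivative_eq_intros simp: fun_eq_iff divide_simps power2_eq_square) (simp_all add: algebra_simps)
  then show ?thesis by (simp add: next_coords_def case_prod_unfold)
qed

text \<open>
  All five equations are the same one. With \<open>q\<close> the second new coordinate, \<open>1 - q\<close> and \<open>1 - z\<^sub>2 q\<close> are
  products of powers of \<open>z\<^sub>1\<close>, \<open>1 - z\<^sub>2\<close> and \<open>1 - z\<^sub>1 z\<^sub>2\<close>; so the logarithmic forms of the new
  coordinates are integral combinations of the old ones, and the residues match by \<open>X_successor\<close>.
\<close>

lemma KZE2_form_next:
  assumes w: "w \<in> open_pentagon"
  shows "KZE2_form (Suc \<alpha>) (next_coords w) (snd h,
      (- fst h * (1 - fst w * snd w) + (1 - fst w) * (snd w * fst h + fst w * snd h)) / (1 - fst w * snd w)\<^sup>2)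
      = KZE2_form \<alpha> w h"
proof -
  obtain z1 z2 where wz: "w = (z1, z2)" by (cases w)
  obtain h1 h2 where hh: "h = (h1, h2)" by (cases h)
  note nz = open_pentagon_regular[OF w[unfolded wz]]
  define q where "q = (1 - z1) / (1 - z1 * z2)"
  define k2 where "k2 = (- h1 * (1 - z1 * z2) + (1 - z1) * (z2 * h1 + z1 * h2)) / (1 - z1 * z2)\<^sup>2"
  define a b c e p where "a = h2 / (1 - z2)" and "b = h1 / (1 - z1)" and "c = h1 / z1"
    and "e = (z2 * h1 + z1 * h2) / (1 - z1 * z2)" and "p = h2 / z2"
  have q1: "1 - q = z1 * (1 - z2) / (1 - z1 * z2)" and q2: "1 - z2 * q = (1 - z2) / (1 - z1 * z2)"
    using nz by (simp_all add: q_def field_simps)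
  have "q \<noteq> 0" "1 - q \<noteq> 0" "1 - z2 * q \<noteq> 0" unfolding q1 q2 using nz by (simp_all add: q_def)
  have c2: "k2 / q = e - b"
    using nz by (simp add: q_def k2_def e_def b_def power2_eq_square divide_simps; simp add: algebra_simps)
  have c22: "k2 / (1 - q) = a - c - e"
    unfolding q1 using nz by (simp add: k2_def a_def c_def e_def power2_eq_square divide_simps; simp add: algebra_simps)
  have c12: "(q * h2 + z2 * k2) / (1 - z2 * q) = a - e"
    unfolding q2 using nz
    by (simp add: q_def k2_def a_def e_def power2_eq_square divide_simps; simp add: algebra_simps)
  have neg: "of_deg1 (X2 (Suc \<alpha>)) = - of_deg1 (X11 \<alpha>)" "of_deg1 (X22 (Suc \<alpha>)) = - of_deg1 (X1 \<alpha>)"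
    "of_deg1 (X1 (Suc \<alpha>)) = of_deg1 (X2 \<alpha>)"
    by (simp_all add: X_successor of_deg1_uminus)
  have add: "degree_one (x + y)" if "degree_one x" "degree_one y" for x y
    using that complex_vector.subspace_add[OF subspace_uea_deg] by (simp add: degree_one_def)
  have s22: "of_deg1 (X11 (Suc \<alpha>)) = of_deg1 (X22 \<alpha>) - of_deg1 (X22 (Suc \<alpha>)) - of_deg1 (X12 (Suc \<alpha>))"
    using arg_cong[OF X_successor(4)[of \<alpha>], of of_deg1] by (simp add: of_deg1_add add algebra_simps)
  have "X2 (Suc \<alpha>) + - X22 (Suc \<alpha>) + - X12 (Suc \<alpha>) = X12 \<alpha>"
    using X_successor(5)[of \<alpha>] by simp
  moreover have "of_deg1 (X2 (Suc \<alpha>) + - X22 (Suc \<alpha>) + - X12 (Suc \<alpha>))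
      = of_deg1 (X2 (Suc \<alpha>)) + - of_deg1 (X22 (Suc \<alpha>)) + - of_deg1 (X12 (Suc \<alpha>))"
    by (simp only: of_deg1_add of_deg1_uminus add degree_one_uminus degree_one_X)
  ultimately have s12: "of_deg1 (X12 (Suc \<alpha>)) = of_deg1 (X2 (Suc \<alpha>)) - of_deg1 (X22 (Suc \<alpha>)) - of_deg1 (X12 \<alpha>)"
    by (simp add: algebra_simps)
  have "KZE2_form (Suc \<alpha>) (z2, q) (h2, k2) = p *\<^sub>C of_deg1 (X1 (Suc \<alpha>)) + a *\<^sub>C of_deg1 (X11 (Suc \<alpha>))
      + (e - b) *\<^sub>C of_deg1 (X2 (Suc \<alpha>)) + (a - c - e) *\<^sub>C of_deg1 (X22 (Suc \<alpha>)) + (a - e) *\<^sub>C of_deg1 (X12 (Suc \<alpha>))"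
    unfolding KZE2_form_def prod.case c2 c22 c12 a_def[symmetric] p_def[symmetric] ..
  also have "\<dots> = c *\<^sub>C of_deg1 (X1 \<alpha>) + b *\<^sub>C of_deg1 (X11 \<alpha>) + p *\<^sub>C of_deg1 (X2 \<alpha>)
      + a *\<^sub>C of_deg1 (X22 \<alpha>) + e *\<^sub>C of_deg1 (X12 \<alpha>)"
    unfolding s22 s12 neg
    by (simp add: scaleC_add_right complex_vector.scale_left_diff_distrib complex_vector.scale_right_diff_distrib algebra_simps)
  also have "\<dots> = KZE2_form \<alpha> (z1, z2) (h1, h2)"
    unfolding KZE2_form_def prod.case a_def b_def c_def e_def p_def ..
  finally show ?thesis
    by (simp add: wz hh next_coords_def q_def k2_def)
qed

lemma vertex_solution_pentagon_differential:
  "w \<in> open_pentagon \<Longrightarrow> has_differential (vertex_solution \<alpha>) (\<lambda>h. KZE2_form \<alpha> w h * vertex_solution \<alpha> w) w"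
  by (intro vertex_solution_differential open_pentagon_bidisc)

text \<open>
  The lowest component of the difference of both sides is a constant \<open>c\<close>, which is computed in two steps:
  at the edge \<open>z\<^sub>2 = 0\<close>, after the common factor \<open>z\<^sub>2\<^sup>X\<close> with \<open>X = X\<^sub>2\<^sup>(\<^sup>\<alpha>\<^sup>)\<close> has been split off on the right,
  and then for \<open>z\<^sub>1 \<longrightarrow> 1\<close>, after multiplication by \<open>(1 - z\<^sub>1)\<^sup>B\<close> with \<open>B = X\<^sub>1\<^sub>1\<^sup>(\<^sup>\<alpha>\<^sup>)\<close> on the left. As these
  factors have constant term 1, neither operation changes \<open>c\<close>.
\<close>

lemma vertex_solution_connection:
  assumes w: "w \<in> open_pentagon"
  shows "vertex_solution \<alpha> w = vertex_solution (Suc \<alpha>) (next_coords w) * Phi \<alpha>"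
proof -
  let ?X2 = "of_deg1 (X2 \<alpha>)" and ?X1 = "of_deg1 (X1 \<alpha>)" and ?Y = "of_deg1 (- X11 \<alpha>)"
  define D where "D w = vertex_solution \<alpha> w - vertex_solution (Suc \<alpha>) (next_coords w) * Phi \<alpha>" for w
  \<comment> \<open>\<open>E\<close> is \<open>D\<close> without the common right factor \<open>z\<^sub>2\<^sup>X\<close>, \<open>X = X\<^sub>2\<^sup>(\<^sup>\<alpha>\<^sup>)\<close>; recall \<open>X\<^sub>2\<^sup>(\<^sup>\<alpha>\<^sup>+\<^sup>1\<^sup>) = - X\<^sub>1\<^sub>1\<^sup>(\<^sup>\<alpha>\<^sup>)\<close>\<close>
  define E where "E w = regular_part \<alpha> w * pow_compl (fst w) ?X1
      - regular_part (Suc \<alpha>) (next_coords w) * pow_compl (snd (next_coords w)) ?Y * Phi \<alpha>" for w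
  have degY: "degree_one (- X11 \<alpha>)" by (intro degree_one_uminus degree_one_X)
  have comm1: "?X2 * ?X1 = ?X1 * ?X2"
    by (rule of_deg1_commute[symmetric]) (simp_all add: X_relations)
  have comm11: "?X2 * of_deg1 (X11 \<alpha>) = of_deg1 (X11 \<alpha>) * ?X2"
    by (rule of_deg1_commute[symmetric]) (simp_all add: X_relations)
  then have commY: "?X2 * ?Y = ?Y * ?X2" by (simp add: of_deg1_uminus)
  have commPhi: "?X2 * Phi \<alpha> = Phi \<alpha> * ?X2"
    unfolding Phi_word_series by (rule word_series_commute) (simp_all add: comm1 comm11)
  have D_E: "D w = E w * pow_compl (snd w) ?X2" for w
  proof -
    have Y: "pow_compl s ?X2 * pow_compl t ?Y = pow_compl t ?Y * pow_compl s ?X2" for s t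
      by (rule pow_compl_commute[OF degree_one_X(2)], rule pow_compl_commute[OF degY, symmetric]) (simp add: commY)
    have P: "pow_compl s ?X2 * Phi \<alpha> = Phi \<alpha> * pow_compl s ?X2" for s
      by (rule pow_compl_commute[OF degree_one_X(2) commPhi])
    have "vertex_solution (Suc \<alpha>) (next_coords w) * Phi \<alpha>
        = regular_part (Suc \<alpha>) (next_coords w) * (pow_compl (snd w) ?X2 * pow_compl (snd (next_coords w)) ?Y) * Phi \<alpha>"
      by (simp add: vertex_solution_def X_successor next_coords_def case_prod_unfold mult.assoc)
    also have "\<dots> = regular_part (Suc \<alpha>) (next_coords w) * pow_compl (snd (next_coords w)) ?Y * (pow_compl (snd w) ?X2 * Phi \<alpha>)"
      unfolding Y by (simp add: mult.assoc)
    also have "\<dots> = regular_part (Suc \<alpha>) (next_coords w) * pow_compl (snd (next_coords w)) ?Y * Phi \<alpha> * pow_compl (snd w) ?X2"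
      unfolding P by (simp add: mult.assoc)
    finally show ?thesis by (simp add: D_def E_def vertex_solution_def left_diff_distrib)
  qed
  have "D w = 0"
  proof (rule solution_zeroI[of D "KZE2_form \<alpha>", OF _ component_form_0 _ w])
    fix w assume w: "w \<in> open_pentagon"
    have "fst w * snd w \<noteq> 1" by (rule bidisc_mult_ne_1[OF open_pentagon_bidisc(1)[OF w]])
    from has_differential_compose[OF vertex_solution_pentagon_differential[OF next_coords_pentagon[OF w]]
        next_coords_differential[OF this], of "Suc \<alpha>"]
    have "has_differential (\<lambda>w. vertex_solution (Suc \<alpha>) (next_coords w))
       (\<lambda>h. KZE2_form \<alpha> w h * vertex_solution (Suc \<alpha>) (next_coords w)) w"
      by (simp only: KZE2_form_next[OF w])
    from has_differential_diff[OF vertex_solution_pentagon_differential[OF w] has_differential_mult[OF this has_differential_const], of \<alpha> "Phi \<alpha>"]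
    show "has_differential D (\<lambda>h. KZE2_form \<alpha> w h * D w) w"
      unfolding D_def[abs_def] by (simp add: right_diff_distrib mult.assoc)
  next
    fix n c
    assume low: "\<And>w. w \<in> open_pentagon \<Longrightarrow> order_ge n (D w)"
      and c: "\<And>w. w \<in> open_pentagon \<Longrightarrow> component (D w) n = c"
    have E_low: "order_ge n (E w)" and E_n: "component (E w) n = c" if w: "w \<in> open_pentagon" for w
    proof -
      have P: "component (pow_compl (snd w) ?X2) 0 = 1" by (simp add: component_pow_compl_0)
      show "order_ge n (E w)" using low[OF w] P unfolding D_E by (rule order_ge_cancel_right)
      from component_mult_lowest_left[OF this, of "pow_compl (snd w) ?X2"]
      show "component (E w) n = c" using c[OF w] P unfolding D_E by simp
    qed
    \<comment> \<open>the limit of \<open>E\<close> at the point \<open>z\<^sub>1 = s\<close> of the edge \<open>z\<^sub>2 = 0\<close>\<close>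
    define E0 where "E0 s = regular_part \<alpha> (complex_of_real s, 0) * pow_compl (complex_of_real s) ?X1
       - regular_part (Suc \<alpha>) (0, complex_of_real (1 - s)) * pow_compl (complex_of_real (1 - s)) ?Y * Phi \<alpha>" for s
    have E0: "order_ge n (E0 s)" "component (E0 s) n = c" if s: "0 < s" "s < 1" for s
    proof -
      let ?w = "\<lambda>j. (complex_of_real s, complex_of_real (1 / real (j + 2)))"
      have pent: "?w j \<in> open_pentagon" for j using s by (intro real_point_pentagon) auto
      have lim: "?w \<longlonglongrightarrow> (complex_of_real s, 0)" by (intro tendsto_Pair tendsto_const inverse_sequence_tendsto_0)
      have "(\<lambda>j. next_coords (?w j)) \<longlonglongrightarrow> (0, (1 - complex_of_real s) / (1 - complex_of_real s * 0))"
        unfolding next_coords_def prod.case by (intro tendsto_intros inverse_sequence_tendsto_0) auto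
      then have lim': "(\<lambda>j. next_coords (?w j)) \<longlonglongrightarrow> (0, complex_of_real (1 - s))" by simp
      have b: "(complex_of_real s, 0) \<in> bidisc" "(0, complex_of_real (1 - s)) \<in> bidisc"
        using s by (auto simp: bidisc_def simp del: of_real_diff)
      have hol: "holomorphic2_on (regular_part \<beta>) bidisc" for \<beta>
        unfolding holomorphic2_on_def by (metis regular_part_differential)
      have "kz_tendsto (\<lambda>j. E (?w j)) (E0 s) sequentially"
        unfolding E_def E0_def
      proof (intro kz_tendsto_diff kz_tendsto_mult kz_tendsto_const holomorphic2_tendsto[OF hol b(1) lim]
          holomorphic2_tendsto[OF hol b(2) lim'])
        show "kz_tendsto (\<lambda>j. pow_compl (fst (?w j)) ?X1) (pow_compl (complex_of_real s) ?X1) sequentially"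
          by (simp add: kz_tendsto_const)
        show "kz_tendsto (\<lambda>j. pow_compl (snd (next_coords (?w j))) ?Y) (pow_compl (complex_of_real (1 - s)) ?Y) sequentially"
          using tendsto_snd[OF lim'] s
          by (intro kz_tendsto_pow_compl[OF degY]) (auto simp: complex_nonpos_Reals_iff)
      qed
      note this' = kz_tendsto_component_const[OF this]
      show "component (E0 s) n = c" by (rule this') (use E_n[OF pent] in auto)
      show "order_ge n (E0 s)"
        unfolding order_ge_def by (intro allI impI this') (use E_low[OF pent] in \<open>auto simp: order_ge_def\<close>)
    qed
    \<comment> \<open>along the edge to the next vertex\<close>
    let ?s = "\<lambda>j. 1 - fast_sequence j"
    let ?L = "\<lambda>j. pow_compl (complex_of_real (1 - ?s j)) (of_deg1 (X11 \<alpha>))"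
    have "kz_tendsto (\<lambda>j. ?L j * E0 (?s j)) (Phi \<alpha> - 1 * Phi \<alpha>) sequentially"
    proof -
      have eq: "?L j * E0 (?s j) = word_series (X1 \<alpha>) (X11 \<alpha>) (regularized_polylog (complex_of_real (?s j)))
          - (pow_compl (complex_of_real (fast_sequence j)) (of_deg1 (X11 \<alpha>))
             * regular_part (Suc \<alpha>) (0, complex_of_real (fast_sequence j))
             * pow_compl (complex_of_real (fast_sequence j)) ?Y) * Phi \<alpha>" for j
      proof -
        have "norm (complex_of_real (?s j)) < 1"
          using fast_sequence(1,2)[of j] by (simp del: of_real_diff)
        from regularized_one_variable[OF this, of \<alpha>] show ?thesis
          by (simp add: E0_def right_diff_distrib mult.assoc)
      qed
      have "filterlim ?s (at_left 1) sequentially"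
        unfolding filterlim_at
        using fast_sequence(1) tendsto_diff[OF tendsto_const[of 1] fast_sequence(3)]
        by (auto intro!: always_eventually simp: less_imp_neq)
      then have "kz_tendsto (\<lambda>j. word_series (X1 \<alpha>) (X11 \<alpha>) (regularized_polylog (complex_of_real (?s j)))) (Phi \<alpha>) sequentially"
        unfolding Phi_word_series
        by (intro kz_tendsto_word_series degree_one_X filterlim_compose[OF regularized_polylog_tendsto])
      then show ?thesis
        unfolding eq
        by (intro kz_tendsto_diff kz_tendsto_mult kz_tendsto_const conjugated_regular_part_tendsto degree_one_X)
    qed
    moreover have "component (?L j * E0 (?s j)) n = c" for j
      using component_mult_lowest_right[OF E0(1)[of "?s j"], of "?L j"] E0(2)[of "?s j"] fast_sequence(1,2)[of j]
      by (simp add: component_pow_compl_0)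
    ultimately have "component (Phi \<alpha> - 1 * Phi \<alpha>) n = c"
      by (intro kz_tendsto_component_const) auto
    then show "c = 0" by simp
  qed
  then show ?thesis by (simp add: D_def)
qed

section \<open>The pentagon relation\<close>

lemma coords_period:
  assumes "w \<in> open_pentagon"
  shows "coords 5 w = w"
proof -
  obtain z1 z2 where w: "w = (z1, z2)" by (cases w)
  note nz = open_pentagon_regular[OF assms[unfolded w]]
  let ?q = "(1 - z1) / (1 - z1 * z2)" and ?r = "(1 - z2) / (1 - z1 * z2)"
  have 1: "next_coords (z1, z2) = (z2, ?q)" by (simp add: next_coords_def)
  have "1 - z2 * ?q = ?r" using nz by (simp add: field_simps)
  then have 2: "next_coords (z2, ?q) = (?q, 1 - z1 * z2)" using nz by (simp add: next_coords_def)
  have "1 - ?q = z1 * ?r" using nz by (simp add: field_simps)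
  then have 3: "next_coords (?q, 1 - z1 * z2) = (1 - z1 * z2, ?r)" using nz by (simp add: next_coords_def)
  have 4: "next_coords (1 - z1 * z2, ?r) = (?r, z1)" using nz by (simp add: next_coords_def)
  have "1 - ?r = z2 * ?q" "1 - ?r * z1 = ?q" using nz by (simp_all add: field_simps)
  then have 5: "next_coords (?r, z1) = (z1, z2)" using nz by (simp add: next_coords_def)
  show ?thesis by (simp add: coords_def w eval_nat_numeral 1 2 3 4 5)
qed

lemma coords_pentagon: "w \<in> open_pentagon \<Longrightarrow> coords \<alpha> w \<in> open_pentagon"
  by (induction \<alpha>) (simp_all add: coords_def next_coords_pentagon)

lemma vertex_solution_period: "vertex_solution 5 = vertex_solution 0"
proof -
  have "kz_coeff 5 n = kz_coeff 0 n" for n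
    by (induction n) (simp_all add: X_period)
  then have "kz_coeff 5 = kz_coeff 0" by (rule ext)
  then show ?thesis by (simp add: vertex_solution_def[abs_def] regular_part_def X_period)
qed

theorem theorem15:
  shows "(\<forall>\<alpha> < 5. \<forall>z \<in> open_pentagon.
            KZ_solution \<alpha> (coords \<alpha> z) =
            KZ_solution ((\<alpha> + 1) mod 5) (coords ((\<alpha> + 1) mod 5) z) * Phi \<alpha>)
       \<and> Phi 4 * Phi 3 * Phi 2 * Phi 1 * Phi 0 = 1"
proof -
  have solution: "KZ_solution \<alpha> (coords \<alpha> z) = vertex_solution \<alpha> (coords \<alpha> z)" if "z \<in> open_pentagon" for \<alpha> z
    using coords_pentagon[OF that] by (simp add: KZ_solution_eq)
  have step: "vertex_solution \<alpha> (coords \<alpha> z) = vertex_solution (Suc \<alpha>) (coords (Suc \<alpha>) z) * Phi \<alpha>"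
    if "z \<in> open_pentagon" for \<alpha> z
    using vertex_solution_connection[OF coords_pentagon[OF that]] by (simp add: coords_def)
  have periodic: "vertex_solution (Suc \<alpha>) (coords (Suc \<alpha>) z)
      = vertex_solution ((\<alpha> + 1) mod 5) (coords ((\<alpha> + 1) mod 5) z)"
    if "\<alpha> < 5" "z \<in> open_pentagon" for \<alpha> z
  proof (cases "\<alpha> = 4")
    case True
    then show ?thesis
      using vertex_solution_period coords_period[OF that(2)] by (simp add: coords_def)
  next
    case False
    with that have "(\<alpha> + 1) mod 5 = Suc \<alpha>" by simp
    then show ?thesis by simp
  qed
  define z where "z = (complex_of_real (1/2), complex_of_real (1/2))"
  have z: "z \<in> open_pentagon" unfolding z_def by (intro real_point_pentagon) auto
  have "vertex_solution 0 z = vertex_solution 5 (coords 5 z) * Phi 4 * Phi 3 * Phi 2 * Phi 1 * Phi 0"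
    using step[OF z, of 0] step[OF z, of 1] step[OF z, of 2] step[OF z, of 3] step[OF z, of 4]
    by (simp add: coords_def numeral_eq_Suc)
  then have "vertex_solution 0 z * (Phi 4 * Phi 3 * Phi 2 * Phi 1 * Phi 0) = vertex_solution 0 z * 1"
    by (simp add: vertex_solution_period coords_period[OF z] mult.assoc)
  moreover have "component (vertex_solution 0 z) 0 = 1"
    using component_regular_part_0[OF open_pentagon_bidisc(1)[OF z]]
    by (simp add: vertex_solution_def component_pow_compl_0)
  ultimately have "Phi 4 * Phi 3 * Phi 2 * Phi 1 * Phi 0 = 1"
    by (rule left_cancel_unipotent)
  moreover have "KZ_solution \<alpha> (coords \<alpha> z) = KZ_solution ((\<alpha> + 1) mod 5) (coords ((\<alpha> + 1) mod 5) z) * Phi \<alpha>"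
    if "\<alpha> < 5" "z \<in> open_pentagon" for \<alpha> z
    unfolding solution[OF that(2)] periodic[OF that, symmetric] by (rule step[OF that(2)])
  ultimately show ?thesis by blast
qed

end
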